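(* Let $m\ge2$, let $n_{\mathrm{mc}}(T)$ be the number of maximal clades in an $m$-ary tree $T$, and let $T_n$ be the random $m$-ary search tree with $n$ keys. Then, as $n\to\infty$, $$\frac{n_{\mathrm{mc}}(T_n)}{|T_n|}\longrightarrow P_{\mathrm{mc}}(m):=\mathbb P\bigl(o\text{ is a maximal clade in }\widetilde{\mathcal T}\bigr)\quad\text{almost surely},$$ where $\widetilde{\mathcal T}$ is the limiting random infinite tree with distinguished node $o$ associated with the $m$-ary search tree.
   Context: A clade in an $m$-ary tree is a node with fewer than $m$ children. A maximal clade is a clade such that no (proper) ancestor is a clade. $|T|$ is the number of nodes. $m$-ary search tree: each node holds up to $m-1$ keys (distinct reals). Start with an empty root. The first $m-1$ keys are stored in the root; when the root becomes full, $m$ new empty nodes are added as its children $1,\dots,m$. The $m-1$ keys divide $\mathbb R$ into intervals $J_1,\dots,J_m$; each further key lying in $J_i$ is passed to child $i$, where the same rule is applied recursively. Finally all empty nodes are deleted; the tree consists of the nodes containing at least one key. $T_n$ is built from the first $n$ terms of an i.i.d. sequence of keys with a continuous distribution. Ordinary individuals: an ordinary individual gets $m$ children in positions $1,\dots,m$, the $i$-th born at age $\sum_{j=2}^{m-1}Y_j+X_i$, where $Y_j\sim\mathrm{Exp}(j)$ (rate $j$), $X_i\sim\mathrm{Exp}(1)$, all independent. An ordinary branching process is started by one ordinary individual, all its descendants being ordinary with independent life histories. The random tree $\widetilde{\mathcal T}$: an individual $o=o^{(0)}$ is born at time 0 and starts an ordinary branching process. It has an infinite line of ancestors $o^{(1)},o^{(2)},\dots$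 ($o^{(k)}$ the parent of $o^{(k-1)}$) with independent life histories of the following modified type: a distinguished child position (the heir) is chosen uniformly at random in $\{1,\dots,m\}$; given that the heir is in position $k$, the children are born at ages $\sum_{j=2}^{m-1}\widetilde Y_j+\widetilde X_i$, $i=1,\dots,m$, with $\widetilde Y_j\sim\mathrm{Exp}(j+1)$, $\widetilde X_k\sim\mathrm{Exp}(2)$ and $\widetilde X_i\sim\mathrm{Exp}(1)$ for $i\ne k$, all independent. The heir of $o^{(k)}$ is $o^{(k-1)}$; this determines the birth times of all $o^{(k)}$ recursively, backwards in time. Every non-heir child of each ancestor starts an independent ordinary branching process. Let $\widetilde{\mathcal T}_t$ be the family tree of all individuals born at or before time $t$, and $\widetilde{\mathcal T}:=\widetilde{\mathcal T}_{\overline\tau}$ where $\overline\tau\sim\mathrm{Exp}(1)$ is independent of everything else. *)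

theory Defs
  imports "HOL-Probability.Probability"
begin

section \<open>Clades in m-ary trees\<close>

text \<open>
  An \<open>m\<close>-ary tree is given by its set \<open>V\<close> of nodes together with a map \<open>ch\<close>, where \<open>ch v i\<close> is the
  potential child of \<open>v\<close> in position \<open>i \<in> {1..m}\<close>; this child is present iff \<open>ch v i \<in> V\<close>.
  As no root is prescribed, an infinite tree with an infinite line of ancestors is covered as well.
\<close>

definition edges :: "nat \<Rightarrow> ('v \<Rightarrow> nat \<Rightarrow> 'v) \<Rightarrow> 'v set \<Rightarrow> ('v \<times> 'v) set" where
  "edges m ch V = {(u, ch u i) | u i. u \<in> V \<and> i \<in> {1..m} \<and> ch u i \<in> V}"

definition proper_ancestor :: "nat \<Rightarrow> ('v \<Rightarrow> nat \<Rightarrow> 'v) \<Rightarrow> 'v set \<Rightarrow> 'v \<Rightarrow> 'v \<Rightarrow> bool" where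
  "proper_ancestor m ch V u v \<longleftrightarrow> (u, v) \<in> (edges m ch V)\<^sup>+"

definition clade :: "nat \<Rightarrow> ('v \<Rightarrow> nat \<Rightarrow> 'v) \<Rightarrow> 'v set \<Rightarrow> 'v \<Rightarrow> bool" where
  "clade m ch V v \<longleftrightarrow> v \<in> V \<and> card {i \<in> {1..m}. ch v i \<in> V} < m"

definition maximal_clade :: "nat \<Rightarrow> ('v \<Rightarrow> nat \<Rightarrow> 'v) \<Rightarrow> 'v set \<Rightarrow> 'v \<Rightarrow> bool" where
  "maximal_clade m ch V v \<longleftrightarrow>
     clade m ch V v \<and> (\<forall>u. proper_ancestor m ch V u v \<longrightarrow> \<not> clade m ch V u)"

definition n_mc :: "nat \<Rightarrow> ('v \<Rightarrow> nat \<Rightarrow> 'v) \<Rightarrow> 'v set \<Rightarrow> nat" where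
  "n_mc m ch V = card {v \<in> V. maximal_clade m ch V v}"


section \<open>The m-ary search tree\<close>

text \<open>
  \<open>Empty\<close> is an empty node. A nonempty node carries its keys in order of arrival; its children in
  positions \<open>1, \<dots>, m\<close> stay \<open>Empty\<close> until the node is full, so that not creating them before that
  moment makes no difference after the final deletion of the empty nodes.
\<close>

datatype stree = Empty | Node "real list" "nat \<Rightarrow> stree"

text \<open>
  Position \<open>i\<close> of the interval \<open>J\<^sub>i\<close> containing \<open>x\<close>, numbered from left to right.
\<close>

definition interval_index :: "real list \<Rightarrow> real \<Rightarrow> nat" where
  "interval_index ks x = Suc (card {k \<in> set ks. k < x})"

primrec insert_key :: "nat \<Rightarrow> real \<Rightarrow> stree \<Rightarrow> stree" where
  "insert_key m x Empty = Node [x] (\<lambda>_. Empty)"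
| "insert_key m x (Node ks c) =
     (if length ks < m - 1 then Node (ks @ [x]) c
      else Node ks (c(interval_index ks x := insert_key m x (c (interval_index ks x)))))"

text \<open>
  Nodes are addressed by their path of child positions from the root.
\<close>

primrec nodes :: "nat \<Rightarrow> stree \<Rightarrow> nat list set" where
  "nodes m Empty = {}"
| "nodes m (Node ks c) = insert [] (\<Union>i\<in>{1..m}. (#) i ` nodes m (c i))"

definition path_child :: "nat list \<Rightarrow> nat \<Rightarrow> nat list" where
  "path_child w i = w @ [i]"

definition search_tree :: "nat \<Rightarrow> (nat \<Rightarrow> real) \<Rightarrow> nat \<Rightarrow> nat list set" where
  "search_tree m x n = nodes m (fold (insert_key m) (map x [0..<n]) Empty)"


section \<open>Life histories\<close>

definition exponential :: "real \<Rightarrow> real measure" where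
  "exponential r = density lborel (\<lambda>x. ennreal (exponential_density r x))"

text \<open>
  Joint law of the ages \<open>(\<Sum>j=2..m-1. Y j) + X i\<close> at which the children \<open>i = 1, \<dots>, m\<close> are born,
  for independent exponential variables with rates \<open>a j\<close> for \<open>Y j\<close> and \<open>b i\<close> for \<open>X i\<close>.
\<close>

definition life_law :: "nat \<Rightarrow> (nat \<Rightarrow> real) \<Rightarrow> (nat \<Rightarrow> real) \<Rightarrow> (nat \<Rightarrow> real) measure" where
  "life_law m a b =
     distr (PiM {2..m-1} (\<lambda>j. exponential (a j)) \<Otimes>\<^sub>M PiM {1..m} (\<lambda>i. exponential (b i)))
       (PiM {1..m} (\<lambda>_. borel))
       (\<lambda>(Y, X). \<lambda>i\<in>{1..m}. (\<Sum>j=2..m-1. Y j) + X i)"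

definition ordinary_law :: "nat \<Rightarrow> (nat \<Rightarrow> real) measure" where
  "ordinary_law m = life_law m real (\<lambda>_. 1)"

text \<open>
  Joint law of the heir's position and of the ages at which the children are born, for the
  ancestors \<open>o\<^sup>(\<^sup>k\<^sup>)\<close>, \<open>k \<ge> 1\<close>.
\<close>

definition ancestor_law :: "nat \<Rightarrow> (nat \<times> (nat \<Rightarrow> real)) measure" where
  "ancestor_law m = measure_pmf (pmf_of_set {1..m}) \<bind> (\<lambda>h.
     distr (life_law m (\<lambda>j. real (j + 1)) (\<lambda>i. if i = h then 2 else 1))
       (count_space UNIV \<Otimes>\<^sub>M PiM {1..m} (\<lambda>_. borel)) (Pair h))"


section \<open>The limiting infinite tree\<close>

text \<open>
  The individual \<open>(k, w)\<close> is the one reached from the ancestor \<open>o\<^sup>(\<^sup>k\<^sup>)\<close> by following the child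
  positions \<open>w\<close>; thus \<open>o\<^sup>(\<^sup>k\<^sup>)\<close> is \<open>(k, [])\<close> and \<open>o\<close> is \<open>(0, [])\<close>. To make this unique, for \<open>k \<ge> 1\<close>
  the path \<open>w\<close> must not start with the position of the heir of \<open>o\<^sup>(\<^sup>k\<^sup>)\<close>.

  Below, \<open>A k\<close> (for \<open>k \<ge> 1\<close>) is the heir position and the life history of \<open>o\<^sup>(\<^sup>k\<^sup>)\<close>, and \<open>L v\<close> is the
  life history of \<open>v\<close> for all other individuals \<open>v\<close>. The values of \<open>L\<close> at pairs that are not
  ordinary individuals are never used.
\<close>

type_synonym indiv = "nat \<times> nat list"
type_synonym anc_lives = "nat \<Rightarrow> nat \<times> (nat \<Rightarrow> real)"
type_synonym ord_lives = "indiv \<Rightarrow> nat \<Rightarrow> real"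

definition individuals :: "nat \<Rightarrow> anc_lives \<Rightarrow> indiv set" where
  "individuals m A =
     {(k, w). set w \<subseteq> {1..m} \<and> (k \<ge> 1 \<and> w \<noteq> [] \<longrightarrow> hd w \<noteq> fst (A k))}"

fun indiv_child :: "anc_lives \<Rightarrow> indiv \<Rightarrow> nat \<Rightarrow> indiv" where
  "indiv_child A (k, w) i =
     (if k \<ge> 1 \<and> w = [] \<and> i = fst (A k) then (k - 1, []) else (k, w @ [i]))"

fun life :: "anc_lives \<Rightarrow> ord_lives \<Rightarrow> indiv \<Rightarrow> nat \<Rightarrow> real" where
  "life A L (k, w) = (if k \<ge> 1 \<and> w = [] then snd (A k) else L (k, w))"

primrec ancestor_birth :: "anc_lives \<Rightarrow> nat \<Rightarrow> real" where
  "ancestor_birth A 0 = 0"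
| "ancestor_birth A (Suc k) = ancestor_birth A k - snd (A (Suc k)) (fst (A (Suc k)))"

fun birth :: "anc_lives \<Rightarrow> ord_lives \<Rightarrow> indiv \<Rightarrow> real" where
  "birth A L (k, w) = ancestor_birth A k + (\<Sum>l<length w. life A L (k, take l w) (w ! l))"

definition family_tree :: "nat \<Rightarrow> anc_lives \<Rightarrow> ord_lives \<Rightarrow> real \<Rightarrow> indiv set" where
  "family_tree m A L t = {v \<in> individuals m A. birth A L v \<le> t}"

definition limit_space :: "nat \<Rightarrow> (real \<times> anc_lives \<times> ord_lives) measure" where
  "limit_space m = exponential 1 \<Otimes>\<^sub>M
     (PiM {1..} (\<lambda>_. ancestor_law m) \<Otimes>\<^sub>M PiM UNIV (\<lambda>_. ordinary_law m))"

definition P_mc :: "nat \<Rightarrow> real" where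
  "P_mc m = measure (limit_space m)
     {(t, A, L) \<in> space (limit_space m).
        maximal_clade m (indiv_child A) (family_tree m A L t) (0, [])}"

end

theory Submission
  imports Defs "HOL-Real_Asymp.Real_Asymp"
begin

text \<open>
  With \<open>a n\<close> the mean of a tree functional such as \<open>|T\<^sub>n|\<close> or \<open>n\<^sub>m\<^sub>c(T\<^sub>n)\<close>, decomposing the tree
  at the root gives \<open>a n = b n + (\<Sum>k. R n k * a k)\<close>, where \<open>R n k\<close> is the expected number of children
  of the root that receive \<open>k\<close> of \<open>n\<close> keys. The weight \<open>w n = 2 / ((n + 1) * (n + 2))\<close> satisfies
  \<open>(\<Sum>n. w n * R n k) = w k\<close>. A limsup argument based on this gives
  \<open>a n / (n + 1) \<longlonglongrightarrow> (\<Sum>n. w n * b n) / h\<close> with \<open>h\<close> independent of the functional; for the size the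
  sum is \<open>1\<close>.

  For maximal clades the sum is \<open>P_mc m\<close>. The age of \<open>o\<close> is exponential, and convolution with the
  exponential life history of an ancestor makes the step to that ancestor act on the weight \<open>w\<close> as \<open>R\<close>,
  restricted to the event that all children of the ancestor are present. Hence
  the probability that \<open>o\<close> is a clade while its first \<open>K\<close> ancestors are not is the \<open>w\<close>-mean of the
  \<open>K\<close>-th iterate of the restricted operator, applied to the probability that the root is a clade. As
  \<open>K\<close> tends to infinity, telescoping identifies the limit.

  For the almost sure statement, the functional is compared with its conditional mean given the sizes
  of the subtrees down to depth \<open>J\<close>: the variance decays like \<open>(2 / (m + 1)) ^ J\<close>. Borel-Cantelli along a
  sequence \<open>n = i ^ q\<close>, with \<open>J\<close> of the order of \<open>log i\<close>, and monotonicity in \<open>n\<close> finish the proof.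
\<close>

section \<open>Search trees as functions of the list of keys\<close>

text \<open>The weight has a probabilistic origin. Let every gap between neighbouring keys wait an
  Exp(1) time until a key falls into it. A node with j - 1 keys has j gaps, which explains the rates
  j of the life histories, and the keys below an individual form a Yule process started with two
  gaps. At age s there are n keys with probability n exp (- 2 s) (1 - exp (- s))^(n - 1); averaging
  over an Exp(1) age gives 2 / ((n + 1) (n + 2)). The proof never constructs this process: the
  number of keys enters by expanding integrals over the age into negative binomial series, so only
  the life histories of \<open>o\<close> and of its ancestors have to be integrated. Two obstacles
  shape the rest. The mean of the clade functional may grow linearly and then is not summable
  against the weight, so the invariance of the weight can only be applied after truncating the
  number of ancestors. And for m >= 3 the size is random as well, so it is treated as a second
  instance of the same kind of functional instead of being computed.\<close>

definition shape :: "nat \<Rightarrow> real list \<Rightarrow> nat list set" where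
  "shape m xs = nodes m (fold (insert_key m) xs Empty)"

definition subkeys :: "nat \<Rightarrow> real list \<Rightarrow> nat \<Rightarrow> real list" where
  "subkeys m xs i = filter (\<lambda>x. interval_index (take (m - 1) xs) x = i) (drop (m - 1) xs)"

lemma search_tree_eq_shape: "search_tree m x n = shape m (map x [0..<n])"
  by (simp add: search_tree_def shape_def)

text \<open>Once the root is full, insertions below different children do not interact, so the tree
  at child i depends only on the subsequence of keys that it receives, in their order of
  arrival.\<close>

lemma fold_insert_key_full:
  assumes "length ks \<ge> m - 1"
  shows "fold (insert_key m) xs (Node ks c) =
    Node ks (\<lambda>i. fold (insert_key m) (filter (\<lambda>x. interval_index ks x = i) xs) (c i))"
  using assms by (induction xs arbitrary: c) (auto simp: fun_eq_iff)

lemma fold_insert_key_short: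
  assumes "length ks + length xs \<le> m - 1"
  shows "fold (insert_key m) xs (Node ks c) = Node (ks @ xs) c"
  using assms by (induction xs arbitrary: ks) auto

lemma shape_Nil [simp]: "shape m [] = {}"
  by (simp add: shape_def)

lemma fold_insert_key_Empty:
  assumes "length xs \<le> m - 1" "xs \<noteq> []"
  shows "fold (insert_key m) xs Empty = Node xs (\<lambda>_. Empty)"
  using assms by (cases xs) (simp_all add: fold_insert_key_short)

lemma shape_short:
  assumes "length xs \<le> m - 1" "xs \<noteq> []"
  shows "shape m xs = {[]}"
  using assms by (simp add: shape_def fold_insert_key_Empty)

lemma shape_rec:
  assumes "m \<ge> 2" "m - 1 \<le> length xs"
  shows "shape m xs = insert [] (\<Union>i\<in>{1..m}. (#) i ` shape m (subkeys m xs i))"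
proof -
  let ?ks = "take (m - 1) xs"
  have "fold (insert_key m) ?ks Empty = Node ?ks (\<lambda>_. Empty)"
    using assms by (intro fold_insert_key_Empty) auto
  moreover have "fold (insert_key m) xs Empty =
      fold (insert_key m) (drop (m - 1) xs) (fold (insert_key m) ?ks Empty)"
    by (metis append_take_drop_id fold_append comp_apply)
  ultimately have "fold (insert_key m) xs Empty =
      Node ?ks (\<lambda>i. fold (insert_key m) (subkeys m xs i) Empty)"
    using assms by (simp add: fold_insert_key_full subkeys_def)
  then show ?thesis by (simp add: shape_def)
qed

lemma length_subkeys_less:
  assumes "m \<ge> 2" "m - 1 \<le> length xs"
  shows "length (subkeys m xs i) < length xs"
proof -
  have "length (subkeys m xs i) \<le> length (drop (m - 1) xs)"
    unfolding subkeys_def by (rule length_filter_le)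
  also have "\<dots> < length xs" using assms by auto
  finally show ?thesis .
qed

lemma interval_index_range:
  assumes "m \<ge> 2" "length ks \<le> m - 1"
  shows "interval_index ks x \<in> {1..m}"
proof -
  have "card {k \<in> set ks. k < x} \<le> card (set ks)"
    by (rule card_mono) auto
  also have "\<dots> \<le> m - 1" using assms(2) card_length le_trans by blast
  finally show ?thesis using assms unfolding interval_index_def by auto
qed

lemma sum_length_filter:
  fixes f :: "'a \<Rightarrow> nat"
  assumes "\<And>x. x \<in> set xs \<Longrightarrow> f x \<in> A" "finite A"
  shows "(\<Sum>i\<in>A. length (filter (\<lambda>x. f x = i) xs)) = length xs"
  using assms
proof (induction xs)
  case (Cons x xs)
  have "(\<Sum>i\<in>A. length (filter (\<lambda>x. f x = i) (x # xs)))
      = (\<Sum>i\<in>A. (if i = f x then 1 else 0) + length (filter (\<lambda>x. f x = i) xs))"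
    by (intro sum.cong) auto
  also have "\<dots> = Suc (length xs)"
    using Cons by (simp add: sum.distrib)
  finally show ?case by simp
qed simp

lemma sum_length_subkeys:
  assumes "m \<ge> 2"
  shows "(\<Sum>i=1..m. length (subkeys m xs i)) = length xs - (m - 1)"
  unfolding subkeys_def
  by (subst sum_length_filter) (use assms interval_index_range[OF assms] in auto)

lemma shape_rooted:
  assumes "m \<ge> 2" "xs \<noteq> []"
  shows "[] \<in> shape m xs"
  using assms shape_short[of xs m] shape_rec[of m xs]
  by (cases "length xs \<le> m - 1") auto

lemma shape_wf:
  assumes m: "m \<ge> 2"
  shows "finite (shape m xs) \<and> (\<forall>v\<in>shape m xs. set v \<subseteq> {1..m}) \<and>
     (\<forall>u w. u @ w \<in> shape m xs \<longrightarrow> u \<in> shape m xs)"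
proof (induction "length xs" arbitrary: xs rule: less_induct)
  case less
  show ?case
  proof (cases "length xs < m - 1")
    case True
    then show ?thesis by (cases "xs = []") (auto simp: shape_short)
  next
    case False
    then have l: "m - 1 \<le> length xs" by simp
    note IH = less[OF length_subkeys_less[OF m l]]
    have "u \<in> shape m xs" if uw: "u @ w \<in> shape m xs" for u w
    proof (cases u)
      case (Cons i u')
      then obtain j where "j \<in> {1..m}" "i = j" "u' @ w \<in> shape m (subkeys m xs j)"
        using uw unfolding shape_rec[OF m l] by auto
      then show ?thesis using IH[of j] Cons unfolding shape_rec[OF m l] by blast
    qed (simp add: shape_rec[OF m l])
    moreover have "finite (shape m xs)" using IH unfolding shape_rec[OF m l] by auto
    moreover have "set v \<subseteq> {1..m}" if v: "v \<in> shape m xs" for v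
    proof (cases v)
      case (Cons i v')
      then obtain j where "j \<in> {1..m}" "i = j" "v' \<in> shape m (subkeys m xs j)"
        using v unfolding shape_rec[OF m l] by auto
      then show ?thesis using IH[of j] Cons by simp
    qed simp
    ultimately show ?thesis by blast
  qed
qed

section \<open>Clades and sizes under the decomposition at the root\<close>

text \<open>Closure under prefixes keeps every intermediate node of a path in \<open>V\<close>, so
  that the edge relation, which only joins nodes of \<open>V\<close>, generates the whole prefix
  order.\<close>

lemma proper_ancestor_path_child:
  assumes pc: "\<forall>u w. u @ w \<in> V \<longrightarrow> u \<in> V" and pos: "\<forall>v\<in>V. set v \<subseteq> {1..m}"
  shows "proper_ancestor m path_child V u v \<longleftrightarrow> v \<in> V \<and> (\<exists>w. w \<noteq> [] \<and> v = u @ w)"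
proof
  assume "proper_ancestor m path_child V u v"
  then have "(u, v) \<in> (edges m path_child V)\<^sup>+" by (simp add: proper_ancestor_def)
  then show "v \<in> V \<and> (\<exists>w. w \<noteq> [] \<and> v = u @ w)"
  proof (induction rule: trancl_induct)
    case (base v)
    then show ?case by (auto simp: edges_def path_child_def)
  next
    case (step v v')
    then obtain w i where "w \<noteq> []" "v' = u @ w @ [i]" "v' \<in> V"
      by (auto simp: edges_def path_child_def)
    then show ?case by blast
  qed
next
  assume "v \<in> V \<and> (\<exists>w. w \<noteq> [] \<and> v = u @ w)"
  then obtain w where "w \<noteq> []" "v = u @ w" "v \<in> V" by blast
  then have "(u, v) \<in> (edges m path_child V)\<^sup>+"
  proof (induction w arbitrary: v rule: rev_induct)
    case (snoc i w)
    have uw: "u @ w \<in> V" using snoc.prems pc by (metis append_assoc)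
    have "i \<in> {1..m}" using snoc.prems pos by fastforce
    then have e: "(u @ w, v) \<in> edges m path_child V"
      using uw snoc.prems by (auto simp: edges_def path_child_def)
    show ?case
    proof (cases "w = []")
      case True
      then show ?thesis using e by auto
    next
      case False
      from snoc.IH[OF this refl uw] e show ?thesis by (rule trancl_into_trancl)
    qed
  qed simp
  then show "proper_ancestor m path_child V u v" by (simp add: proper_ancestor_def)
qed

lemma clade_iff:
  "clade m ch V v \<longleftrightarrow> v \<in> V \<and> (\<exists>i\<in>{1..m}. ch v i \<notin> V)"
proof -
  have "card {i \<in> {1..m}. ch v i \<in> V} < m \<longleftrightarrow> {i \<in> {1..m}. ch v i \<in> V} \<noteq> {1..m}"
  proof
    assume "{i \<in> {1..m}. ch v i \<in> V} \<noteq> {1..m}"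
    then have "card {i \<in> {1..m}. ch v i \<in> V} < card {1..m}"
      by (intro psubset_card_mono) auto
    then show "card {i \<in> {1..m}. ch v i \<in> V} < m" by simp
  qed auto
  then show ?thesis unfolding clade_def by auto
qed

text \<open>A root with an empty child is a clade and, being an ancestor of every other node, the
  only maximal one. A full root is no clade, so it drops out of the maximality condition and the
  subtrees of the children are counted separately.\<close>

lemma n_mc_shape_rec:
  assumes m: "m \<ge> 2" and l: "m - 1 \<le> length xs"
  shows "n_mc m path_child (shape m xs) =
    (if \<forall>i\<in>{1..m}. subkeys m xs i \<noteq> [] then (\<Sum>i=1..m. n_mc m path_child (shape m (subkeys m xs i))) else 1)"
proof -
  let ?V = "shape m xs" and ?W = "\<lambda>i. shape m (subkeys m xs i)"
  note wf = shape_wf[OF m]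
  have V: "?V = insert [] (\<Union>i\<in>{1..m}. (#) i ` ?W i)" by (rule shape_rec[OF m l])
  have pa: "proper_ancestor m path_child (shape m ys) u v \<longleftrightarrow>
     v \<in> shape m ys \<and> (\<exists>w. w \<noteq> [] \<and> v = u @ w)" for ys u v
    using wf[of ys] by (intro proper_ancestor_path_child) auto
  have mx: "maximal_clade m path_child (shape m ys) v \<longleftrightarrow> clade m path_child (shape m ys) v \<and>
     (\<forall>u w. w \<noteq> [] \<and> v = u @ w \<longrightarrow> \<not> clade m path_child (shape m ys) u)" for ys v
    unfolding maximal_clade_def pa by (auto simp: clade_def)
  have child: "i # v \<in> ?V \<longleftrightarrow> v \<in> ?W i" if "i \<in> {1..m}" for i v
    using that unfolding V by auto
  have root: "clade m path_child ?V [] \<longleftrightarrow> \<not> (\<forall>i\<in>{1..m}. subkeys m xs i \<noteq> [])"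
  proof -
    have "[i] \<in> ?V \<longleftrightarrow> subkeys m xs i \<noteq> []" if "i \<in> {1..m}" for i
      using child[OF that, of "[]"] shape_rooted[OF m, of "subkeys m xs i"] by auto
    then show ?thesis unfolding clade_iff by (auto simp: path_child_def V)
  qed
  have cl: "clade m path_child ?V (i # v) \<longleftrightarrow> clade m path_child (?W i) v" if "i \<in> {1..m}" for i v
    using child[OF that] unfolding clade_iff by (auto simp: path_child_def)
  show ?thesis
  proof (cases "\<forall>i\<in>{1..m}. subkeys m xs i \<noteq> []")
    case False
    then have r: "clade m path_child ?V []" using root by simp
    have "{v \<in> ?V. maximal_clade m path_child ?V v} = {[]}"
      using r unfolding mx V[symmetric] by (auto simp: clade_def)
    then show ?thesis using False unfolding n_mc_def by auto
  next
    case True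
    then have r: "\<not> clade m path_child ?V []" using root by simp
    have mxi: "maximal_clade m path_child ?V (i # v) \<longleftrightarrow> maximal_clade m path_child (?W i) v"
      if "i \<in> {1..m}" for i v
    proof -
      \<comment> \<open>The prefix \<open>[]\<close> of \<open>i # v\<close> is the root, which is
        no clade in this case; every other prefix starts with i.\<close>
      have "(\<forall>u w. w \<noteq> [] \<and> i # v = u @ w \<longrightarrow> \<not> clade m path_child ?V u) \<longleftrightarrow>
        (\<forall>u w. w \<noteq> [] \<and> v = u @ w \<longrightarrow> \<not> clade m path_child ?V (i # u))"
        using r by (auto simp: Cons_eq_append_conv)
      then show ?thesis unfolding mx cl[OF that] by simp
    qed
    have "{v \<in> ?V. maximal_clade m path_child ?V v} =
      (\<Union>i\<in>{1..m}. (#) i ` {v \<in> ?W i. maximal_clade m path_child (?W i) v})" (is "_ = ?U")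
    proof (rule set_eqI)
      fix v show "v \<in> {v \<in> ?V. maximal_clade m path_child ?V v} \<longleftrightarrow> v \<in> ?U"
      proof (cases v)
        case Nil
        then show ?thesis using r by (auto simp: mx)
      next
        case (Cons i v')
        show ?thesis
        proof (cases "i \<in> {1..m}")
          case True
          then show ?thesis using Cons child[OF True] mxi[OF True] by auto
        next
          case False
          then show ?thesis using Cons V by auto
        qed
      qed
    qed
    then have "n_mc m path_child ?V = card ?U" by (simp add: n_mc_def)
    also have "\<dots> = (\<Sum>i=1..m. card ((#) i ` {v \<in> ?W i. maximal_clade m path_child (?W i) v}))"
      using wf by (intro card_UN_disjoint) auto
    also have "\<dots> = (\<Sum>i=1..m. n_mc m path_child (?W i))"
      by (intro sum.cong refl) (simp add: card_image n_mc_def)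
    finally show ?thesis using True by simp
  qed
qed

lemma card_shape_rec:
  assumes m: "m \<ge> 2" and l: "m - 1 \<le> length xs"
  shows "card (shape m xs) = 1 + (\<Sum>i=1..m. card (shape m (subkeys m xs i)))"
proof -
  let ?W = "\<lambda>i. shape m (subkeys m xs i)"
  have "card (\<Union>i\<in>{1..m}. (#) i ` ?W i) = (\<Sum>i=1..m. card ((#) i ` ?W i))"
    using shape_wf[OF m] by (intro card_UN_disjoint) auto
  also have "\<dots> = (\<Sum>i=1..m. card (?W i))"
    by (intro sum.cong refl) (simp add: card_image)
  finally show ?thesis
    unfolding shape_rec[OF m l] using shape_wf[OF m]
    by (subst card_insert_disjoint) auto
qed

lemma n_mc_singleton:
  assumes "m \<ge> 2" shows "n_mc m path_child {[]} = 1"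
proof -
  have "{v \<in> {[]}. maximal_clade m path_child {[]} v} = {[]}"
    using assms proper_ancestor_path_child[of "{[]}" m]
    by (auto simp: maximal_clade_def clade_iff path_child_def)
  then show ?thesis by (simp add: n_mc_def)
qed

text \<open>\<open>interval_index\<close> only compares keys with each other, so passing keys to
  children commutes with a strictly increasing relabelling. This reduces random keys to random
  permutations.\<close>

lemma subkeys_map:
  assumes "strict_mono_on (set xs) f"
  shows "subkeys m (map f xs) i = map f (subkeys m xs i)"
proof -
  have "interval_index (take (m - 1) (map f xs)) (f x) = interval_index (take (m - 1) xs) x"
    if "x \<in> set (drop (m - 1) xs)" for x
  proof -
    let ?K = "set (take (m - 1) xs)"
    have x: "x \<in> set xs" using that by (rule in_set_dropD)
    have K: "?K \<subseteq> set xs" by (rule set_take_subset)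
    have lt: "f k < f x \<longleftrightarrow> k < x" if "k \<in> ?K" for k
      using assms x K that by (meson strict_mono_on_less subsetD)
    have "{k \<in> f ` ?K. k < f x} = f ` {k \<in> ?K. k < x}"
      using lt by auto
    moreover have "inj_on f {k \<in> ?K. k < x}"
      using strict_mono_on_imp_inj_on[OF assms] K by (auto intro: inj_on_subset)
    ultimately show ?thesis
      unfolding interval_index_def by (simp add: take_map card_image)
  qed
  then show ?thesis
    unfolding subkeys_def by (simp add: drop_map filter_map o_def cong: filter_cong)
qed

section \<open>Averages over the orders of the keys\<close>

definition perm_avg :: "real set \<Rightarrow> (real list \<Rightarrow> real) \<Rightarrow> real" where
  "perm_avg S \<phi> = (\<Sum>xs\<in>permutations_of_set S. \<phi> xs) / fact (card S)"

text \<open>Stands for the expectation over n random keys: i.i.d. keys with a continuous law are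
  almost surely distinct and all n! rank patterns are equally likely. All moment computations are
  thus finite sums.\<close>

definition avg :: "nat \<Rightarrow> (real list \<Rightarrow> real) \<Rightarrow> real" where
  "avg n \<phi> = perm_avg (real ` {..<n}) \<phi>"

definition order_invariant :: "(real list \<Rightarrow> 'b) \<Rightarrow> bool" where
  "order_invariant \<phi> \<longleftrightarrow> (\<forall>f xs. strict_mono_on (set xs) f \<longrightarrow> \<phi> (map f xs) = \<phi> xs)"

lemma bij_betw_rank:
  fixes S :: "'a :: linorder set"
  assumes "finite S"
  shows "bij_betw (\<lambda>x. card {y \<in> S. y < x}) S {..<card S}"
    and "strict_mono_on S (\<lambda>x. card {y \<in> S. y < x})"
proof -
  let ?f = "\<lambda>x. card {y \<in> S. y < x}"
  show sm: "strict_mono_on S ?f"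
    using assms by (intro strict_mono_onI psubset_card_mono) auto
  have "?f ` S \<subseteq> {..<card S}"
    using assms by (auto intro!: psubset_card_mono)
  moreover have "inj_on ?f S" using sm by (rule strict_mono_on_imp_inj_on)
  ultimately show "bij_betw ?f S {..<card S}"
    by (simp add: bij_betw_def card_image card_subset_eq)
qed

text \<open>Replacing each key by its rank in \<open>S\<close> turns the orders of \<open>S\<close>
  into the orders of 0, ..., card S - 1.\<close>

lemma perm_avg_eq_avg:
  assumes "order_invariant \<phi>" "finite S"
  shows "perm_avg S \<phi> = avg (card S) \<phi>"
proof -
  let ?f = "\<lambda>x. real (card {y \<in> S. y < x})"
  have sm: "strict_mono_on S ?f"
    using bij_betw_rank(2)[OF assms(2)] by (auto simp: strict_mono_on_def)
  have img: "?f ` S = real ` {..<card S}"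
  proof -
    have "?f ` S = real ` ((\<lambda>x. card {y \<in> S. y < x}) ` S)" by (simp add: image_image)
    also have "(\<lambda>x. card {y \<in> S. y < x}) ` S = {..<card S}"
      using bij_betw_rank(1)[OF assms(2)] by (simp add: bij_betw_def)
    finally show ?thesis .
  qed
  have inj: "inj_on ?f S" using sm by (rule strict_mono_on_imp_inj_on)
  have "inj_on (map ?f) (permutations_of_set S)"
    by (rule inj_on_subset[OF inj_on_mapI[of ?f "permutations_of_set S"]])
       (use inj in \<open>auto simp: permutations_of_set_def intro: inj_on_subset\<close>)
  then have "(\<Sum>xs\<in>permutations_of_set (?f ` S). \<phi> xs) = (\<Sum>xs\<in>permutations_of_set S. \<phi> (map ?f xs))"
    unfolding permutations_of_set_image_inj[OF inj] by (simp add: sum.reindex)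
  also have "\<dots> = (\<Sum>xs\<in>permutations_of_set S. \<phi> xs)"
    using assms(1) sm by (intro sum.cong refl) (simp add: order_invariant_def permutations_of_set_def)
  finally show ?thesis unfolding avg_def perm_avg_def img by (simp add: card_image)
qed

lemma perm_avg_eq_expectation:
  assumes "finite S"
  shows "perm_avg S \<phi> = measure_pmf.expectation (pmf_of_set (permutations_of_set S)) \<phi>"
  using assms by (simp add: perm_avg_def integral_pmf_of_set)

text \<open>In a uniformly random order of \<open>A\<close>, the relative orders of two
  complementary blocks are independent and uniform. This is the independence of the subtrees given
  the sets of keys that they receive.\<close>

lemma perm_avg_partition:
  assumes "finite A"
  shows "perm_avg A (\<lambda>xs. \<phi> (filter P xs) * \<psi> (filter (\<lambda>x. \<not> P x) xs)) =
    perm_avg {x \<in> A. P x} \<phi> * perm_avg {x \<in> A. \<not> P x} \<psi>"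
proof -
  let ?u = "\<lambda>A. pmf_of_set (permutations_of_set (A :: real set))"
  let ?B = "permutations_of_set {x \<in> A. P x}" and ?C = "permutations_of_set {x \<in> A. \<not> P x}"
  have "perm_avg A (\<lambda>xs. \<phi> (filter P xs) * \<psi> (filter (\<lambda>x. \<not> P x) xs)) =
    measure_pmf.expectation (map_pmf (partition P) (?u A)) (\<lambda>(xs, ys). \<phi> xs * \<psi> ys)"
    using assms by (simp add: perm_avg_eq_expectation partition_filter_conv o_def)
  also have "\<dots> = measure_pmf.expectation (pair_pmf (?u {x \<in> A. P x}) (?u {x \<in> A. \<not> P x})) (\<lambda>(xs, ys). \<phi> xs
    * \<psi> ys)"
    using assms by (simp add: partition_random_permutations)
  also have "\<dots> = (\<Sum>(xs, ys)\<in>?B \<times> ?C. pmf (pair_pmf (?u {x \<in> A. P x}) (?u {x \<in> A. \<not> P x})) (xs, ys) * (\<phi> xs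
    * \<psi> ys))"
    using assms by (subst integral_measure_pmf[where A = "?B \<times> ?C"]) (auto simp: case_prod_unfold)
  also have "\<dots> = (\<Sum>xs\<in>?B. \<Sum>ys\<in>?C. (\<phi> xs / fact (card {x \<in> A. P x})) * (\<psi> ys / fact (card {x \<in> A. \<not> P x})))"
    using assms by (simp add: sum.cartesian_product[symmetric] pmf_pair)
  also have "\<dots> = perm_avg {x \<in> A. P x} \<phi> * perm_avg {x \<in> A. \<not> P x} \<psi>"
    unfolding perm_avg_def sum_product[symmetric] sum_divide_distrib ..
  finally show ?thesis .
qed

lemma perm_avg_prod:
  assumes "finite I" "finite A" "\<And>x. x \<in> A \<Longrightarrow> g x \<in> I"
  shows "perm_avg A (\<lambda>xs. \<Prod>i\<in>I. \<phi> i (filter (\<lambda>x. g x = i) xs)) =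
    (\<Prod>i\<in>I. perm_avg {x \<in> A. g x = i} (\<phi> i))"
  using assms
proof (induction I arbitrary: A rule: finite_induct)
  case empty
  then have "A = {}" by blast
  then show ?case by (simp add: perm_avg_def)
next
  case (insert j I)
  let ?P = "\<lambda>x. g x = j"
  have *: "(\<Prod>i\<in>I. \<phi> i (filter (\<lambda>x. g x = i) xs)) =
      (\<Prod>i\<in>I. \<phi> i (filter (\<lambda>x. g x = i) (filter (\<lambda>x. \<not> ?P x) xs)))" for xs
    using insert.hyps(2) by (intro prod.cong refl arg_cong[of _ _ "\<phi> _"]) (auto simp: intro!: filter_cong)
  have "perm_avg A (\<lambda>xs. \<Prod>i\<in>insert j I. \<phi> i (filter (\<lambda>x. g x = i) xs)) =
    perm_avg A (\<lambda>xs. \<phi> j (filter ?P xs) * (\<Prod>i\<in>I. \<phi> i (filter (\<lambda>x. g x = i) (filter (\<lambda>x. \<not> ?P x) xs))))"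
  proof -
    have "(\<lambda>xs. \<phi> j (filter ?P xs) * (\<Prod>i\<in>I. \<phi> i (filter (\<lambda>x. g x = i) xs))) = (\<lambda>xs. \<phi> j (filter ?P xs) *
        (\<Prod>i\<in>I. \<phi> i (filter (\<lambda>x. g x = i) (filter (\<lambda>x. \<not> ?P x) xs))))"
      by (rule ext, rule arg_cong2[of _ _ _ _ "(*)", OF refl *])
    then show ?thesis by (simp only: prod.insert[OF insert.hyps])
  qed
  also have "\<dots> = perm_avg {x \<in> A. ?P x} (\<phi> j) *
      perm_avg {x \<in> A. \<not> ?P x} (\<lambda>ys. \<Prod>i\<in>I. \<phi> i (filter (\<lambda>x. g x = i) ys))"
    using insert.prems by (intro perm_avg_partition)
  also have "perm_avg {x \<in> A. \<not> ?P x} (\<lambda>ys. \<Prod>i\<in>I. \<phi> i (filter (\<lambda>x. g x = i) ys)) =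
      (\<Prod>i\<in>I. perm_avg {x \<in> {x \<in> A. \<not> ?P x}. g x = i} (\<phi> i))"
    using insert.prems by (intro insert.IH) auto
  also have "\<dots> = (\<Prod>i\<in>I. perm_avg {x \<in> A. g x = i} (\<phi> i))"
    using insert.hyps(2) by (intro prod.cong refl arg_cong2[of _ _ _ _ perm_avg]) auto
  finally show ?case using insert.hyps by simp
qed

text \<open>Decomposition according to the set \<open>K\<close> of the first k keys, which will be
  the keys in the root.\<close>

lemma sum_permutations_take_drop:
  assumes "finite S" "k \<le> card S"
  shows "(\<Sum>xs\<in>permutations_of_set S. G (take k xs) (drop k xs)) =
    (\<Sum>K | K \<subseteq> S \<and> card K = k. \<Sum>ks\<in>permutations_of_set K. \<Sum>ys\<in>permutations_of_set (S - K). G ks ys)"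
proof -
  let ?T = "SIGMA K:{K. K \<subseteq> S \<and> card K = k}. SIGMA ks:permutations_of_set K. permutations_of_set (S - K)"
  have fin: "finite {K. K \<subseteq> S \<and> card K = k}" using assms by auto
  have "(\<Sum>xs\<in>permutations_of_set S. G (take k xs) (drop k xs)) = (\<Sum>(K, ks, ys)\<in>?T. G ks ys)"
  proof (rule sum.reindex_bij_witness[where i = "\<lambda>(K, ks, ys). ks @ ys" and
        j = "\<lambda>xs. (set (take k xs), take k xs, drop k xs)"])
    fix xs assume xs: "xs \<in> permutations_of_set S"
    then have d: "set xs = S" "distinct xs" by (auto simp: permutations_of_set_def)
    have "length xs = card S" using d distinct_card by metis
    then have "length (take k xs) = k" using assms by simp
    then have "card (set (take k xs)) = k" using d by (metis distinct_card distinct_take)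
    moreover have "set (drop k xs) = S - set (take k xs)"
      using d by (metis append_take_drop_id distinct_append set_append Diff_cancel Un_Diff Diff_triv
        Un_empty_left inf_commute)
    ultimately show "(set (take k xs), take k xs, drop k xs) \<in> ?T"
      using d by (auto simp: permutations_of_set_def dest: in_set_takeD)
  next
    fix p assume "p \<in> ?T"
    then obtain K ks ys where p: "p = (K, ks, ys)" "K \<subseteq> S" "card K = k" "ks \<in> permutations_of_set K"
      "ys \<in> permutations_of_set (S - K)" by auto
    then have "length ks = k" by (auto simp: permutations_of_set_def distinct_card)
    then show "(\<lambda>xs. (set (take k xs), take k xs, drop k xs)) ((\<lambda>(K, ks, ys). ks @ ys) p) = p"
      "(\<lambda>(K, ks, ys). ks @ ys) p \<in> permutations_of_set S"
      using p by (auto simp: permutations_of_set_def)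
  qed auto
  also have "\<dots> = (\<Sum>K | K \<subseteq> S \<and> card K = k. \<Sum>(ks, ys)\<in>(SIGMA ks:permutations_of_set K. permutations_of_set
    (S - K)). G ks ys)"
    using fin by (subst sum.Sigma) (auto simp: case_prod_unfold)
  also have "\<dots> = (\<Sum>K | K \<subseteq> S \<and> card K = k. \<Sum>ks\<in>permutations_of_set K. \<Sum>ys\<in>permutations_of_set (S - K). G ks
    ys)"
    by (subst sum.Sigma) auto
  finally show ?thesis .
qed

text \<open>\<open>K\<close> is determined by its j + 1 gap sizes, and these can be any composition
  of card S - j into parts that may be 0; so the sum is a Cauchy product of the sequences
  \<open>\<psi> i\<close>. The induction splits off the largest element \<kappa> of
  \<open>K\<close>: what lies above it is the last gap, and the rest of \<open>K\<close> is a subset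
  of what lies below.\<close>

lemma sum_subsets_gaps:
  fixes S :: "real set" and \<psi> :: "nat \<Rightarrow> nat \<Rightarrow> real"
  assumes "finite S"
  shows "(\<Sum>K | K \<subseteq> S \<and> card K = j. \<Prod>i\<le>j. \<psi> i (card {x \<in> S - K. card {k \<in> K. k < x} = i})) =
    (if j \<le> card S then fps_nth (\<Prod>i\<le>j. Abs_fps (\<psi> i)) (card S - j) else 0)"
  using assms
proof (induction j arbitrary: S)
  case 0
  have "{K. K \<subseteq> S \<and> card K = 0} = {{}}" using 0 finite_subset by fastforce
  then show ?case by simp
next
  case (Suc j)
  let ?n = "card S"
  let ?L = "\<lambda>\<kappa>. {x \<in> S. x < \<kappa>}"
  let ?g = "\<lambda>S K i. card {x \<in> S - K. card {k \<in> K. k < x} = i}"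
  let ?A = "\<Prod>i\<le>j. Abs_fps (\<psi> i)"
  define T where "T = (SIGMA \<kappa>:S. {K. K \<subseteq> ?L \<kappa> \<and> card K = j})"
  have gaps: "(\<Prod>i\<le>Suc j. \<psi> i (?g S (insert \<kappa> K) i)) =
     \<psi> (Suc j) (?n - 1 - card (?L \<kappa>)) * (\<Prod>i\<le>j. \<psi> i (?g (?L \<kappa>) K i))"
    if "\<kappa> \<in> S" "K \<subseteq> ?L \<kappa>" "card K = j" for \<kappa> K
  proof -
    have finK: "finite K" using that Suc.prems finite_subset by fastforce
    have \<kappa>: "\<kappa> \<notin> K" using that by auto
    have gt: "card {k \<in> insert \<kappa> K. k < x} = Suc j" if "x > \<kappa>" for x
    proof -
      have "{k \<in> insert \<kappa> K. k < x} = insert \<kappa> K" using \<open>K \<subseteq> ?L \<kappa>\<close> that by auto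
      then show ?thesis using finK \<kappa> \<open>card K = j\<close> by simp
    qed
    have lt: "{k \<in> insert \<kappa> K. k < x} = {k \<in> K. k < x}" if "x < \<kappa>" for x
      using that by auto
    have le: "card {k \<in> K. k < x} \<le> j" for x
      using card_mono[OF finK, of "{k \<in> K. k < x}"] that by auto
    have "{x \<in> S - insert \<kappa> K. card {k \<in> insert \<kappa> K. k < x} = i} =
        {x \<in> ?L \<kappa> - K. card {k \<in> K. k < x} = i}" if "i \<le> j" for i
    proof (rule set_eqI)
      fix x
      show "x \<in> {x \<in> S - insert \<kappa> K. card {k \<in> insert \<kappa> K. k < x} = i} \<longleftrightarrow>
         x \<in> {x \<in> ?L \<kappa> - K. card {k \<in> K. k < x} = i}"
        using gt[of x] lt[of x] \<open>i \<le> j\<close> by (cases x \<kappa> rule: linorder_cases) auto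
    qed
    moreover have "{x \<in> S - insert \<kappa> K. card {k \<in> insert \<kappa> K. k < x} = Suc j} = S - insert \<kappa> (?L \<kappa>)"
    proof (rule set_eqI)
      fix x
      show "x \<in> {x \<in> S - insert \<kappa> K. card {k \<in> insert \<kappa> K. k < x} = Suc j} \<longleftrightarrow> x \<in> S - insert \<kappa> (?L \<kappa>)"
        using gt[of x] lt[of x] le[of x] that by (cases x \<kappa> rule: linorder_cases) auto
    qed
    moreover have "card (S - insert \<kappa> (?L \<kappa>)) = ?n - 1 - card (?L \<kappa>)"
      using Suc.prems that(1) by (subst card_Diff_subset) auto
    ultimately show ?thesis by simp
  qed
  have "(\<Sum>K | K \<subseteq> S \<and> card K = Suc j. \<Prod>i\<le>Suc j. \<psi> i (?g S K i)) =
      (\<Sum>(\<kappa>, K)\<in>T. \<psi> (Suc j) (?n - 1 - card (?L \<kappa>)) * (\<Prod>i\<le>j. \<psi> i (?g (?L \<kappa>) K i)))"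
  proof (rule sum.reindex_bij_witness[where i = "\<lambda>(\<kappa>, K). insert \<kappa> K" and j = "\<lambda>K. (Max K, K - {Max K})"])
    fix K assume "K \<in> {K. K \<subseteq> S \<and> card K = Suc j}"
    then have K: "K \<subseteq> S" "card K = Suc j" by auto
    then have f: "finite K" "K \<noteq> {}" using Suc.prems finite_subset by auto
    have mx: "Max K \<in> K" using f by simp
    then show i: "(\<lambda>(\<kappa>, K). insert \<kappa> K) (Max K, K - {Max K}) = K" by auto
    have MS: "Max K \<in> S" using mx K by blast
    have "x < Max K" if "x \<in> K" "x \<noteq> Max K" for x using f that by (simp add: less_le)
    then show t: "(Max K, K - {Max K}) \<in> T" using K mx f MS by (auto simp: T_def)
    show "(case (Max K, K - {Max K}) of (\<kappa>, K) \<Rightarrow> \<psi> (Suc j) (?n - 1 - card (?L \<kappa>)) * (\<Prod>i\<le>j. \<psi> i (?g (?L \<kappa>) K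
      i))) =
       (\<Prod>i\<le>Suc j. \<psi> i (?g S K i))"
    proof -
      have t': "K - {Max K} \<subseteq> ?L (Max K)" "card (K - {Max K}) = j" using t by (auto simp: T_def)
      have i': "insert (Max K) (K - {Max K}) = K" using i by simp
      show ?thesis unfolding prod.case by (rule gaps[OF MS t', unfolded i', symmetric])
    qed
  next
    fix p assume "p \<in> T"
    then obtain \<kappa> K where p: "p = (\<kappa>, K)" "\<kappa> \<in> S" "K \<subseteq> ?L \<kappa>" "card K = j" by (auto simp: T_def)
    have fin: "finite K" using p Suc.prems finite_subset by fastforce
    have "\<kappa> \<notin> K" using p by auto
    moreover have "Max (insert \<kappa> K) = \<kappa>" using p fin by (intro Max_eqI) (auto dest!: subsetD)
    ultimately show "(Max ((\<lambda>(\<kappa>, K). insert \<kappa> K) p), (\<lambda>(\<kappa>, K). insert \<kappa> K) p - {Max ((\<lambda>(\<kappa>, K). insert \<kappa> K)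
      p)}) = p"
      "(\<lambda>(\<kappa>, K). insert \<kappa> K) p \<in> {K. K \<subseteq> S \<and> card K = Suc j}"
      using p fin by auto
  qed
  also have "\<dots> = (\<Sum>\<kappa>\<in>S. \<psi> (Suc j) (?n - 1 - card (?L \<kappa>)) *
      (\<Sum>K | K \<subseteq> ?L \<kappa> \<and> card K = j. \<Prod>i\<le>j. \<psi> i (?g (?L \<kappa>) K i)))"
    unfolding T_def using Suc.prems by (subst sum.Sigma[symmetric]) (auto simp: sum_distrib_left)
  also have "\<dots> = (\<Sum>\<kappa>\<in>S. \<psi> (Suc j) (?n - 1 - card (?L \<kappa>)) *
      (if j \<le> card (?L \<kappa>) then fps_nth ?A (card (?L \<kappa>) - j) else 0))"
    using Suc.prems by (intro sum.cong refl arg_cong2[of _ _ _ _ "(*)"] Suc.IH) auto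
  \<comment> \<open>Only the rank r of \<kappa> in \<open>S\<close> matters, and each rank occurs
    once.\<close>
  also have "\<dots> = (\<Sum>r<?n. \<psi> (Suc j) (?n - 1 - r) * (if j \<le> r then fps_nth ?A (r - j) else 0))"
    by (rule sum.reindex_bij_betw[OF bij_betw_rank(1)[OF Suc.prems]])
  also have "\<dots> = (\<Sum>r\<in>{j..<?n}. \<psi> (Suc j) (?n - 1 - r) * fps_nth ?A (r - j))"
    by (intro sum.mono_neutral_cong_right) auto
  also have "\<dots> = (if Suc j \<le> ?n then fps_nth (?A * Abs_fps (\<psi> (Suc j))) (?n - Suc j) else 0)"
  proof (cases "Suc j \<le> ?n")
    case True
    have "(\<Sum>r\<in>{j..<?n}. \<psi> (Suc j) (?n - 1 - r) * fps_nth ?A (r - j)) =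
        (\<Sum>i=0..?n - Suc j. fps_nth ?A i * \<psi> (Suc j) (?n - Suc j - i))"
      by (rule sum.reindex_bij_witness[where i = "\<lambda>i. i + j" and j = "\<lambda>r. r - j"]) (use True in auto)
    then show ?thesis using True by (simp add: fps_mult_nth)
  qed auto
  finally show ?case by simp
qed

text \<open>All sets \<open>K\<close> of root keys are equally likely, and given \<open>K\<close>
  the keys in its gaps are in independent uniform orders. Summing over \<open>K\<close> convolves
  the gap sizes, whence a coefficient of a product of generating functions.\<close>

lemma avg_prod_subkeys:
  assumes m: "m \<ge> 2" and n: "m - 1 \<le> n" and inv: "\<And>i. i \<in> {1..m} \<Longrightarrow> order_invariant (\<phi> i)"
  shows "avg n (\<lambda>xs. \<Prod>i=1..m. \<phi> i (subkeys m xs i)) =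
    fps_nth (\<Prod>i=1..m. Abs_fps (\<lambda>k. avg k (\<phi> i))) (n - (m - 1)) / real (n choose (m - 1))"
proof -
  define S where "S = real ` {..<n}"
  have S: "finite S" "card S = n" by (auto simp: S_def card_image)
  let ?\<K> = "{K. K \<subseteq> S \<and> card K = m - 1}"
  let ?ix = "\<lambda>K x. Suc (card {k \<in> K. k < x})"
  have I: "{1..m} = Suc ` {..m - 1}" using m by (simp add: image_Suc_atMost)
  have "(\<Sum>xs\<in>permutations_of_set S. \<Prod>i=1..m. \<phi> i (subkeys m xs i)) =
    (\<Sum>K\<in>?\<K>. \<Sum>ks\<in>permutations_of_set K. \<Sum>ys\<in>permutations_of_set (S - K).
        \<Prod>i=1..m. \<phi> i (filter (\<lambda>x. interval_index ks x = i) ys))"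
    unfolding subkeys_def using S n by (intro sum_permutations_take_drop) auto
  also have "\<dots> = (\<Sum>K\<in>?\<K>. \<Sum>ks\<in>permutations_of_set K. \<Sum>ys\<in>permutations_of_set (S - K).
        \<Prod>i=1..m. \<phi> i (filter (\<lambda>x. ?ix K x = i) ys))"
    by (intro sum.cong refl) (simp add: interval_index_def permutations_of_set_def)
  also have "\<dots> = (\<Sum>K\<in>?\<K>. fact (m - 1) * (fact (n - (m - 1)) *
      (\<Prod>i=1..m. avg (card {x \<in> S - K. ?ix K x = i}) (\<phi> i))))"
  proof (intro sum.cong refl)
    fix K assume "K \<in> ?\<K>"
    then have K: "K \<subseteq> S" "card K = m - 1" "finite K" using S finite_subset by auto
    have c: "card (S - K) = n - (m - 1)" using K S by (simp add: card_Diff_subset)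
    have "?ix K x \<in> {1..m}" for x
      using card_mono[OF K(3), of "{k \<in> K. k < x}"] K m by auto
    then have "perm_avg (S - K) (\<lambda>ys. \<Prod>i=1..m. \<phi> i (filter (\<lambda>x. ?ix K x = i) ys)) =
       (\<Prod>i=1..m. perm_avg {x \<in> S - K. ?ix K x = i} (\<phi> i))"
      using S by (intro perm_avg_prod) auto
    also have "\<dots> = (\<Prod>i=1..m. avg (card {x \<in> S - K. ?ix K x = i}) (\<phi> i))"
      using S inv by (intro prod.cong refl perm_avg_eq_avg) auto
    finally have "(\<Sum>ys\<in>permutations_of_set (S - K). \<Prod>i=1..m. \<phi> i (filter (\<lambda>x. ?ix K x = i) ys)) =
        fact (n - (m - 1)) * (\<Prod>i=1..m. avg (card {x \<in> S - K. ?ix K x = i}) (\<phi> i))"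
      unfolding perm_avg_def c by (simp add: field_simps)
    then show "(\<Sum>ks\<in>permutations_of_set K. \<Sum>ys\<in>permutations_of_set (S - K).
        \<Prod>i=1..m. \<phi> i (filter (\<lambda>x. ?ix K x = i) ys)) = fact (m - 1) * (fact (n - (m - 1)) *
      (\<Prod>i=1..m. avg (card {x \<in> S - K. ?ix K x = i}) (\<phi> i)))"
      using K by simp
  qed
  also have "\<dots> = fact (m - 1) * (fact (n - (m - 1)) *
     (\<Sum>K\<in>?\<K>. \<Prod>i\<le>m - 1. avg (card {x \<in> S - K. card {k \<in> K. k < x} = i}) (\<phi> (Suc i))))"
  proof -
    have "(\<Prod>i=1..m. avg (card {x \<in> S - K. ?ix K x = i}) (\<phi> i)) =
      (\<Prod>i\<le>m - 1. avg (card {x \<in> S - K. card {k \<in> K. k < x} = i}) (\<phi> (Suc i)))" for K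
      unfolding I by (simp add: prod.reindex)
    then show ?thesis by (simp only: sum_distrib_left[symmetric])
  qed
  also have "(\<Sum>K\<in>?\<K>. \<Prod>i\<le>m - 1. avg (card {x \<in> S - K. card {k \<in> K. k < x} = i}) (\<phi> (Suc i))) =
      fps_nth (\<Prod>i\<le>m - 1. Abs_fps (\<lambda>k. avg k (\<phi> (Suc i)))) (n - (m - 1))"
    using sum_subsets_gaps[OF S(1), where j = "m - 1" and \<psi> = "\<lambda>i k. avg k (\<phi> (Suc i))"] S n by simp
  also have "(\<Prod>i\<le>m - 1. Abs_fps (\<lambda>k. avg k (\<phi> (Suc i)))) = (\<Prod>i=1..m. Abs_fps (\<lambda>k. avg k (\<phi> i)))"
    unfolding I by (simp add: prod.reindex)
  finally show ?thesis
    using n unfolding avg_def perm_avg_def S_def[symmetric] S(2) binomial_fact[OF n, where 'a = real]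
    by (simp add: field_simps)
qed

section \<open>Splitting probabilities\<close>

text \<open>\<open>split_prob m n k\<close> is the probability that a given child of the root receives \<open>k\<close> of \<open>n\<close> keys,
  and \<open>split_prob_full m n k\<close> the probability that, in addition, no child stays empty.\<close>

definition split_prob :: "nat \<Rightarrow> nat \<Rightarrow> nat \<Rightarrow> real" where
  "split_prob m n k = (if k + (m - 1) \<le> n then real (n - 1 - k choose (m - 2)) / real (n choose (m - 1))
    else 0)"

definition split_prob_full :: "nat \<Rightarrow> nat \<Rightarrow> nat \<Rightarrow> real" where
  "split_prob_full m n k = (if k + 2 * (m - 1) \<le> n then real (n - m - k choose (m - 2)) / real (n choose (m
    - 1)) else 0)"

text \<open>There are (n - m choose m - 1) compositions of n - m + 1 into m positive parts. For m >=
  2, truncated subtraction and division by 0 give the value 1 for all n < 2 m - 1, where the root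
  cannot have m children. The value at n = 0 is also 1; it is reset in
  \<open>clade_prob\<close>.\<close>

definition nonfull_prob :: "nat \<Rightarrow> nat \<Rightarrow> real" where
  "nonfull_prob m n = 1 - real (n - m choose (m - 1)) / real (n choose (m - 1))"

abbreviation fps_ones :: "real fps" where "fps_ones \<equiv> Abs_fps (\<lambda>_. 1)"

lemma fps_ones_power: "fps_ones ^ Suc d = Abs_fps (\<lambda>n. real (n + d choose d))"
proof (induction d)
  case (Suc d)
  show ?case
  proof (rule fps_ext)
    fix n
    have "fps_nth (fps_ones ^ Suc (Suc d)) n = fps_nth (fps_ones ^ Suc d * fps_ones) n"
      by (simp only: power_Suc2)
    also have "\<dots> = (\<Sum>i=0..n. real (i + d choose d))"
      by (simp only: Suc fps_mult_nth) simp
    also have "\<dots> = (\<Sum>i\<le>n. real (d + i choose i))"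
    proof (intro sum.cong)
      show "real (i + d choose d) = real (d + i choose i)" for i
        using binomial_symmetric[of i "d + i"] by (simp add: add.commute)
    qed auto
    also have "\<dots> = real (Suc (d + n) choose n)"
      unfolding sum_choose_lower[symmetric] by simp
    also have "\<dots> = real (n + Suc d choose Suc d)"
      using binomial_symmetric[of "Suc d" "n + Suc d"] by (simp add: add.commute)
    finally show "fps_nth (fps_ones ^ Suc (Suc d)) n =
      fps_nth (Abs_fps (\<lambda>n. real (n + Suc d choose Suc d))) n"
      by simp
  qed
qed (simp add: fps_eq_iff)

lemma fps_ones_power': "d \<ge> 1 \<Longrightarrow> fps_nth (fps_ones ^ d) n = real (n + (d - 1) choose (d - 1))"
  using fps_ones_power[of "d - 1"] by simp

lemma split_prob_nonneg: "split_prob m n k \<ge> 0" and split_prob_full_nonneg: "split_prob_full m n k \<ge> 0"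
  by (auto simp: split_prob_def split_prob_full_def)

text \<open>The distinguished child carries \<open>f\<close>, each of the other m - 1 children the
  series 1 / (1 - X).\<close>

lemma nth_mult_ones_power:
  assumes "m \<ge> 2" "m - 1 \<le> n"
  shows "fps_nth (Abs_fps f * fps_ones ^ (m - 1)) (n - (m - 1)) / real (n choose (m - 1)) =
    (\<Sum>k\<le>n. split_prob m n k * f k)"
proof -
  let ?N = "n - (m - 1)"
  have "fps_nth (Abs_fps f * fps_ones ^ (m - 1)) ?N / real (n choose (m - 1)) =
     (\<Sum>k=0..?N. split_prob m n k * f k)"
    unfolding fps_mult_nth sum_divide_distrib
  proof (intro sum.cong refl)
    fix k assume k: "k \<in> {0..?N}"
    have "?N - k + (m - 1 - 1) = n - 1 - k" using assms k by auto
    then show "fps_nth (Abs_fps f) k * fps_nth (fps_ones ^ (m - 1)) (?N - k) / real (n choose (m - 1)) =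
      split_prob m n k * f k"
      using assms k fps_ones_power'[of "m - 1" "?N - k"] by (simp add: split_prob_def numeral_2_eq_2)
  qed
  also have "\<dots> = (\<Sum>k\<le>n. split_prob m n k * f k)"
    using assms by (intro sum.mono_neutral_left) (auto simp: split_prob_def)
  finally show ?thesis .
qed

text \<open>Here the other children must be nonempty, so each of them carries X / (1 - X).\<close>

lemma nth_mult_X_ones_power:
  assumes "m \<ge> 2" "m - 1 \<le> n"
  shows "fps_nth (Abs_fps f * (fps_X * fps_ones) ^ (m - 1)) (n - (m - 1)) / real (n choose (m - 1)) =
    (\<Sum>k\<le>n. split_prob_full m n k * f k)"
proof -
  let ?N = "n - (m - 1)"
  have nth: "fps_nth ((fps_X * fps_ones) ^ (m - 1)) j =
      (if j < m - 1 then 0 else real (j - 1 choose (m - 2)))" for j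
  proof (cases "j < m - 1")
    case False
    have "j - (m - 1) + (m - 1 - 1) = j - 1" using assms False by auto
    with fps_ones_power'[of "m - 1" "j - (m - 1)"] False assms show ?thesis
      by (simp add: power_mult_distrib fps_X_power_mult_nth numeral_2_eq_2)
  qed (simp add: power_mult_distrib fps_X_power_mult_nth)
  have "fps_nth (Abs_fps f * (fps_X * fps_ones) ^ (m - 1)) ?N / real (n choose (m - 1)) =
     (\<Sum>k=0..?N. split_prob_full m n k * f k)"
    unfolding fps_mult_nth sum_divide_distrib
  proof (intro sum.cong refl)
    fix k assume k: "k \<in> {0..?N}"
    have e: "?N - k < m - 1 \<longleftrightarrow> \<not> k + 2 * (m - 1) \<le> n" "?N - k - 1 = n - m - k" using assms k by auto
    then show "fps_nth (Abs_fps f) k * fps_nth ((fps_X * fps_ones) ^ (m - 1)) (?N - k) / real (n choose (m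
      - 1)) = split_prob_full m n k * f k"
      unfolding nth by (simp add: split_prob_full_def)
  qed
  also have "\<dots> = (\<Sum>k\<le>n. split_prob_full m n k * f k)"
    using assms by (intro sum.mono_neutral_left) (auto simp: split_prob_full_def)
  finally show ?thesis .
qed

lemma nth_X_ones_power:
  assumes "m \<ge> 2" "m - 1 \<le> n"
  shows "fps_nth ((fps_X * fps_ones) ^ m) (n - (m - 1)) / real (n choose (m - 1)) = 1 - nonfull_prob m n"
proof (cases "n - (m - 1) < m")
  case True
  then have "n - m < m - 1" using assms by auto
  then show ?thesis using True assms
    by (simp add: power_mult_distrib fps_X_power_mult_nth nonfull_prob_def)
next
  case False
  have "n - (m - 1) - m + (m - 1) = n - m" using assms False by auto
  then show ?thesis using False assms fps_ones_power'[of m "n - (m - 1) - m"]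
    by (simp add: power_mult_distrib fps_X_power_mult_nth nonfull_prob_def)
qed

text \<open>\<open>k + r choose r\<close> has the generating function (1 / (1 - X))^(r + 1), so
  convolution with the other children only raises the power. The cases r = 0, 1, 2 yield the total
  mass and the moments used below.\<close>

lemma sum_split_prob_choose:
  assumes "m \<ge> 2" "m - 1 \<le> n"
  shows "(\<Sum>k\<le>n. split_prob m n k * real (k + r choose r)) =
    real (n + r choose (m - 1 + r)) / real (n choose (m - 1))"
proof -
  have "(\<Sum>k\<le>n. split_prob m n k * real (k + r choose r)) =
     fps_nth (fps_ones ^ Suc r * fps_ones ^ (m - 1)) (n - (m - 1)) / real (n choose (m - 1))"
    unfolding nth_mult_ones_power[OF assms, symmetric] fps_ones_power ..
  also have "fps_ones ^ Suc r * fps_ones ^ (m - 1) = fps_ones ^ (m + r)"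
    using assms by (simp only: power_add[symmetric]) (simp add: add.commute)
  also have "fps_nth (fps_ones ^ (m + r)) (n - (m - 1)) =
    real (n - (m - 1) + (m + r - 1) choose (m + r - 1))"
    using assms by (intro fps_ones_power') auto
  also have "n - (m - 1) + (m + r - 1) = n + r" using assms by auto
  also have "m + r - 1 = m - 1 + r" using assms by auto
  finally show ?thesis .
qed

lemma choose_pos: "m - 1 \<le> n \<Longrightarrow> real (n choose (m - 1)) > 0"
  by (simp add: zero_less_binomial)

lemma sum_split_prob:
  assumes "m \<ge> 2" "m - 1 \<le> n"
  shows "(\<Sum>k\<le>n. split_prob m n k) = 1"
  using sum_split_prob_choose[OF assms, of 0] choose_pos[OF assms(2)] by simp

lemma absorb: "m \<ge> 1 \<Longrightarrow> real m * real (n + 1 choose m) = real (n + 1) * real (n choose (m - 1))"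
proof -
  assume "m \<ge> 1"
  then have "m * (n + 1 choose m) = (n + 1) * (n choose (m - 1))"
    using binomial_absorption[of "m - 1" "n + 1"] by simp
  then show ?thesis by (metis of_nat_mult)
qed

text \<open>The subtree sizes, each increased by one, add up to n + 1; so n + 1 is harmonic for the
  step to the children.\<close>

lemma sum_split_prob_linear:
  assumes "m \<ge> 2" "m - 1 \<le> n"
  shows "real m * (\<Sum>k\<le>n. split_prob m n k * real (k + 1)) = real (n + 1)"
proof -
  have "(\<Sum>k\<le>n. split_prob m n k * real (k + 1)) = real (n + 1 choose m) / real (n choose (m - 1))"
    using sum_split_prob_choose[OF assms, of 1] assms by simp
  also have "real m * \<dots> = real (n + 1) * real (n choose (m - 1)) / real (n choose (m - 1))"
    using absorb[of m n] assms by (simp only: times_divide_eq_right)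
  finally show ?thesis using choose_pos[OF assms(2)] by simp
qed

text \<open>The factor 2 / (m + 1) < 1 is the contraction of the variance per level in
  \<open>avg_dev_square\<close>.\<close>

lemma sum_split_prob_quadratic:
  assumes "m \<ge> 2" "m - 1 \<le> n"
  shows "real m * (\<Sum>k\<le>n. split_prob m n k * (real (k + 1) * real (k + 2))) =
    2 * real (n + 1) * real (n + 2) / real (m + 1)"
proof -
  have c2: "real (k + 1) * real (k + 2) = 2 * real (k + 2 choose 2)" for k
    using absorb[of 2 "k + 1"] by (simp add: numeral_2_eq_2 algebra_simps)
  have "real (m + 1) * real (n + 2 choose (m + 1)) = real (n + 2) * real (n + 1 choose m)"
    using absorb[of "m + 1" "n + 1"] by (simp add: numeral_2_eq_2)
  then have "real m * real (m + 1) * real (n + 2 choose (m + 1)) =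
    real (n + 2) * (real m * real (n + 1 choose m))"
    by (simp only: mult.assoc) (simp only: mult.left_commute)
  also have "real m * real (n + 1 choose m) = real (n + 1) * real (n choose (m - 1))"
    using assms by (intro absorb) auto
  finally
  have a: "real (n + 2 choose (m + 1)) = real (n + 2) * real (n + 1) * real (n choose (m - 1)) / (real m *
    real (m + 1))"
    using assms by (simp only: eq_divide_eq mult.assoc) (simp add: mult_ac)
  have "(\<Sum>k\<le>n. split_prob m n k * (real (k + 1) * real (k + 2))) =
    2 * (\<Sum>k\<le>n. split_prob m n k * real (k + 2 choose 2))"
    unfolding c2 sum_distrib_left by (intro sum.cong) auto
  also have "\<dots> = 2 * (real (n + 2 choose (m + 1)) / real (n choose (m - 1)))"
    unfolding sum_split_prob_choose[OF assms] using assms by simp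
  finally have q: "(\<Sum>k\<le>n. split_prob m n k * (real (k + 1) * real (k + 2))) = \<dots>" .
  have "M * (2 * (x * y * C / (M * M') / C)) = 2 * y * x / M'" if "M \<noteq> 0" "C \<noteq> 0" for M C M' x y :: real
    using that by simp
  then show ?thesis unfolding q a using choose_pos[OF assms(2)] assms by simp
qed

lemma split_prob_0:
  assumes "m \<ge> 2" "m - 1 \<le> n"
  shows "split_prob m n 0 = real (m - 1) / real n"
proof -
  have "real (m - 1) * real (n choose (m - 1)) = real n * real (n - 1 choose (m - 2))"
    using absorb[of "m - 1" "n - 1"] assms by (simp add: numeral_2_eq_2)
  then show ?thesis using assms choose_pos[OF assms(2)] by (simp add: split_prob_def field_simps)
qed

lemma split_prob_le:
  assumes "m \<ge> 2" "m - 1 \<le> n"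
  shows "split_prob m n k \<le> real (m - 1) / real n"
proof -
  have "split_prob m n k \<le> split_prob m n 0"
    using assms by (auto simp: split_prob_def intro!: divide_right_mono binomial_right_mono)
  then show ?thesis by (simp add: split_prob_0[OF assms])
qed

section \<open>Additive functionals of the tree\<close>

lemma length_permutations_of_reals: "xs \<in> permutations_of_set (real ` {..<n}) \<Longrightarrow> length xs = n"
  using length_finite_permutations_of_set[of xs "real ` {..<n}"] by (simp add: card_image)

lemma avg_sum: "avg n (\<lambda>xs. \<Sum>i\<in>I. f i xs) = (\<Sum>i\<in>I. avg n (f i))"
  unfolding avg_def perm_avg_def by (subst sum.swap) (simp add: sum_divide_distrib)

lemma avg_add: "avg n (\<lambda>xs. f xs + g xs) = avg n f + avg n g"
  unfolding avg_def perm_avg_def by (simp add: sum.distrib add_divide_distrib)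

lemma avg_diff: "avg n (\<lambda>xs. f xs - g xs) = avg n f - avg n g"
  unfolding avg_def perm_avg_def by (simp add: sum_subtractf diff_divide_distrib)

lemma avg_cmult: "avg n (\<lambda>xs. c * f xs) = c * avg n f"
  unfolding avg_def perm_avg_def by (simp add: sum_distrib_left)

lemma avg_const: "avg n (\<lambda>xs. c) = c"
  unfolding avg_def perm_avg_def by (simp add: card_image)

lemma avg_mono: "(\<And>xs. length xs = n \<Longrightarrow> f xs \<le> g xs) \<Longrightarrow> avg n f \<le> avg n g"
  unfolding avg_def perm_avg_def
  by (intro divide_right_mono sum_mono) (auto dest: length_permutations_of_reals)

lemma avg_cong: "(\<And>xs. length xs = n \<Longrightarrow> f xs = g xs) \<Longrightarrow> avg n f = avg n g"
  by (intro antisym avg_mono) auto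

lemma avg_0 [simp]: "avg 0 f = f []"
  unfolding avg_def perm_avg_def by simp

text \<open>The first n entries of a uniform order of n + 1 keys are a uniform order of a random
  n-subset, and by order invariance it does not matter which subset.\<close>

lemma avg_butlast_mono:
  assumes inv: "order_invariant \<phi>" and mono: "\<And>xs x. \<phi> xs \<le> \<phi> (xs @ [x])"
  shows "avg n \<phi> \<le> avg (Suc n) \<phi>"
proof -
  define S where "S = real ` {..<Suc n}"
  have S: "finite S" "card S = Suc n" by (auto simp: S_def card_image)
  have "(\<Sum>xs\<in>permutations_of_set S. \<phi> (take n xs)) =
    (\<Sum>K | K \<subseteq> S \<and> card K = n. \<Sum>ks\<in>permutations_of_set K. \<Sum>ys\<in>permutations_of_set (S - K). \<phi> ks)"
    using S by (intro sum_permutations_take_drop[where G = "\<lambda>ks _. \<phi> ks"]) auto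
  also have "\<dots> = (\<Sum>K | K \<subseteq> S \<and> card K = n. fact n * avg n \<phi>)"
  proof (intro sum.cong refl)
    fix K assume "K \<in> {K. K \<subseteq> S \<and> card K = n}"
    then have K: "finite K" "card K = n" "K \<subseteq> S" using S finite_subset by auto
    have "card (S - K) = 1" using K S by (simp add: card_Diff_subset)
    moreover have "(\<Sum>ks\<in>permutations_of_set K. \<phi> ks) = fact n * avg n \<phi>"
      using perm_avg_eq_avg[OF inv K(1)] K by (simp add: perm_avg_def field_simps)
    ultimately show "(\<Sum>ks\<in>permutations_of_set K. \<Sum>ys\<in>permutations_of_set (S - K). \<phi> ks) = fact n * avg n \<phi>"
      using S by simp
  qed
  also have "\<dots> = fact (Suc n) * avg n \<phi>"
    using n_subsets[OF S(1), of n] S by simp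
  finally have eq: "(\<Sum>xs\<in>permutations_of_set S. \<phi> (take n xs)) / fact (Suc n) = avg n \<phi>" by simp
  have "(\<Sum>xs\<in>permutations_of_set S. \<phi> (take n xs)) \<le> (\<Sum>xs\<in>permutations_of_set S. \<phi> xs)"
  proof (rule sum_mono)
    fix xs assume "xs \<in> permutations_of_set S"
    then have "length xs = Suc n" unfolding S_def by (rule length_permutations_of_reals)
    then have "xs = take n xs @ [last xs]"
      by (metis append_butlast_last_id butlast_conv_take diff_Suc_1 length_0_conv nat.distinct(1))
    then show "\<phi> (take n xs) \<le> \<phi> xs" using mono[of "take n xs" "last xs"] by simp
  qed
  then show ?thesis unfolding eq[symmetric] unfolding avg_def perm_avg_def S_def[symmetric] S(2)
    by (intro divide_right_mono) auto
qed

text \<open>Common source of the free and the full transition: \<eta> is constantly 1 in the first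
  case and the indicator of a nonempty list in the second.\<close>

lemma avg_one_subkeys:
  assumes m: "m \<ge> 2" "m - 1 \<le> n" and i: "i \<in> {1..m}" and inv: "order_invariant \<psi>" "order_invariant \<eta>"
  shows "avg n (\<lambda>xs. \<psi> (subkeys m xs i) * (\<Prod>j\<in>{1..m} - {i}. \<eta> (subkeys m xs j))) =
    fps_nth (Abs_fps (\<lambda>k. avg k \<psi>) * Abs_fps (\<lambda>k. avg k \<eta>) ^ (m - 1)) (n - (m - 1)) / real (n choose (m -
      1))"
proof -
  let ?\<phi> = "\<lambda>j. if j = i then \<psi> else \<eta>"
  have p: "(\<Prod>j=1..m. f j) = f i * (\<Prod>j\<in>{1..m} - {i}. f j)" for f :: "nat \<Rightarrow> 'a :: comm_monoid_mult"
    using i by (simp add: prod.remove)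
  have "avg n (\<lambda>xs. \<psi> (subkeys m xs i) * (\<Prod>j\<in>{1..m} - {i}. \<eta> (subkeys m xs j))) =
     avg n (\<lambda>xs. \<Prod>j=1..m. ?\<phi> j (subkeys m xs j))"
    unfolding p by (intro avg_cong arg_cong2[of _ _ _ _ "(*)"] prod.cong) auto
  also have "\<dots> = fps_nth (\<Prod>j=1..m. Abs_fps (\<lambda>k. avg k (?\<phi> j))) (n - (m - 1)) / real (n choose (m - 1))"
    using inv by (intro avg_prod_subkeys m) auto
  also have "(\<Prod>j=1..m. Abs_fps (\<lambda>k. avg k (?\<phi> j))) =
    Abs_fps (\<lambda>k. avg k \<psi>) * Abs_fps (\<lambda>k. avg k \<eta>) ^ (m - 1)"
    unfolding p using i by simp
  finally show ?thesis .
qed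

lemma avg_subkeys:
  assumes "m \<ge> 2" "m - 1 \<le> n" "i \<in> {1..m}" "order_invariant \<psi>"
  shows "avg n (\<lambda>xs. \<psi> (subkeys m xs i)) = (\<Sum>k\<le>n. split_prob m n k * avg k \<psi>)"
  using avg_one_subkeys[OF assms, of "\<lambda>_. 1"] nth_mult_ones_power[OF assms(1,2), of "\<lambda>k. avg k \<psi>"]
  by (simp add: order_invariant_def avg_const)

lemma avg_nonempty: "avg k (\<lambda>xs. of_bool (xs \<noteq> [])) = of_bool (0 < k)"
proof -
  have "avg k (\<lambda>xs. of_bool (xs \<noteq> [])) = avg k (\<lambda>xs. of_bool (0 < k))" by (rule avg_cong) auto
  then show ?thesis by (simp add: avg_const)
qed

lemma X_mult_ones: "Abs_fps (\<lambda>k. of_bool (0 < k)) = fps_X * fps_ones"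
  by (auto simp: fps_eq_iff fps_X_mult_nth)

definition full :: "nat \<Rightarrow> real list \<Rightarrow> bool" where
  "full m xs \<longleftrightarrow> (\<forall>i\<in>{1..m}. subkeys m xs i \<noteq> [])"

lemma prod_of_bool: "finite A \<Longrightarrow> (\<Prod>x\<in>A. of_bool (P x)) = (of_bool (\<forall>x\<in>A. P x) :: real)"
  by (induction A rule: finite_induct) auto

lemma order_invariant_nonempty: "order_invariant (\<lambda>xs. of_bool (xs \<noteq> []) :: real)"
  by (auto simp: order_invariant_def)

text \<open>As \<psi> vanishes on the empty list, the condition \<open>full\<close> may be replaced
  by a product over the children other than i.\<close>

lemma avg_full_subkeys:
  assumes "m \<ge> 2" "m - 1 \<le> n" "i \<in> {1..m}" "order_invariant \<psi>" "\<psi> [] = 0"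
  shows "avg n (\<lambda>xs. of_bool (full m xs) * \<psi> (subkeys m xs i)) = (\<Sum>k\<le>n. split_prob_full m n k * avg k \<psi>)"
proof -
  have "avg n (\<lambda>xs. of_bool (full m xs) * \<psi> (subkeys m xs i)) =
     avg n (\<lambda>xs. \<psi> (subkeys m xs i) * (\<Prod>j\<in>{1..m} - {i}. of_bool (subkeys m xs j \<noteq> [])))"
    using assms(3,5) by (intro avg_cong) (auto simp: prod_of_bool full_def)
  then show ?thesis
    using avg_one_subkeys[OF assms(1-4) order_invariant_nonempty] nth_mult_X_ones_power[OF assms(1,2), of
      "\<lambda>k. avg k \<psi>"]
    by (simp add: avg_nonempty X_mult_ones)
qed

lemma avg_full:
  assumes "m \<ge> 2" "m - 1 \<le> n"
  shows "avg n (\<lambda>xs. of_bool (full m xs)) = 1 - nonfull_prob m n"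
proof -
  have "avg n (\<lambda>xs. of_bool (full m xs)) = avg n (\<lambda>xs. \<Prod>i=1..m. of_bool (subkeys m xs i \<noteq> []))"
    by (simp add: prod_of_bool full_def)
  also have "\<dots> = fps_nth ((fps_X * fps_ones) ^ m) (n - (m - 1)) / real (n choose (m - 1))"
    using avg_prod_subkeys[OF assms, of "\<lambda>_ xs. of_bool (xs \<noteq> [])"] order_invariant_nonempty
    by (simp add: avg_nonempty X_mult_ones)
  finally show ?thesis using nth_X_ones_power[OF assms] by simp
qed

text \<open>Union bound over the empty child. The order 1 / n is what keeps the toll of the clade
  functional bounded.\<close>

lemma nonfull_prob_le:
  assumes "m \<ge> 2" "m - 1 \<le> n"
  shows "nonfull_prob m n \<le> real m * real (m - 1) / real n"
proof -
  have "nonfull_prob m n = avg n (\<lambda>xs. 1 - of_bool (full m xs))"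
    unfolding avg_diff by (simp add: avg_full[OF assms] avg_const)
  also have "\<dots> \<le> avg n (\<lambda>xs. \<Sum>i=1..m. of_bool (subkeys m xs i = []))"
  proof (rule avg_mono)
    fix xs
    show "1 - of_bool (full m xs) \<le> (\<Sum>i=1..m. of_bool (subkeys m xs i = []) :: real)"
    proof (cases "full m xs")
      case False
      then obtain i where "i \<in> {1..m}" "subkeys m xs i = []" by (auto simp: full_def)
      then show ?thesis using member_le_sum[of i "{1..m}" "\<lambda>i. of_bool (subkeys m xs i =
        []) :: real"] False by simp
    qed (simp add: sum_nonneg)
  qed
  also have "\<dots> = (\<Sum>i=1..m. \<Sum>k\<le>n. split_prob m n k * avg k (\<lambda>xs. of_bool (xs = [])))"
    unfolding avg_sum by (intro sum.cong refl avg_subkeys assms) (auto simp: order_invariant_def)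
  also have "\<dots> = real m * split_prob m n 0"
  proof -
    have "avg k (\<lambda>xs. of_bool (xs = [])) = of_bool (k = 0)" for k
    proof -
      have "avg k (\<lambda>xs. of_bool (xs = [])) = avg k (\<lambda>xs. of_bool (k = 0))" by (rule avg_cong) auto
      then show ?thesis by (simp add: avg_const)
    qed
    moreover have "(\<Sum>k\<le>n. split_prob m n k * of_bool (k = 0)) = split_prob m n 0"
      using sum.delta[of "{..n}" 0 "split_prob m n"] by (simp add: if_distrib cong: if_cong)
    ultimately show ?thesis by simp
  qed
  finally show ?thesis using split_prob_0[OF assms] by simp
qed

text \<open>The size of the search tree is the case \<open>b = True\<close>, the number of maximal clades
  the case \<open>b = False\<close>.\<close>

locale tree_functional =
  fixes m :: nat and b :: bool and F :: "real list \<Rightarrow> real"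
  assumes m2: "m \<ge> 2"
    and F_Nil [simp]: "F [] = 0"
    and F_short: "\<And>xs. xs \<noteq> [] \<Longrightarrow> length xs < m - 1 \<Longrightarrow> F xs = 1"
    and F_rec: "\<And>xs. m - 1 \<le> length xs \<Longrightarrow>
      F xs = (if b \<or> full m xs then of_bool b + (\<Sum>i=1..m. F (subkeys m xs i)) else 1)"
begin

lemma keys_induct [case_names short step]:
  assumes "\<And>xs. length xs < m - 1 \<Longrightarrow> P xs"
    and "\<And>xs. m - 1 \<le> length xs \<Longrightarrow> (\<And>i. P (subkeys m xs i)) \<Longrightarrow> P xs"
  shows "P xs"
proof (induction "length xs" arbitrary: xs rule: less_induct)
  case less
  show ?case
  proof (cases "length xs < m - 1")
    case False
    then have l: "m - 1 \<le> length xs" by simp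
    show ?thesis using assms(2)[OF l] less[OF length_subkeys_less[OF m2 l]] by blast
  qed (rule assms(1))
qed

text \<open>For the upper bound: the root uses up m - 1 >= 1 keys, which pays for the 1 that it may
  contribute.\<close>

lemma F_bounds: "0 \<le> F xs \<and> F xs \<le> length xs \<and> (xs \<noteq> [] \<longrightarrow> 1 \<le> F xs)"
proof (induction xs rule: keys_induct)
  case (short xs)
  then show ?case using F_short[of xs] by (cases xs) auto
next
  case (step xs)
  have ne: "xs \<noteq> []" using step m2 by auto
  have "1 \<le> F xs"
  proof (cases "b \<or> full m xs")
    case True
    show ?thesis
    proof (cases b)
      case True
      then show ?thesis using step by (simp add: F_rec sum_nonneg)
    next
      case False
      then have f: "full m xs" using True by simp
      have "1 \<le> F (subkeys m xs 1)" using f step(2) m2 by (auto simp: full_def)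
      also have "\<dots> \<le> (\<Sum>i=1..m. F (subkeys m xs i))"
        using step(2) m2 by (intro member_le_sum) auto
      finally show ?thesis using step f False by (simp add: F_rec)
    qed
  qed (use step in \<open>simp add: F_rec\<close>)
  moreover have "F xs \<le> length xs"
  proof -
    have "(\<Sum>i=1..m. F (subkeys m xs i)) \<le> (\<Sum>i=1..m. real (length (subkeys m xs i)))"
      using step(2) by (intro sum_mono) auto
    also have "\<dots> = real (length xs - (m - 1))"
      using sum_length_subkeys[OF m2, of xs] by (simp flip: of_nat_sum)
    finally have "(\<Sum>i=1..m. F (subkeys m xs i)) \<le> real (length xs) - 1" using m2 step by simp
    moreover have "1 \<le> real (length xs)" using ne by (cases xs) auto
    ultimately show ?thesis using step by (auto simp: F_rec)
  qed
  ultimately show ?case by auto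
qed

lemma subkeys_append:
  assumes "m - 1 \<le> length xs"
  shows "subkeys m (xs @ [x]) i = subkeys m xs i @ (if interval_index (take (m - 1) xs) x =
    i then [x] else [])"
  using assms by (auto simp: subkeys_def)

text \<open>A new key reaches only one child, and a full root stays full. If the root was a clade
  then \<open>F\<close> was 1, which is a lower bound after the insertion as well, so a root that
  becomes full does no harm.\<close>

lemma F_append_mono: "F xs \<le> F (xs @ [x])"
proof (induction xs arbitrary: x rule: keys_induct)
  case (short xs)
  then have "F xs \<le> 1" using F_short[of xs] by (cases xs) auto
  also have "1 \<le> F (xs @ [x])" using F_bounds[of "xs @ [x]"] by simp
  finally show ?case .
next
  case (step xs)
  show ?case
  proof (cases "b \<or> full m xs")
    case True
    then have "b \<or> full m (xs @ [x])" using step by (auto simp: full_def subkeys_append)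
    moreover have "(\<Sum>i=1..m. F (subkeys m xs i)) \<le> (\<Sum>i=1..m. F (subkeys m (xs @ [x]) i))"
      using step by (intro sum_mono) (auto simp: subkeys_append)
    ultimately show ?thesis using step True by (simp add: F_rec)
  next
    case False
    then show ?thesis using step F_bounds[of "xs @ [x]"] by (simp add: F_rec)
  qed
qed

lemma full_map: "strict_mono_on (set xs) f \<Longrightarrow> full m (map f xs) \<longleftrightarrow> full m xs"
  by (simp add: full_def subkeys_map)

lemma strict_mono_on_subkeys: "strict_mono_on (set xs) f \<Longrightarrow> strict_mono_on (set (subkeys m xs i)) f"
  by (auto simp: strict_mono_on_def subkeys_def dest!: in_set_dropD)

lemma order_invariant_F: "order_invariant F"
proof -
  have "\<forall>f. strict_mono_on (set xs) f \<longrightarrow> F (map f xs) = F xs" for xs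
  proof (induction xs rule: keys_induct)
    case (short xs)
    then show ?case using F_short[of xs] F_short[of "map _ xs"] by (cases xs) auto
  next
    case (step xs)
    show ?case
    proof (intro allI impI)
      fix f :: "real \<Rightarrow> real" assume f: "strict_mono_on (set xs) f"
      have "F (map f (subkeys m xs i)) = F (subkeys m xs i)" for i
        using step(2) strict_mono_on_subkeys[OF f] by blast
      then show "F (map f xs) = F xs" using step(1) f by (simp add: F_rec full_map subkeys_map)
    qed
  qed
  then show ?thesis by (auto simp: order_invariant_def)
qed

definition mean :: "nat \<Rightarrow> real" where "mean n = avg n F"

lemma mean_0 [simp]: "mean 0 = 0" by (simp add: mean_def)

lemma mean_nonneg: "0 \<le> mean n" and mean_le: "mean n \<le> n"
proof -
  have "avg n (\<lambda>_. 0) \<le> avg n F" "avg n F \<le> avg n (\<lambda>_. n)" using F_bounds by (auto intro!: avg_mono)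
  then show "0 \<le> mean n" "mean n \<le> n" by (simp_all add: mean_def avg_const)
qed

lemma mean_mono: "incseq mean"
  unfolding mean_def by (intro incseq_SucI avg_butlast_mono order_invariant_F F_append_mono)

lemma mean_short: "0 < n \<Longrightarrow> n < m - 1 \<Longrightarrow> mean n = 1"
  using avg_cong[of n F "\<lambda>_. 1"] F_short by (auto simp: mean_def avg_const)

definition kernel :: "nat \<Rightarrow> nat \<Rightarrow> real" where
  "kernel n k = (if b then split_prob m n k else split_prob_full m n k)"

lemma avg_sel_subkeys:
  assumes "m - 1 \<le> n" "i \<in> {1..m}" "order_invariant \<psi>" "\<psi> [] = 0"
  shows "avg n (\<lambda>xs. of_bool (b \<or> full m xs) * \<psi> (subkeys m xs i)) = (\<Sum>k\<le>n. kernel n k * avg k \<psi>)"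
  using avg_subkeys[OF m2 assms(1-3)] avg_full_subkeys[OF m2 assms] by (simp add: kernel_def)

lemma mean_rec:
  assumes n: "m - 1 \<le> n"
  shows "mean n = (if b then 1 else nonfull_prob m n) + real m * (\<Sum>k\<le>n. kernel n k * mean k)"
proof -
  have "mean n = avg n (\<lambda>xs. (if b then 1 else 1 - of_bool (full m xs)) +
      (\<Sum>i=1..m. of_bool (b \<or> full m xs) * F (subkeys m xs i)))"
    unfolding mean_def using n by (intro avg_cong) (auto simp: F_rec)
  also have "\<dots> = (if b then 1 else nonfull_prob m n) + (\<Sum>i=1..m. \<Sum>k\<le>n. kernel n k * avg k F)"
    unfolding avg_add avg_sum
    by (intro arg_cong2[of _ _ _ _ "(+)"] sum.cong avg_sel_subkeys n order_invariant_F refl F_Nil)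
       (auto simp: avg_diff avg_const avg_full[OF m2 n])
  finally show ?thesis by (simp add: mean_def)
qed

text \<open>The conditional expectation of \<open>F\<close> given the sizes of the subtrees down to depth \<open>J\<close>.\<close>

primrec cond_mean :: "nat \<Rightarrow> real list \<Rightarrow> real" where
  "cond_mean 0 xs = mean (length xs)"
| "cond_mean (Suc J) xs = (if length xs < m - 1 then F xs
     else if b \<or> full m xs then of_bool b + (\<Sum>i=1..m. cond_mean J (subkeys m xs i)) else 1)"

lemma cond_mean_Nil [simp]: "cond_mean J [] = 0"
  using m2 by (cases J) auto

lemma order_invariant_cond_mean: "order_invariant (cond_mean J)"
proof (induction J)
  case 0
  then show ?case by (simp add: order_invariant_def)
next
  case (Suc J)
  show ?case unfolding order_invariant_def
  proof (intro allI impI)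
    fix f :: "real \<Rightarrow> real" and xs :: "real list" assume f: "strict_mono_on (set xs) f"
    have "cond_mean J (subkeys m (map f xs) i) = cond_mean J (subkeys m xs i)" for i
      using Suc f strict_mono_on_subkeys[OF f, of i] by (simp add: subkeys_map order_invariant_def)
    moreover have "F (map f xs) = F xs" using order_invariant_F f by (simp add: order_invariant_def)
    ultimately show "cond_mean (Suc J) (map f xs) = cond_mean (Suc J) xs"
      using f by (simp add: full_map)
  qed
qed

definition dev :: "nat \<Rightarrow> real list \<Rightarrow> real" where "dev J xs = F xs - cond_mean J xs"

lemma dev_Nil [simp]: "dev J [] = 0" by (simp add: dev_def)

lemma order_invariant_dev: "order_invariant (dev J)"
  using order_invariant_F order_invariant_cond_mean[of J] by (simp add: dev_def order_invariant_def)

lemma dev_Suc: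
  "dev (Suc J) xs = (if length xs < m - 1 then 0 else
     (\<Sum>i=1..m. of_bool (b \<or> full m xs) * dev J (subkeys m xs i)))"
  by (auto simp: dev_def F_rec sum_subtractf)

text \<open>Martingale property of \<open>cond_mean\<close>: given its length, each child's list is
  in uniform order, so mean 0 is inherited from level to level.\<close>

lemma avg_dev: "avg n (dev J) = 0"
proof (induction J arbitrary: n)
  case 0
  have "avg n (dev 0) = avg n (\<lambda>xs. F xs - mean n)" by (rule avg_cong) (simp add: dev_def)
  then show ?case by (simp add: avg_diff avg_const mean_def)
next
  case (Suc J)
  show ?case
  proof (cases "n < m - 1")
    case True
    then have "avg n (dev (Suc J)) = avg n (\<lambda>_. 0)" by (intro avg_cong) (simp add: dev_Suc)
    then show ?thesis by (simp add: avg_const)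
  next
    case False
    then have "avg n (dev (Suc J)) = avg n (\<lambda>xs. \<Sum>i=1..m. of_bool (b \<or> full m xs) * dev J (subkeys m xs i))"
      by (intro avg_cong) (simp add: dev_Suc)
    also have "\<dots> = (\<Sum>i=1..m. \<Sum>k\<le>n. kernel n k * avg k (dev J))"
      unfolding avg_sum using False
      by (intro sum.cong avg_sel_subkeys order_invariant_dev dev_Nil refl) auto
    finally show ?thesis using Suc by simp
  qed
qed

lemma avg_dev_cross:
  assumes n: "m - 1 \<le> n" and ij: "i \<in> {1..m}" "j \<in> {1..m}" "i \<noteq> j"
  shows "avg n (\<lambda>xs. of_bool (b \<or> full m xs) * (dev J (subkeys m xs i) * dev J (subkeys m xs j))) = 0"
proof -
  let ?\<phi> = "\<lambda>l. if l = i \<or> l = j then dev J else (\<lambda>xs. of_bool (b \<or> xs \<noteq> []))"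
  have "avg n (\<lambda>xs. of_bool (b \<or> full m xs) * (dev J (subkeys m xs i) * dev J (subkeys m xs j))) =
     avg n (\<lambda>xs. \<Prod>l=1..m. ?\<phi> l (subkeys m xs l))"
  proof (rule avg_cong)
    fix xs
    have "(\<Prod>l=1..m. ?\<phi> l (subkeys m xs l)) = ?\<phi> i (subkeys m xs i) * (\<Prod>l\<in>{1..m} - {i}. ?\<phi> l (subkeys m xs
      l))"
      using ij by (intro prod.remove) auto
    also have "(\<Prod>l\<in>{1..m} - {i}. ?\<phi> l (subkeys m xs l)) = ?\<phi> j (subkeys m xs j) *
        (\<Prod>l\<in>{1..m} - {i} - {j}. ?\<phi> l (subkeys m xs l))"
      using ij by (intro prod.remove) auto
    also have "(\<Prod>l\<in>{1..m} - {i} - {j}. ?\<phi> l (subkeys m xs l)) =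
        (\<Prod>l\<in>{1..m} - {i} - {j}. of_bool (b \<or> subkeys m xs l \<noteq> []))"
      by (intro prod.cong) auto
    also have "\<dots> = of_bool (\<forall>l\<in>{1..m} - {i} - {j}. b \<or> subkeys m xs l \<noteq> [])"
      by (rule prod_of_bool) auto
    finally have eq: "(\<Prod>l=1..m. ?\<phi> l (subkeys m xs l)) = dev J (subkeys m xs i) * (dev J (subkeys m xs j) *
        of_bool (\<forall>l\<in>{1..m} - {i} - {j}. b \<or> subkeys m xs l \<noteq> []))" using ij(3)
          by (simp only: simp_thms if_True)
    show "of_bool (b \<or> full m xs) * (dev J (subkeys m xs i) * dev J (subkeys m xs j)) =
        (\<Prod>l=1..m. ?\<phi> l (subkeys m xs l))"
    proof (cases "subkeys m xs i = [] \<or> subkeys m xs j = []")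
      case True
      then have "dev J (subkeys m xs i) = 0 \<or> dev J (subkeys m xs j) = 0" by auto
      then show ?thesis unfolding eq by (elim disjE) (simp_all only: mult_zero_left mult_zero_right)
    next
      case False
      then have "(\<forall>l\<in>{1..m} - {i} - {j}. b \<or> subkeys m xs l \<noteq> []) \<longleftrightarrow> b \<or> full m xs"
        using ij(1,2) unfolding full_def by blast
      then show ?thesis unfolding eq by (simp only: mult_ac)
    qed
  qed
  also have "\<dots> = fps_nth (\<Prod>l=1..m. Abs_fps (\<lambda>k. avg k (?\<phi> l))) (n - (m - 1)) / real (n choose (m - 1))"
  proof (intro avg_prod_subkeys m2 n)
    fix l
    show "order_invariant (?\<phi> l)"
      using order_invariant_dev[of J] by (auto simp: order_invariant_def)
  qed
  also have "(\<Prod>l=1..m. Abs_fps (\<lambda>k. avg k (?\<phi> l))) = 0"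
    using ij by (intro prod_zero) (auto simp: avg_dev fps_eq_iff intro!: bexI[of _ i])
  finally show ?thesis by simp
qed

text \<open>Orthogonality leaves only the diagonal terms, and the summed squares of the subtree
  sizes shrink by 2 / (m + 1) per level. At level 0 the trivial bound of order n^2 suffices.\<close>

lemma avg_dev_square: "avg n (\<lambda>xs. (dev J xs)\<^sup>2) \<le> (2 / (m + 1)) ^ J * (real n + 1)\<^sup>2"
proof (induction J arbitrary: n)
  case 0
  have "avg n (\<lambda>xs. (dev 0 xs)\<^sup>2) \<le> avg n (\<lambda>_. (real n + 1)\<^sup>2)"
  proof (rule avg_mono)
    fix xs :: "real list" assume l: "length xs = n"
    have "\<bar>dev 0 xs\<bar> \<le> real n + 1" using F_bounds[of xs] mean_nonneg[of n] mean_le[of n] l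
      by (auto simp: dev_def)
    then have "\<bar>dev 0 xs\<bar>\<^sup>2 \<le> (real n + 1)\<^sup>2" by (intro power_mono) auto
    then show "(dev 0 xs)\<^sup>2 \<le> (real n + 1)\<^sup>2" by simp
  qed
  then show ?case by (simp add: avg_const)
next
  case (Suc J)
  let ?r = "2 / (m + 1) :: real"
  show ?case
  proof (cases "n < m - 1")
    case True
    then have "avg n (\<lambda>xs. (dev (Suc J) xs)\<^sup>2) = avg n (\<lambda>_. 0)" by (intro avg_cong) (simp add: dev_Suc)
    then show ?thesis by (simp add: avg_const)
  next
    case False
    then have n: "m - 1 \<le> n" by simp
    let ?p = "\<lambda>xs. of_bool (b \<or> full m xs) :: real"
    let ?D = "\<lambda>xs i. dev J (subkeys m xs i)"
    have "avg n (\<lambda>xs. (dev (Suc J) xs)\<^sup>2) = avg n (\<lambda>xs. \<Sum>i=1..m. \<Sum>j=1..m. ?p xs * (?D xs i * ?D xs j))"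
    proof (rule avg_cong)
      fix xs :: "real list" assume "length xs = n"
      then have "(dev (Suc J) xs)\<^sup>2 = (\<Sum>i=1..m. \<Sum>j=1..m. (?p xs * ?D xs i) * (?p xs * ?D xs j))"
        using n by (simp add: dev_Suc power2_eq_square sum_product)
      also have "\<dots> = (\<Sum>i=1..m. \<Sum>j=1..m. ?p xs * (?D xs i * ?D xs j))"
        by (intro sum.cong) auto
      finally show "(dev (Suc J) xs)\<^sup>2 = (\<Sum>i=1..m. \<Sum>j=1..m. ?p xs * (?D xs i * ?D xs j))" .
    qed
    also have "\<dots> = (\<Sum>i=1..m. \<Sum>j=1..m. avg n (\<lambda>xs. ?p xs * (?D xs i * ?D xs j)))"
      unfolding avg_sum ..
    also have "\<dots> = (\<Sum>i=1..m. avg n (\<lambda>xs. ?p xs * (?D xs i * ?D xs i)))"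
    proof (rule sum.cong)
      fix i assume i: "i \<in> {1..m}"
      show "(\<Sum>j=1..m. avg n (\<lambda>xs. ?p xs * (?D xs i * ?D xs j))) = avg n (\<lambda>xs. ?p xs * (?D xs i * ?D xs i))"
        using i avg_dev_cross[OF n i] by (subst sum.remove[of _ i]) auto
    qed simp
    also have "\<dots> \<le> (\<Sum>i=1..m. avg n (\<lambda>xs. (?D xs i)\<^sup>2))"
      by (intro sum_mono avg_mono) (auto simp: power2_eq_square)
    also have "\<dots> = (\<Sum>i=1..m. \<Sum>k\<le>n. split_prob m n k * avg k (\<lambda>xs. (dev J xs)\<^sup>2))"
      using order_invariant_dev[of J] by (intro sum.cong refl avg_subkeys m2 n) (auto simp:
        order_invariant_def)
    also have "\<dots> = real m * (\<Sum>k\<le>n. split_prob m n k * avg k (\<lambda>xs. (dev J xs)\<^sup>2))" by simp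
    also have "\<dots> \<le> real m * (\<Sum>k\<le>n. split_prob m n k * (?r ^ J * (real k + 1)\<^sup>2))"
      using Suc by (intro mult_left_mono sum_mono) (auto simp: split_prob_nonneg)
    \<comment> \<open>(k + 1)^2 = (k + 1) (k + 2) - (k + 1) reduces to the two moments that are
      known exactly.\<close>
    also have "\<dots> = ?r ^ J * (real m * (\<Sum>k\<le>n. split_prob m n k * (real (k + 1) * real (k + 2))) -
        real m * (\<Sum>k\<le>n. split_prob m n k * real (k + 1)))"
      by (simp add: sum_distrib_left right_diff_distrib[symmetric] sum_subtractf[symmetric]
        power2_eq_square algebra_simps del: right_diff_distrib)
    also have "\<dots> = ?r ^ J * (2 * real (n + 1) * real (n + 2) / real (m + 1) - real (n + 1))"
      unfolding sum_split_prob_quadratic[OF m2 n] sum_split_prob_linear[OF m2 n] ..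
    also have "\<dots> \<le> ?r ^ J * (?r * (real n + 1)\<^sup>2)"
    proof (intro mult_left_mono)
      have "2 * real (n + 1) * real (n + 2) / real (m + 1) - real (n + 1) =
         ?r * (real n + 1)\<^sup>2 + (real n + 1) * (2 / (m + 1) - 1)"
          (is "?lhs = _")
      proof -
        have "2 * N * (N + 1) / M - N = 2 / M * N\<^sup>2 + N * (2 / M - 1)" for N M :: real
          by (simp add: power2_eq_square algebra_simps add_divide_distrib)
        from this[of "real n + 1" "real (m + 1)"] show ?thesis by (simp add: add_ac)
      qed
      also have "(real n + 1) * (2 / (m + 1) - 1) \<le> 0"
        using m2 by (intro mult_nonneg_nonpos) (auto simp: field_simps)
      finally show "2 * real (n + 1) * real (n + 2) / real (m + 1) - real (n + 1) \<le> ?r * (real n + 1)\<^sup>2"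
        by simp
    qed simp
    finally show ?thesis by (simp add: mult_ac)
  qed
qed

end

section \<open>Exponential life histories\<close>

lemma sets_exponential [simp, measurable_cong]: "sets (exponential r) = sets borel"
  and space_exponential [simp]: "space (exponential r) = UNIV"
  by (simp_all add: exponential_def)

lemma prob_space_exponential: "r > 0 \<Longrightarrow> prob_space (exponential r)"
  unfolding exponential_def by (rule prob_space_exponential_density)

text \<open>Rate 0 gives the null measure. It occurs at j = 0, \<delta> = 0 in the families below,
  which are indexed by all natural numbers although the products run over {2..M}.\<close>

lemma sigma_finite_exponential:
  assumes "r \<ge> 0" shows "sigma_finite_measure (exponential r)"
proof (cases "r = 0")
  case True
  have "exponential_density 0 = (\<lambda>_. 0)" by (auto simp: fun_eq_iff exponential_density_def)
  then have "emeasure (exponential r) (space (exponential r)) = 0"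
    unfolding exponential_def True by (subst emeasure_density) auto
  then show ?thesis by (intro finite_measure.axioms(1) finite_measureI) simp
next
  case False
  then interpret prob_space "exponential r" using assms by (intro prob_space_exponential) simp
  show ?thesis ..
qed

lemma product_sigma_finite_exponential:
  "\<delta> \<ge> 0 \<Longrightarrow> product_sigma_finite (\<lambda>j::nat. exponential (real j + \<delta>))"
  by (simp add: product_sigma_finite_def sigma_finite_exponential)

lemma nn_integral_exponential:
  assumes [measurable]: "f \<in> borel_measurable borel"
  shows "(\<integral>\<^sup>+x. f x \<partial>exponential r) = (\<integral>\<^sup>+x. ennreal (exponential_density r x) * f x \<partial>lborel)"
  unfolding exponential_def by (rule nn_integral_density) (auto simp: measurable_lborel1)

text \<open>For a natural number c >= 1, (a + c - 1 choose a) times this is the probability that a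
  Yule process started with c particles has a births by time s. The particles are the gaps between
  keys.\<close>

definition weight :: "real \<Rightarrow> nat \<Rightarrow> real \<Rightarrow> real" where
  "weight c a s = (if s < 0 then 0 else exp (- c * s) * (1 - exp (- s)) ^ a)"

lemma borel_measurable_weight [measurable]: "weight c a \<in> borel_measurable borel"
  unfolding weight_def by measurable

lemma weight_nonneg: "weight c a s \<ge> 0"
  by (auto simp: weight_def)

definition weighted :: "real \<Rightarrow> nat \<Rightarrow> (real \<Rightarrow> ennreal) \<Rightarrow> ennreal" where
  "weighted c a q = (\<integral>\<^sup>+s. ennreal (weight c a s) * q s \<partial>lborel)"

text \<open>Convolution of the weight with an exponential law of rate \<open>r\<close> amounts to integration in the variable
  \<open>1 - exp (- s)\<close>, provided that the exponent is \<open>r + 1\<close>.\<close>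

lemma weighted_exponential:
  assumes r: "r > 0" and q [measurable]: "q \<in> borel_measurable borel"
  shows "weighted (r + 1) a (\<lambda>s. \<integral>\<^sup>+y. q (s + y) \<partial>exponential r) =
    ennreal (r / (a + 1)) * weighted r (Suc a) q"
proof -
  let ?e = "exponential_density r"
  have [measurable]: "?e \<in> borel_measurable borel" by simp
  have "weighted (r + 1) a (\<lambda>s. \<integral>\<^sup>+y. q (s + y) \<partial>exponential r) =
      (\<integral>\<^sup>+s. \<integral>\<^sup>+u. ennreal (weight (r + 1) a s) * (ennreal (?e (u - s)) * q u) \<partial>lborel \<partial>lborel)"
    unfolding weighted_def
  proof (intro nn_integral_cong)
    fix s :: real
    have "(\<integral>\<^sup>+y. q (s + y) \<partial>exponential r) = (\<integral>\<^sup>+y. ennreal (?e y) * q (s + y) \<partial>lborel)"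
      by (rule nn_integral_exponential) measurable
    also have "\<dots> = (\<integral>\<^sup>+u. ennreal (?e (u - s)) * q u \<partial>lborel)"
      by (subst nn_integral_real_affine[where c = 1 and t = "-s"]) (auto simp: algebra_simps)
    finally show "ennreal (weight (r + 1) a s) * (\<integral>\<^sup>+y. q (s + y) \<partial>exponential r) =
        (\<integral>\<^sup>+u. ennreal (weight (r + 1) a s) * (ennreal (?e (u - s)) * q u) \<partial>lborel)"
      by (simp add: nn_integral_cmult)
  qed
  also have "\<dots> = (\<integral>\<^sup>+u. \<integral>\<^sup>+s. ennreal (weight (r + 1) a s) * (ennreal (?e (u - s)) * q u) \<partial>lborel \<partial>lborel)"
    by (rule lborel_pair.Fubini') measurable
  also have "\<dots> = (\<integral>\<^sup>+u. ennreal (r / (a + 1)) * (ennreal (weight r (Suc a) u) * q u) \<partial>lborel)"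
  proof (intro nn_integral_cong)
    fix u :: real
    let ?f = "\<lambda>s. r * exp (- r * u) * (exp (- s) * (1 - exp (- s)) ^ a)"
    let ?F = "\<lambda>s. r * exp (- r * u) * ((1 - exp (- s)) ^ Suc a / (a + 1))"
    have "(\<integral>\<^sup>+s. ennreal (weight (r + 1) a s) * (ennreal (?e (u - s)) * q u) \<partial>lborel) =
       (\<integral>\<^sup>+s. ennreal (weight (r + 1) a s) * ennreal (?e (u - s)) * q u \<partial>lborel)"
      by (simp add: mult.assoc)
    also have "\<dots> = (\<integral>\<^sup>+s. ennreal (weight (r + 1) a s) * ennreal (?e (u - s)) \<partial>lborel) * q u"
      by (rule nn_integral_multc) measurable
    also have "(\<integral>\<^sup>+s. ennreal (weight (r + 1) a s) * ennreal (?e (u - s)) \<partial>lborel) =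
        (\<integral>\<^sup>+s. ennreal (?f s) * indicator {0..u} s \<partial>lborel)"
    proof (intro nn_integral_cong)
      fix s :: real
      have e: "exp (- (r + 1) * s) * exp (- (u - s) * r) = exp (- r * u) * exp (- s)"
        by (simp only: exp_add[symmetric]) (simp add: algebra_simps)
      have "weight (r + 1) a s * ?e (u - s) = ?f s" if "0 \<le> s" "s \<le> u"
      proof -
        have "weight (r + 1) a s * ?e (u - s) = r * (exp (- (r + 1) * s) * exp (- (u - s) * r)) * (1 - exp
          (- s)) ^ a"
          using that by (simp add: weight_def exponential_density_def)
        then show ?thesis unfolding e by simp
      qed
      moreover have "weight (r + 1) a s * ?e (u - s) = 0" if "\<not> (0 \<le> s \<and> s \<le> u)"
        using that by (auto simp: weight_def exponential_density_def)
      ultimately show "ennreal (weight (r + 1) a s) * ennreal (?e (u - s)) =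
        ennreal (?f s) * indicator {0..u} s"
        by (auto simp: ennreal_mult'[symmetric] weight_nonneg indicator_def)
    qed
    also have "\<dots> = ennreal (r / (a + 1)) * ennreal (weight r (Suc a) u)"
    proof (cases "u < 0")
      case True
      then show ?thesis by (simp add: weight_def)
    next
      case False
      have "(\<integral>\<^sup>+s. ennreal (?f s) * indicator {0..u} s \<partial>lborel) = ennreal (?F u - ?F 0)"
      proof (rule nn_integral_FTC_Icc)
        fix s :: real assume "s \<in> {0..u}"
        then have s: "0 \<le> s" "s \<le> u" by auto
        show "0 \<le> ?f s" using s r by simp
        have "((\<lambda>s. (1 - exp (- s)) ^ Suc a / (a + 1)) has_real_derivative (exp (- s) * (1 - exp (- s)) ^
          a)) (at s)"
          by (auto intro!: derivative_eq_intros simp del: power_Suc)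
        then show "(?F has_real_derivative ?f s) (at s)" by (rule DERIV_cmult)
      qed (use False in auto)
      then show ?thesis using False r
        by (simp add: weight_def ennreal_mult'[symmetric] mult_ac)
    qed
    finally show "(\<integral>\<^sup>+s. ennreal (weight (r + 1) a s) * (ennreal (?e (u - s)) * q u) \<partial>lborel) =
       ennreal (r / (a + 1)) * (ennreal (weight r (Suc a) u) * q u)" by (simp add: mult.assoc)
  qed
  also have "\<dots> = ennreal (r / (a + 1)) * weighted r (Suc a) q"
    unfolding weighted_def by (rule nn_integral_cmult) measurable
  finally show ?thesis .
qed

lemma sums_neg_binomial:
  fixes z :: real assumes z: "0 \<le> z" "z < 1"
  shows "(\<lambda>r. real (r + d choose d) * z ^ r) sums ((1 / (1 - z)) ^ Suc d)"
proof (induction d)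
  case 0
  then show ?case using geometric_sums[of z] z by simp
next
  case (Suc d)
  have g: "(\<lambda>r. z ^ r) sums (1 / (1 - z))" using geometric_sums[of z] z by simp
  have "(\<lambda>k. \<Sum>i\<le>k. (real (i + d choose d) * z ^ i) * z ^ (k - i)) sums
    ((\<Sum>r. real (r + d choose d) * z ^ r) * (\<Sum>r. z ^ r))"
    using Suc g z by (intro Cauchy_product_sums) (auto simp: sums_iff)
  also have "(\<lambda>k. \<Sum>i\<le>k. (real (i + d choose d) * z ^ i) * z ^ (k - i)) =
    (\<lambda>k. real (k + Suc d choose Suc d) * z ^ k)"
  proof
    fix k
    have "(\<Sum>i\<le>k. (real (i + d choose d) * z ^ i) * z ^ (k - i)) = (\<Sum>i\<le>k. real (i + d choose d) * z ^ k)"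
      by (intro sum.cong refl) (simp add: mult.assoc power_add[symmetric])
    also have "\<dots> = (\<Sum>i\<le>k. real (i + d choose d)) * z ^ k" by (simp add: sum_distrib_right)
    also have "(\<Sum>i\<le>k. real (i + d choose d)) = fps_nth (fps_ones ^ Suc d * fps_ones) k"
      by (simp only: fps_ones_power fps_mult_nth) (simp add: atLeast0AtMost)
    also have "\<dots> = real (k + Suc d choose Suc d)"
    proof -
      have "fps_ones ^ Suc d * fps_ones = fps_ones ^ Suc (Suc d)" by (simp only: power_Suc2)
      then show ?thesis by (simp only: fps_ones_power fps_nth_Abs_fps)
    qed
    finally show "(\<Sum>i\<le>k. (real (i + d choose d) * z ^ i) * z ^ (k - i)) =
      real (k + Suc d choose Suc d) * z ^ k" .
  qed
  also have "(\<Sum>r. real (r + d choose d) * z ^ r) * (\<Sum>r. z ^ r) = (1 / (1 - z)) ^ Suc (Suc d)"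
    using Suc g by (simp only: sums_iff power_Suc2[of _ "Suc d"])
  finally show ?case .
qed

text \<open>The weight is multiplied by 1, written as exp (- (d + 1) s) times the negative binomial
  series in 1 - exp (- s). This lifts the exponent c to the value that a chain of exponential
  convolutions then uses up one by one.\<close>

lemma weighted_expand:
  assumes q [measurable]: "q \<in> borel_measurable borel"
  shows "weighted c a q = (\<Sum>r. ennreal (real (r + d choose d)) * weighted (c + real (Suc d)) (a + r) q)"
proof -
  have "ennreal (weight c a s) * q s = (\<Sum>r. ennreal (real (r + d choose d)) * (ennreal (weight (c + real
    (Suc d)) (a + r) s) * q s))" for s
  proof (cases "s < 0")
    case False
    let ?z = "1 - exp (- s)"
    have z: "0 \<le> ?z" "?z < 1" using False by auto
    have "(\<lambda>r. exp (- (c + real (Suc d)) * s) * ?z ^ a * (real (r + d choose d) * ?z ^ r)) sums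
        (exp (- (c + real (Suc d)) * s) * ?z ^ a * (1 / (1 - ?z)) ^ Suc d)"
      by (intro sums_mult sums_neg_binomial z)
    also have "(1 / (1 - ?z)) ^ Suc d = exp (real (Suc d) * s)"
    proof -
      have "1 / (1 - ?z) = exp s" by (simp add: exp_minus field_simps)
      then show ?thesis by (simp only: exp_of_nat_mult)
    qed
    also have "exp (- (c + real (Suc d)) * s) * ?z ^ a * exp (real (Suc d) * s) = exp (- c * s) * ?z ^ a"
    proof -
      have "exp (- (c + real (Suc d)) * s) * exp (real (Suc d) * s) = exp (- c * s)"
        by (simp only: exp_add[symmetric]) (simp add: algebra_simps)
      then show ?thesis by (simp add: mult_ac)
    qed
    finally have "(\<lambda>r. real (r + d choose d) * weight (c + real (Suc d)) (a + r) s) sums weight c a s"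
      using False by (simp add: weight_def power_add mult_ac)
    then have "(\<lambda>r. ennreal (real (r + d choose d) * weight (c + real (Suc d)) (a + r) s)) sums ennreal
      (weight c a s)"
      by (subst sums_ennreal) (auto simp: weight_nonneg)
    then have "ennreal (weight c a s) = (\<Sum>r. ennreal (real (r + d choose d) * weight (c + real (Suc d)) (a
      + r) s))"
      by (simp add: sums_iff)
    then show ?thesis
      by (simp add: ennreal_suminf_multc[symmetric] ennreal_mult' mult.assoc)
  qed (simp add: weight_def)
  then have "weighted c a q = (\<integral>\<^sup>+s. (\<Sum>r. ennreal (real (r + d choose d)) * (ennreal (weight (c + real (Suc
    d)) (a + r) s) * q s)) \<partial>lborel)"
    unfolding weighted_def by simp
  also have "\<dots> = (\<Sum>r. \<integral>\<^sup>+s. ennreal (real (r + d choose d)) * (ennreal (weight (c + real (Suc d)) (a + r)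
    s) * q s) \<partial>lborel)"
    by (rule nn_integral_suminf) measurable
  also have "\<dots> = (\<Sum>r. ennreal (real (r + d choose d)) * weighted (c + real (Suc d)) (a + r) q)"
    unfolding weighted_def by (intro suminf_cong nn_integral_cmult) measurable
  finally show ?thesis .
qed

abbreviation exp_product :: "nat \<Rightarrow> real \<Rightarrow> (nat \<Rightarrow> real) measure" where
  "exp_product M \<delta> \<equiv> PiM {2..M} (\<lambda>j. exponential (real j + \<delta>))"

lemma measurable_exp_product_integral [measurable]:
  assumes [measurable]: "q \<in> borel_measurable borel" and \<delta>: "\<delta> \<ge> 0"
  shows "(\<lambda>s::real. \<integral>\<^sup>+Y. q (s + (\<Sum>j=2..M. Y j)) \<partial>exp_product M \<delta>) \<in> borel_measurable borel"
proof -
  interpret product_sigma_finite "\<lambda>j::nat. exponential (real j + \<delta>)"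
    by (rule product_sigma_finite_exponential[OF \<delta>])
  interpret sigma_finite_measure "exp_product M \<delta>" by (rule sigma_finite) simp
  show ?thesis by measurable
qed

text \<open>The rates M + \<delta>, ..., 2 + \<delta> are removed in decreasing order; each use of
  \<open>weighted_exponential\<close> leaves exactly the exponent that the next rate
  requires.\<close>

lemma weighted_exp_product:
  assumes q [measurable]: "q \<in> borel_measurable borel" and \<delta>: "\<delta> \<ge> 0" and M: "M \<ge> 1"
  shows "weighted (real M + 1 + \<delta>) a (\<lambda>s. \<integral>\<^sup>+Y. q (s + (\<Sum>j=2..M. Y j)) \<partial>exp_product M \<delta>) =
    ennreal ((\<Prod>j=2..M. real j + \<delta>) / pochhammer (real a + 1) (M - 1)) * weighted (2 + \<delta>) (a + (M - 1)) q"
  using M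
proof (induction M arbitrary: a rule: dec_induct)
  case base
  then show ?case by (simp add: PiM_empty nn_integral_count_space_finite add.commute)
next
  case (step M)
  interpret product_sigma_finite "\<lambda>j::nat. exponential (real j + \<delta>)"
    by (rule product_sigma_finite_exponential[OF \<delta>])
  have I: "{2..Suc M} = insert (Suc M) {2..M}" using step by auto
  let ?r = "real (Suc M) + \<delta>"
  let ?Q = "\<lambda>s. \<integral>\<^sup>+Y. q (s + (\<Sum>j=2..M. Y j)) \<partial>exp_product M \<delta>"
  have "(\<integral>\<^sup>+Y. q (s + (\<Sum>j=2..Suc M. Y j)) \<partial>exp_product (Suc M) \<delta>) = (\<integral>\<^sup>+y. ?Q (s + y) \<partial>exponential ?r)"
    for s
  proof -
    have "(\<lambda>Y. q (s + (\<Sum>j=2..Suc M. Y j))) \<in> borel_measurable (Pi\<^sub>M (insert (Suc M) {2..M}) (\<lambda>j.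
      exponential (real j + \<delta>)))"
      unfolding I by measurable
    then have "(\<integral>\<^sup>+Y. q (s + (\<Sum>j=2..Suc M. Y j)) \<partial>exp_product (Suc M) \<delta>) =
       (\<integral>\<^sup>+y. \<integral>\<^sup>+Y. q (s + (\<Sum>j=2..Suc M. (Y(Suc M := y)) j)) \<partial>exp_product M \<delta> \<partial>exponential ?r)"
      unfolding I by (subst product_nn_integral_insert_rev) auto
    also have "\<dots> = (\<integral>\<^sup>+y. ?Q (s + y) \<partial>exponential ?r)"
    proof (intro nn_integral_cong arg_cong[of _ _ q])
      fix y and Y :: "nat \<Rightarrow> real"
      have "(\<Sum>j=2..M. (Y(Suc M := y)) j) = (\<Sum>j=2..M. Y j)" by (intro sum.cong) auto
      then show "s + (\<Sum>j=2..Suc M. (Y(Suc M := y)) j) = s + y + (\<Sum>j=2..M. Y j)"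
        unfolding I by (simp add: algebra_simps)
    qed
    finally show ?thesis .
  qed
  then have "weighted (real (Suc M) + 1 + \<delta>) a (\<lambda>s. \<integral>\<^sup>+Y. q (s + (\<Sum>j=2..Suc M. Y j)) \<partial>exp_product (Suc M)
    \<delta>) =
     weighted (?r + 1) a (\<lambda>s. \<integral>\<^sup>+y. ?Q (s + y) \<partial>exponential ?r)"
    by (simp add: add_ac)
  also have "\<dots> = ennreal (?r / (a + 1)) * weighted ?r (Suc a) ?Q"
    using \<delta> by (intro weighted_exponential) (auto intro!: measurable_exp_product_integral)
  also have "weighted ?r (Suc a) ?Q = weighted (real M + 1 + \<delta>) (Suc a) ?Q" by (simp add: add_ac)
  also have "\<dots> = ennreal ((\<Prod>j=2..M. real j + \<delta>) / pochhammer (real (Suc a) + 1) (M - 1)) * weighted (2 + \<delta>)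
    (Suc a + (M - 1)) q"
    by (rule step.IH)
  also have "Suc a + (M - 1) = a + (Suc M - 1)" using step by simp
  also have "ennreal (?r / (a + 1)) * (ennreal ((\<Prod>j=2..M. real j + \<delta>) / pochhammer (real (Suc a) + 1) (M -
    1)) * weighted (2 + \<delta>) (a + (Suc M - 1)) q) =
     ennreal ((\<Prod>j=2..Suc M. real j + \<delta>) / pochhammer (real a + 1) (Suc M - 1)) * weighted (2 + \<delta>) (a + (Suc
       M - 1)) q"
  proof -
    have "pochhammer (real a + 1) (Suc M - 1) = (real a + 1) * pochhammer (real (Suc a) + 1) (M - 1)"
      using step pochhammer_rec[of "real a + 1" "M - 1"] by (simp add: add_ac)
    moreover have "(\<Prod>j=2..Suc M. real j + \<delta>) = ?r * (\<Prod>j=2..M. real j + \<delta>)" unfolding I by simp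
    ultimately have "?r / (a + 1) * ((\<Prod>j=2..M. real j + \<delta>) / pochhammer (real (Suc a) + 1) (M - 1)) =
       (\<Prod>j=2..Suc M. real j + \<delta>) / pochhammer (real a + 1) (Suc M - 1)" by simp
    moreover have "?r / (a + 1) \<ge> 0" using \<delta> by simp
    ultimately show ?thesis by (simp only: mult.assoc[symmetric] ennreal_mult'[symmetric])
  qed
  finally show ?case .
qed

section \<open>The invariant weight of the subtree sizes\<close>

text \<open>The Exp(1) density of the age s times the probability n exp (- 2 s) (1 - exp (- s))^(n -
  1) of n keys at that age: the mean of \<open>q\<close> over the age of \<open>o\<close> on the
  event that its subtree holds n keys.\<close>

definition size_weight :: "nat \<Rightarrow> (real \<Rightarrow> ennreal) \<Rightarrow> ennreal" where
  "size_weight n q = ennreal (real n) * weighted 3 (n - 1) q"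

lemma size_weight_0 [simp]: "size_weight 0 q = 0" by (simp add: size_weight_def)

text \<open>Brings the constant of \<open>weighted_exp_product\<close> into the form of the
  denominator of a split probability.\<close>

lemma pochhammer_choose:
  assumes "m \<ge> 2"
  shows "1 / pochhammer (real a + 1) (m - 2) = real (a + m - 1) / (fact (m - 1) * real (a + m - 1 choose (m
    - 1)))"
proof -
  have "real (a + m - 1 choose (m - 1)) = pochhammer (real (a + m - 1) - real (m - 1) + 1) (m - 1) / fact
    (m - 1)"
    by (simp only: binomial_gbinomial gbinomial_pochhammer')
  also have "real (a + m - 1) - real (m - 1) + 1 = real a + 1" using assms by simp
  also have "pochhammer (real a + 1) (m - 1) = pochhammer (real a + 1) (m - 2) * (real a + 1 + real (m -
    2))"
  proof -
    have "m - 1 = Suc (m - 2)" using assms by simp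
    then show ?thesis using pochhammer_rec'[of "real a + 1" "m - 2"] by (simp only: mult.commute)
  qed
  also have "real a + 1 + real (m - 2) = real (a + m - 1)" using assms by simp
  finally have "fact (m - 1) * real (a + m - 1 choose (m - 1)) =
    pochhammer (real a + 1) (m - 2) * real (a + m - 1)" by simp
  moreover have "pochhammer (real a + 1) (m - 2) > 0" by (intro pochhammer_pos) simp
  moreover have "real (a + m - 1) > 0" using assms by simp
  ultimately show ?thesis by (simp add: field_simps)
qed

lemma prod_shift_fact: "(\<Prod>j=2..M. real j + 1) * 2 = fact (Suc M)" if "M \<ge> 1"
  using that
proof (induction M rule: dec_induct)
  case (step M)
  have I: "{2..Suc M} = insert (Suc M) {2..M}" using step by auto
  show ?case using step.IH by (simp add: I algebra_simps)
qed simp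

lemma prod_fact: "(\<Prod>j=2..M. real j + 0) = fact M" if "M \<ge> 1"
  using that
proof (induction M rule: dec_induct)
  case (step M)
  have I: "{2..Suc M} = insert (Suc M) {2..M}" using step by auto
  show ?case using step.IH by (simp add: I algebra_simps)
qed simp

lemma suminf_shift_zero:
  fixes f :: "nat \<Rightarrow> ennreal"
  assumes "\<And>i. i < k \<Longrightarrow> f i = 0"
  shows "(\<Sum>n. f n) = (\<Sum>r. f (r + k))"
  using assms by (subst suminf_offset[of _ k]) auto

text \<open>\<delta> = 1 stands for the rates j + 1 of the ancestors, and the factor 2 for the
  heir's rate 2. The index r counts keys passed to the m - 1 siblings of the heir beyond those
  included in a; with the keys of the parent the total is a + r + m - 1.\<close>

lemma heir_expand:
  assumes m: "m \<ge> 2" and q [measurable]: "q \<in> borel_measurable borel"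
  shows "2 * weighted 2 a (\<lambda>s. \<integral>\<^sup>+Y. q (s + (\<Sum>j=2..m-1. Y j)) \<partial>exp_product (m - 1) 1) =
    (\<Sum>r. ennreal (real m * real (r + (m - 2) choose (m - 2)) / real (a + r + m - 1 choose (m - 1))) *
      size_weight (a + r + m - 1) q)"
proof -
  let ?Q = "\<lambda>s. \<integral>\<^sup>+Y. q (s + (\<Sum>j=2..m-1. Y j)) \<partial>exp_product (m - 1) 1"
  \<comment> \<open>d = m - 2 lifts the exponent from 2 to m + 1, from which the rates m, ..., 3
    lead down to 3.\<close>
  have "2 * weighted 2 a ?Q = 2 * (\<Sum>r. ennreal (real (r + (m - 2) choose (m - 2))) * weighted (2 + real
    (Suc (m - 2))) (a + r) ?Q)"
    by (subst weighted_expand[where d = "m - 2"]) (auto intro: measurable_exp_product_integral)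
  also have "2 + real (Suc (m - 2)) = real (m - 1) + 1 + 1" using m by simp
  also have "(\<lambda>r. ennreal (real (r + (m - 2) choose (m - 2))) * weighted (real (m - 1) + 1 + 1) (a + r) ?Q)
    =
    (\<lambda>r. ennreal (real (r + (m - 2) choose (m - 2))) *
      (ennreal ((\<Prod>j=2..m-1. real j + 1) / pochhammer (real (a + r) + 1) (m - 1 - 1)) * weighted (2 + 1) (a
        + r + (m - 1 - 1)) q))"
    using m by (intro ext arg_cong2[of _ _ _ _ "(*)"] refl weighted_exp_product) auto
  also have "2 * suminf \<dots> = (\<Sum>r. 2 * (ennreal (real (r + (m - 2) choose (m - 2))) *
      (ennreal ((\<Prod>j=2..m-1. real j + 1) / pochhammer (real (a + r) + 1) (m - 1 - 1)) * weighted (2 + 1) (a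
        + r + (m - 1 - 1)) q)))"
    by simp
  also have "\<dots> = (\<Sum>r. ennreal (real m * real (r + (m - 2) choose (m - 2)) / real (a + r + m - 1 choose (m -
    1))) * size_weight (a + r + m - 1) q)"
  proof (rule suminf_cong)
    fix r
    let ?n = "a + r + m - 1" and ?c = "real (r + (m - 2) choose (m - 2))"
    let ?pi = "(\<Prod>j=2..m-1. real j + 1)" and ?po = "pochhammer (real (a + r) + 1) (m - 2)"
    have "2 * (?c * (?pi / ?po)) = ?c * ((?pi * 2) * (1 / ?po))" by simp
    also have "?pi * 2 = fact m" using prod_shift_fact[of "m - 1"] m by simp
    also have "1 / ?po = real ?n / (fact (m - 1) * real (?n choose (m - 1)))"
      using pochhammer_choose[OF m, of "a + r"] .
    also have "?c * (fact m * (real ?n / (fact (m - 1) * real (?n choose (m - 1))))) =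
        real m * ?c / real (?n choose (m - 1)) * real ?n"
      using m by (subst fact_reduce[of m]) (simp_all add: field_simps)
    finally have e: "2 * (?c * (?pi / ?po)) = real m * ?c / real (?n choose (m - 1)) * real ?n" .
    have po: "?po \<ge> 0" by (intro less_imp_le pochhammer_pos) simp
    have i: "a + r + (m - 2) = ?n - 1" "m - 1 - 1 = m - 2" "(2 + 1 :: real) = 3" using m by auto
    have "2 * (ennreal ?c * (ennreal (?pi / ?po) * weighted 3 (?n - 1) q)) =
        ennreal (2 * (?c * (?pi / ?po))) * weighted 3 (?n - 1) q"
    proof -
      have "2 * (ennreal c * (ennreal x * W)) = ennreal (2 * (c * x)) * W" if "c \<ge> 0" "x \<ge> 0" for c x W
        using that by (simp add: ennreal_mult mult.assoc)
      then show ?thesis using po by (simp add: prod_nonneg)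
    qed
    also have "\<dots> = ennreal (real m * ?c / real (?n choose (m - 1))) * size_weight ?n q"
    proof -
      have "ennreal (x * real n) * W = ennreal x * (ennreal (real n) * W)" if "x \<ge> 0" for x n W
        using that by (simp add: ennreal_mult mult.assoc)
      note h = this
      show ?thesis unfolding e size_weight_def by (rule h) simp
    qed
    finally show "2 * (ennreal ?c * (ennreal (?pi / pochhammer (real (a + r) + 1) (m - 1 - 1)) *
        weighted (2 + 1) (a + r + (m - 1 - 1)) q)) =
          ennreal (real m * ?c / real (?n choose (m - 1))) * size_weight ?n q"
      unfolding i .
  qed
  finally show ?thesis .
qed

text \<open>The second case carries an extra factor (1 - exp (- s))^(m - 1) for the presence of the
  heir's siblings, which shifts both the exponent and the smallest total number of keys by m -
  1.\<close>

lemma heir_expand_split: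
  assumes m: "m \<ge> 2" and q [measurable]: "q \<in> borel_measurable borel"
  shows "2 * weighted 2 k (\<lambda>s. \<integral>\<^sup>+Y. q (s + (\<Sum>j=2..m-1. Y j)) \<partial>exp_product (m - 1) 1) =
      (\<Sum>n. ennreal (real m * split_prob m n k) * size_weight n q)"
    and "2 * weighted 2 (k + (m - 1)) (\<lambda>s. \<integral>\<^sup>+Y. q (s + (\<Sum>j=2..m-1. Y j)) \<partial>exp_product (m - 1) 1) =
      (\<Sum>n. ennreal (real m * split_prob_full m n k) * size_weight n q)"
proof -
  show "2 * weighted 2 k (\<lambda>s. \<integral>\<^sup>+Y. q (s + (\<Sum>j=2..m-1. Y j)) \<partial>exp_product (m - 1) 1) =
      (\<Sum>n. ennreal (real m * split_prob m n k) * size_weight n q)"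
  proof (subst suminf_shift_zero[of "k + (m - 1)"])
    show "ennreal (real m * split_prob m i k) * size_weight i q = 0" if "i < k + (m - 1)" for i
      using that by (simp add: split_prob_def)
    have "r + (k + (m - 1)) - 1 - k = r + (m - 2)" "k + r + m - 1 = r + (k + (m - 1))" for r using m by auto
    then show "2 * weighted 2 k (\<lambda>s. \<integral>\<^sup>+Y. q (s + (\<Sum>j=2..m-1. Y j)) \<partial>exp_product (m - 1) 1) =
       (\<Sum>r. ennreal (real m * split_prob m (r + (k + (m - 1))) k) * size_weight (r + (k + (m - 1))) q)"
      unfolding heir_expand[OF assms] split_prob_def by (intro suminf_cong) simp
  qed
  show "2 * weighted 2 (k + (m - 1)) (\<lambda>s. \<integral>\<^sup>+Y. q (s + (\<Sum>j=2..m-1. Y j)) \<partial>exp_product (m - 1) 1) =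
      (\<Sum>n. ennreal (real m * split_prob_full m n k) * size_weight n q)"
  proof (subst suminf_shift_zero[of "k + 2 * (m - 1)"])
    show "ennreal (real m * split_prob_full m i k) * size_weight i q = 0" if "i < k + 2 * (m - 1)" for i
      using that by (simp add: split_prob_full_def)
    have "r + (k + 2 * (m - 1)) - m - k = r + (m - 2)" "k + (m - 1) + r + m - 1 = r + (k + 2 * (m - 1))"
      for r using m by auto
    then show "2 * weighted 2 (k + (m - 1)) (\<lambda>s. \<integral>\<^sup>+Y. q (s + (\<Sum>j=2..m-1. Y j)) \<partial>exp_product (m - 1) 1) =
       (\<Sum>r. ennreal (real m * split_prob_full m (r + (k + 2 * (m - 1))) k) * size_weight (r + (k + 2 * (m -
         1))) q)"
      unfolding heir_expand[OF assms] split_prob_full_def by (intro suminf_cong) simp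
  qed
qed

text \<open>\<open>weight 0 m\<close> is the probability that m independent Exp(1) times have
  elapsed. The chain with \<delta> = 0 ends at exponent 2, and the Exp(1) density contained in
  \<open>q'\<close> raises it to the 3 of \<open>size_weight\<close>.\<close>

lemma full_expand:
  assumes m: "m \<ge> 2" and q [measurable]: "q \<in> borel_measurable borel"
  defines "q' \<equiv> \<lambda>t. ennreal (exponential_density 1 t) * q t"
  shows "weighted 0 m (\<lambda>s. \<integral>\<^sup>+Y. q' (s + (\<Sum>j=2..m-1. Y j)) \<partial>exp_product (m - 1) 0) =
      (\<Sum>n. ennreal (1 - nonfull_prob m n) * size_weight n q)"
proof -
  have q' [measurable]: "q' \<in> borel_measurable borel" unfolding q'_def by simp
  have w: "weighted 2 a q' = weighted 3 a q" for a
    unfolding weighted_def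
  proof (intro nn_integral_cong)
    fix s :: real
    have "exp (- 2 * s) * exp (- s) = exp (- 3 * s)" by (simp only: exp_add[symmetric]) simp
    then have "weight 2 a s * exponential_density 1 s = weight 3 a s"
      by (auto simp: weight_def exponential_density_def mult_ac)
    moreover have "ennreal (weight 2 a s) * q' s = ennreal (weight 2 a s * exponential_density 1 s) * q s"
      by (simp add: q'_def ennreal_mult weight_nonneg exponential_density_nonneg mult.assoc)
    ultimately show "ennreal (weight 2 a s) * q' s = ennreal (weight 3 a s) * q s" by simp
  qed
  let ?Q = "\<lambda>s. \<integral>\<^sup>+Y. q' (s + (\<Sum>j=2..m-1. Y j)) \<partial>exp_product (m - 1) 0"
  have "weighted 0 m ?Q = (\<Sum>r. ennreal (real (r + (m - 1) choose (m - 1))) * weighted (0 + real (Suc (m -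
    1))) (m + r) ?Q)"
    by (rule weighted_expand[where d = "m - 1"], rule measurable_exp_product_integral[OF q']) simp
  also have "0 + real (Suc (m - 1)) = real (m - 1) + 1 + 0" using m by simp
  also have "(\<lambda>r. ennreal (real (r + (m - 1) choose (m - 1))) * weighted (real (m - 1) + 1 + 0) (m + r) ?Q)
    =
    (\<lambda>r. ennreal (real (r + (m - 1) choose (m - 1))) *
      (ennreal ((\<Prod>j=2..m-1. real j + 0) / pochhammer (real (m + r) + 1) (m - 1 - 1)) * weighted (2 + 0) (m
        + r + (m - 1 - 1)) q'))"
    using m by (intro ext arg_cong2[of _ _ _ _ "(*)"] refl weighted_exp_product) auto
  also have "suminf \<dots> = (\<Sum>r. ennreal (1 - nonfull_prob m (r + (2 * m - 1))) * size_weight (r + (2 * m - 1))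
    q)"
  proof (rule suminf_cong)
    fix r
    let ?n = "m + r + m - 1" and ?c = "real (r + (m - 1) choose (m - 1))"
    let ?pi = "(\<Prod>j=2..m-1. real j + 0)" and ?po = "pochhammer (real (m + r) + 1) (m - 2)"
    have "?c * (?pi / ?po) = ?c * (fact (m - 1) * (1 / ?po))" using prod_fact[of "m - 1"] m by simp
    also have "1 / ?po = real ?n / (fact (m - 1) * real (?n choose (m - 1)))"
      using pochhammer_choose[OF m, of "m + r"] .
    also have "?c * (fact (m - 1) * (real ?n / (fact (m - 1) * real (?n choose (m - 1))))) =
        ?c / real (?n choose (m - 1)) * real ?n"
      by simp
    finally have e: "?c * (?pi / ?po) = ?c / real (?n choose (m - 1)) * real ?n" .
    have po: "?po \<ge> 0" by (intro less_imp_le pochhammer_pos) simp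
    have i: "m + r + (m - 2) = ?n - 1" "m - 1 - 1 = m - 2" "(2 + 0 :: real) = 2" "r + (2 * m - 1) = ?n"
      using m by auto
    have "ennreal ?c * (ennreal (?pi / ?po) * weighted 2 (?n - 1) q') =
        ennreal (?c * (?pi / ?po)) * weighted 3 (?n - 1) q"
    proof -
      have "ennreal c * (ennreal x * W) = ennreal (c * x) * W" if "c \<ge> 0" "x \<ge> 0" for c x W
        using that by (simp add: ennreal_mult mult.assoc)
      then show ?thesis using po unfolding w by (simp add: prod_nonneg)
    qed
    also have "\<dots> = ennreal (?c / real (?n choose (m - 1))) * size_weight ?n q"
    proof -
      have "ennreal (x * real n) * W = ennreal x * (ennreal (real n) * W)" if "x \<ge> 0" for x n W
        using that by (simp add: ennreal_mult mult.assoc)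
      note h = this
      show ?thesis unfolding e size_weight_def by (rule h) simp
    qed
    also have "?c / real (?n choose (m - 1)) = 1 - nonfull_prob m ?n"
      using m by (simp add: nonfull_prob_def)
    finally show "ennreal ?c * (ennreal (?pi / pochhammer (real (m + r) + 1) (m - 1 - 1)) *
        weighted (2 + 0) (m + r + (m - 1 - 1)) q') =
          ennreal (1 - nonfull_prob m (r + (2 * m - 1))) * size_weight (r + (2 * m - 1)) q"
      unfolding i .
  qed
  also have "\<dots> = (\<Sum>n. ennreal (1 - nonfull_prob m n) * size_weight n q)"
  proof (rule suminf_shift_zero[symmetric])
    fix n assume "n < 2 * m - 1"
    then have "n - m < m - 1" using m by auto
    then show "ennreal (1 - nonfull_prob m n) * size_weight n q = 0" by (simp add: nonfull_prob_def)
  qed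
  finally show ?thesis .
qed

text \<open>With d = 1 the expansion of 1 runs over the states of a Yule process started with two
  gaps: the age of \<open>o\<close> is split according to the number of keys below
  \<open>o\<close>.\<close>

lemma total_expand:
  assumes q [measurable]: "q \<in> borel_measurable borel"
  shows "(\<integral>\<^sup>+t. q t \<partial>exponential 1) = (\<Sum>n. size_weight n q)"
proof -
  have "(\<integral>\<^sup>+t. q t \<partial>exponential 1) = weighted 1 0 q"
    unfolding weighted_def by (subst nn_integral_exponential)
      (auto intro!: nn_integral_cong simp: weight_def exponential_density_def)
  also have "\<dots> = (\<Sum>r. ennreal (real (r + 1 choose 1)) * weighted (1 + real (Suc 1)) (0 + r) q)"
    by (rule weighted_expand) simp
  also have "\<dots> = (\<Sum>r. size_weight (r + 1) q)"
    by (simp add: size_weight_def add_ac)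
  also have "\<dots> = (\<Sum>n. size_weight n q)"
    by (rule suminf_shift_zero[symmetric]) simp
  finally show ?thesis .
qed

lemma tendsto_one_minus_exp_power: "((\<lambda>s::real. (1 - exp (- s)) ^ a) \<longlongrightarrow> 1) at_top"
proof -
  have "((\<lambda>s::real. exp (- s)) \<longlongrightarrow> 0) at_top"
    by (rule filterlim_compose[OF exp_at_bot filterlim_uminus_at_bot_at_top])
  then have "((\<lambda>s::real. (1 - exp (- s)) ^ a) \<longlongrightarrow> (1 - 0) ^ a) at_top"
    by (intro tendsto_intros)
  then show ?thesis by simp
qed

lemma weighted_const:
  assumes F: "\<And>s. 0 \<le> s \<Longrightarrow> (F has_real_derivative (exp (- c * s) * (1 - exp (- s)) ^ a)) (at s)"
    and T: "(F \<longlongrightarrow> T) at_top"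
  shows "weighted c a (\<lambda>_. 1) = ennreal (T - F 0)"
proof -
  have "weighted c a (\<lambda>_. 1) = (\<integral>\<^sup>+s. ennreal (exp (- c * s) * (1 - exp (- s)) ^ a) * indicator {0..} s
    \<partial>lborel)"
    unfolding weighted_def by (intro nn_integral_cong) (auto simp: weight_def indicator_def)
  also have "\<dots> = ennreal (T - F 0)"
    by (rule nn_integral_FTC_atLeast) (use F T in auto)
  finally show ?thesis .
qed

text \<open>In the variable z = 1 - exp (- s) this is the Beta integral of z^a (1 - z) over [0, 1],
  and the next one that of z^a (1 - z)^2; the antiderivatives are the expanded primitives.\<close>

lemma weighted_2_const: "weighted 2 a (\<lambda>_. 1) = ennreal (1 / ((real a + 1) * (real a + 2)))"
proof -
  let ?F = "\<lambda>s. (1 - exp (- s)) ^ (a + 1) / (real a + 1) - (1 - exp (- s)) ^ (a + 2) / (real a + 2)"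
  have "weighted 2 a (\<lambda>_. 1) = ennreal ((1 / (real a + 1) - 1 / (real a + 2)) - ?F 0)"
  proof (rule weighted_const)
    fix s :: real
    have e: "exp (- 2 * s) = exp (- s) * exp (- s)" by (simp only: exp_add[symmetric]) simp
    have "((\<lambda>s. (1 - exp (- s)) ^ (a + 1) / (real a + 1)) has_real_derivative ((1 - exp (- s)) ^ a * exp (-
      s))) (at s)"
      by (auto intro!: derivative_eq_intros simp del: power_Suc simp: add_ac)
    moreover have "((\<lambda>s. (1 - exp (- s)) ^ (a + 2) / (real a + 2)) has_real_derivative ((1 - exp (- s)) ^
      (a + 1) * exp (- s))) (at s)"
      by (auto intro!: derivative_eq_intros simp del: power_Suc simp: add_ac)
    ultimately have "(?F has_real_derivative ((1 - exp (- s)) ^ a * exp (- s)) - ((1 - exp (- s)) ^ (a + 1)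
      * exp (- s))) (at s)"
      by (intro DERIV_diff)
    also have "((1 - exp (- s)) ^ a * exp (- s)) - ((1 - exp (- s)) ^ (a + 1) * exp (- s)) =
      exp (- 2 * s) * (1 - exp (- s)) ^ a"
      unfolding e by (simp add: algebra_simps)
    finally show "(?F has_real_derivative exp (- 2 * s) * (1 - exp (- s)) ^ a) (at s)" .
  qed (intro tendsto_add tendsto_diff tendsto_mult tendsto_divide tendsto_const
    tendsto_one_minus_exp_power; simp)
  then show ?thesis by (simp add: field_simps)
qed

lemma weighted_3_const: "weighted 3 a (\<lambda>_. 1) = ennreal (2 / ((real a + 1) * (real a + 2) * (real a + 3)))"
proof -
  let ?F = "\<lambda>s. (1 - exp (- s)) ^ (a + 1) / (real a + 1) - 2 * ((1 - exp (- s)) ^ (a + 2) / (real a + 2)) +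
    (1 - exp (- s)) ^ (a + 3) / (real a + 3)"
  have "weighted 3 a (\<lambda>_. 1) = ennreal ((1 / (real a + 1) - 2 * (1 / (real a + 2)) + 1 / (real a + 3)) - ?F
    0)"
  proof (rule weighted_const)
    fix s :: real
    have e: "exp (- 3 * s) = exp (- s) * exp (- s) * exp (- s)" by (simp only: exp_add[symmetric]) simp
    have "((\<lambda>s. (1 - exp (- s)) ^ (a + 1) / (real a + 1)) has_real_derivative ((1 - exp (- s)) ^ a * exp (-
      s))) (at s)"
      by (auto intro!: derivative_eq_intros simp del: power_Suc simp: add_ac)
    moreover have "((\<lambda>s. (1 - exp (- s)) ^ (a + 2) / (real a + 2)) has_real_derivative ((1 - exp (- s)) ^
      (a + 1) * exp (- s))) (at s)"
      by (auto intro!: derivative_eq_intros simp del: power_Suc simp: add_ac)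
    moreover have "((\<lambda>s. (1 - exp (- s)) ^ (a + 3) / (real a + 3)) has_real_derivative ((1 - exp (- s)) ^
      (a + 2) * exp (- s))) (at s)"
      by (auto intro!: derivative_eq_intros simp del: power_Suc simp: add_ac)
    ultimately have "(?F has_real_derivative ((1 - exp (- s)) ^ a * exp (- s)) - 2 * ((1 - exp (- s)) ^ (a
      + 1) * exp (- s)) + ((1 - exp (- s)) ^ (a + 2) * exp (- s))) (at s)"
      by (intro DERIV_add DERIV_diff DERIV_cmult)
    also have "((1 - exp (- s)) ^ a * exp (- s)) - 2 * ((1 - exp (- s)) ^ (a + 1) * exp (- s)) + ((1 - exp
      (- s)) ^ (a + 2) * exp (- s)) =
        exp (- 3 * s) * (1 - exp (- s)) ^ a"
      unfolding e by (simp add: algebra_simps power2_eq_square)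
    finally show "(?F has_real_derivative exp (- 3 * s) * (1 - exp (- s)) ^ a) (at s)" .
  qed (intro tendsto_add tendsto_diff tendsto_mult tendsto_divide tendsto_const
    tendsto_one_minus_exp_power; simp)
  also have "?F 0 = 0" by simp
  also have "1 / (real a + 1) - 2 * (1 / (real a + 2)) + 1 / (real a + 3) - 0 =
    2 / ((real a + 1) * (real a + 2) * (real a + 3))"
  proof -
    have "1 / x - 2 * (1 / (x + 1)) + 1 / (x + 2) - 0 = 2 / (x * (x + 1) * (x + 2))" if x: "x > 0"
      for x :: real
    proof -
      have nz: "x \<noteq> 0" "x + 1 \<noteq> 0" "x + 2 \<noteq> 0" using x by auto
      have "1 / x - 2 * (1 / (x + 1)) + 1 / (x + 2) =
        ((x + 1) * (x + 2) - 2 * (x * (x + 2)) + x * (x + 1)) / (x * (x + 1) * (x + 2))"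
      proof -
        have e: "1 / x = (x + 1) * (x + 2) / (x * (x + 1) * (x + 2))"
          "1 / (x + 1) = x * (x + 2) / (x * (x + 1) * (x + 2))"
          "1 / (x + 2) = x * (x + 1) / (x * (x + 1) * (x + 2))" using nz by simp_all
        have "a / D - 2 * (b / D) + c / D = (a - 2 * b + c) / D" for a b c D :: real
          by (simp add: add_divide_distrib diff_divide_distrib)
        then show ?thesis unfolding e .
      qed
      also have "(x + 1) * (x + 2) - 2 * (x * (x + 2)) + x * (x + 1) = 2" by (simp add: algebra_simps)
      finally show ?thesis by simp
    qed
    from this[of "real a + 1"] show ?thesis by (simp add: add_ac)
  qed
  finally show ?thesis .
qed

text \<open>For n > 0 the law of the number of keys below \<open>o\<close>, of total mass 1. The
  value 1 at n = 0 lies outside this law; it is the one for which \<open>fringe_adjoint\<close>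
  holds at k = 0 too.\<close>

definition fringe_prob :: "nat \<Rightarrow> real" where
  "fringe_prob n = 2 / ((real n + 1) * (real n + 2))"

lemma size_weight_const: "n > 0 \<Longrightarrow> size_weight n (\<lambda>_. 1) = ennreal (fringe_prob n)"
proof -
  assume n: "n > 0"
  then have "real n * (2 / ((real (n - 1) + 1) * (real (n - 1) + 2) * (real (n - 1) + 3))) = fringe_prob n"
    unfolding fringe_prob_def by (simp add: of_nat_diff add_ac)
  then show ?thesis unfolding size_weight_def weighted_3_const
    by (simp only: ennreal_mult'[symmetric] of_nat_0_le_iff)
qed

lemma fringe_prob_pos: "fringe_prob n > 0" by (simp add: fringe_prob_def)

text \<open>The case q = 1 of \<open>heir_expand_split\<close>: with the ages integrated out, the
  step from heir to parent becomes the transposed split kernel.\<close>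

lemma fringe_adjoint:
  assumes m: "m \<ge> 2"
  shows "(\<lambda>n. fringe_prob n * (real m * split_prob m n k)) sums fringe_prob k"
proof -
  interpret prob_space "exp_product (m - 1) 1" by (intro prob_space_PiM prob_space_exponential) auto
  have "ennreal (fringe_prob k) = 2 * weighted 2 k (\<lambda>_. 1)"
    unfolding weighted_2_const fringe_prob_def by (simp flip: ennreal_mult' ennreal_numeral)
  also have "\<dots> = 2 * weighted 2 k (\<lambda>s. \<integral>\<^sup>+Y. 1 \<partial>exp_product (m - 1) 1)"
    by (simp only: nn_integral_const emeasure_space_1 mult_1_left)
  also have "\<dots> = (\<Sum>n. ennreal (real m * split_prob m n k) * size_weight n (\<lambda>_. 1))"
    using m by (intro heir_expand_split) auto
  also have "\<dots> = (\<Sum>n. ennreal (fringe_prob n * (real m * split_prob m n k)))"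
  proof (rule suminf_cong)
    fix n
    show "ennreal (real m * split_prob m n k) * size_weight n (\<lambda>_. 1) =
      ennreal (fringe_prob n * (real m * split_prob m n k))"
    proof (cases "n = 0")
      case True
      then show ?thesis using m by (simp add: split_prob_def)
    next
      case False
      then show ?thesis using fringe_prob_pos[of n]
        by (simp add: size_weight_const ennreal_mult'[symmetric] split_prob_nonneg mult_ac)
    qed
  qed
  finally have "(\<lambda>n. ennreal (fringe_prob n * (real m * split_prob m n k))) sums ennreal (fringe_prob k)"
    by (simp add: sums_iff)
  then show ?thesis
    by (subst (asm) sums_ennreal) (simp_all add: split_prob_nonneg less_imp_le[OF fringe_prob_pos])
qed

section \<open>Convergence of the mean\<close>

text \<open>\<open>exit_weight m N\<close> is the part of the invariant weight \<open>fringe_prob\<close> that enters \<open>{0..N}\<close> from above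
  in one step.\<close>

definition exit_weight :: "nat \<Rightarrow> nat \<Rightarrow> nat \<Rightarrow> real" where
  "exit_weight m N k = fringe_prob k - (\<Sum>n\<le>N. fringe_prob n * (real m * split_prob m n k))"

lemma sums_exit_weight:
  assumes "m \<ge> 2"
  shows "(\<lambda>n. fringe_prob (n + Suc N) * (real m * split_prob m (n + Suc N) k)) sums exit_weight m N k"
  using sums_split_initial_segment[OF fringe_adjoint[OF assms, of k], of "Suc N"]
  by (simp add: exit_weight_def lessThan_Suc_atMost)

lemma exit_weight_nonneg:
  assumes "m \<ge> 2"
  shows "0 \<le> exit_weight m N k"
  by (rule sums_le[OF _ sums_zero sums_exit_weight[OF assms]])
     (simp add: split_prob_nonneg less_imp_le[OF fringe_prob_pos])

text \<open>Since \<open>split_prob\<close> is at most (m - 1) / n, a telescoping series dominates.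
  The bound is uniform in k and of order 1 / N^2, so weighted with k + 1 the indices k <= \<eta> N
  carry only O(\<eta>^2).\<close>

lemma exit_weight_le:
  assumes m: "m \<ge> 2"
  shows "exit_weight m N k \<le> real m * real (m - 1) / (real (N + 1) * real (N + 2))"
proof -
  let ?f = "\<lambda>n. 1 / (real (n + N + 1) * real (n + N + 2))"
  let ?g = "\<lambda>n. 2 / (real (n + N + 1) * real (n + N + 2) * real (n + N + 3))"
  have "?f \<longlonglongrightarrow> 0" by real_asymp
  from telescope_sums'[OF this] have "(\<lambda>n. ?f n - ?f (Suc n)) sums ?f 0" by simp
  moreover have "?f n - ?f (Suc n) = ?g n" for n
  proof -
    have "1 / (x * (x + 1)) - 1 / ((x + 1) * (x + 2)) = 2 / (x * (x + 1) * (x + 2))" if "x > 0"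
      for x :: real
      using that by (simp add: divide_simps)
    from this[of "real (n + N + 1)"] show ?thesis by (simp add: add_ac)
  qed
  ultimately have "?g sums ?f 0" by simp
  then have "(\<lambda>n. real m * real (m - 1) * ?g n) sums (real m * real (m - 1) * ?f 0)" by (rule sums_mult)
  then have "exit_weight m N k \<le> real m * real (m - 1) * ?f 0"
  proof (rule sums_le[rotated 2])
    fix n
    let ?n = "n + Suc N"
    have "split_prob m ?n k \<le> real (m - 1) / real ?n"
    proof (cases "m - 1 \<le> ?n")
      case True
      then show ?thesis by (rule split_prob_le[OF m])
    next
      case False
      then have "\<not> k + (m - 1) \<le> ?n" by linarith
      then show ?thesis by (simp only: split_prob_def if_False) simp
    qed
    then have "fringe_prob ?n * (real m * split_prob m ?n k) \<le>
      fringe_prob ?n * (real m * (real (m - 1) / real ?n))"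
      by (intro mult_left_mono less_imp_le[OF fringe_prob_pos]) auto
    also have "\<dots> = real m * real (m - 1) * ?g n"
      by (simp add: fringe_prob_def add_ac mult_ac)
    finally show "fringe_prob ?n * (real m * split_prob m ?n k) \<le> real m * real (m - 1) * ?g n" .
  qed (rule sums_exit_weight[OF m])
  then show ?thesis by simp
qed

text \<open>Partial sums of the weighted toll become averages of \<open>a\<close> against
  \<open>exit_weight\<close>; in this way the convergence of the toll series yields information on
  \<open>a\<close>.\<close>

lemma sum_fringe_exit:
  "(\<Sum>n\<le>N. fringe_prob n * (a n - real m * (\<Sum>k\<le>n. split_prob m n k * a k))) =
    (\<Sum>k\<le>N. exit_weight m N k * a k)"
proof -
  have "(\<Sum>k\<le>n. split_prob m n k * a k) = (\<Sum>k\<le>N. split_prob m n k * a k)" if "n \<le> N" for n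
    using that by (intro sum.mono_neutral_left) (auto simp: split_prob_def)
  then have "(\<Sum>n\<le>N. fringe_prob n * (a n - real m * (\<Sum>k\<le>n. split_prob m n k * a k))) =
     (\<Sum>n\<le>N. fringe_prob n * a n - (\<Sum>k\<le>N. fringe_prob n * (real m * split_prob m n k) * a k))"
    by (intro sum.cong refl) (simp add: right_diff_distrib sum_distrib_left mult_ac)
  also have "\<dots> = (\<Sum>n\<le>N. fringe_prob n * a n) - (\<Sum>k\<le>N. \<Sum>n\<le>N. fringe_prob n * (real m * split_prob m n k) * a
    k)"
    unfolding sum_subtractf by (subst sum.swap) simp
  also have "\<dots> = (\<Sum>k\<le>N. exit_weight m N k * a k)"
    by (simp add: exit_weight_def left_diff_distrib sum_subtractf sum_distrib_right)
  finally show ?thesis .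
qed

text \<open>The sum is 2 (1/2 + ... + 1/m) = 2 (H_m - 1), with H_m the harmonic number;
  \<open>1 / total_exit m\<close> is the classical number of nodes per key of an m-ary search
  tree.\<close>

definition total_exit :: "nat \<Rightarrow> real" where
  "total_exit m = (\<Sum>n<m-1. fringe_prob n * real (n + 1))"

lemma total_exit_pos: "m \<ge> 2 \<Longrightarrow> total_exit m > 0"
proof -
  assume "m \<ge> 2"
  then show ?thesis unfolding total_exit_def
    by (intro sum_pos2[of _ 0]) (auto simp: fringe_prob_pos less_imp_le[OF fringe_prob_pos])
qed

text \<open>n + 1 is harmonic for n >= m - 1, so its toll lives on n < m - 1 and the sum does not
  depend on N.\<close>

lemma sum_exit_weight:
  assumes m: "m \<ge> 2" and N: "m - 1 \<le> N"
  shows "(\<Sum>k\<le>N. exit_weight m N k * real (k + 1)) = total_exit m"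
proof -
  have "(\<Sum>k\<le>N. exit_weight m N k * real (k + 1)) =
     (\<Sum>n\<le>N. fringe_prob n * (real (n + 1) - real m * (\<Sum>k\<le>n. split_prob m n k * real (k + 1))))"
    by (rule sum_fringe_exit[symmetric])
  also have "\<dots> = (\<Sum>n\<le>N. if n < m - 1 then fringe_prob n * real (n + 1) else 0)"
  proof (intro sum.cong refl)
    fix n
    show "fringe_prob n * (real (n + 1) - real m * (\<Sum>k\<le>n. split_prob m n k * real (k + 1))) =
      (if n < m - 1 then fringe_prob n * real (n + 1) else 0)"
    proof (cases "n < m - 1")
      case True
      then have "(\<Sum>k\<le>n. split_prob m n k * real (k + 1)) = 0"
        by (intro sum.neutral) (auto simp: split_prob_def)
      then show ?thesis using True by simp
    next
      case False
      then have "real m * (\<Sum>k\<le>n. split_prob m n k * real (k + 1)) = real (n + 1)"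
        using m by (intro sum_split_prob_linear) auto
      then show ?thesis using False by simp
    qed
  qed
  also have "\<dots> = total_exit m"
    unfolding total_exit_def using N by (intro sum.mono_neutral_cong_right) auto
  finally show ?thesis .
qed

section \<open>A Tauberian argument for the limit superior\<close>

text \<open>Doob transform by the harmonic function n + 1, hence stochastic for n >= m - 1: the law
  of the size of the child subtree that contains a uniformly chosen one of the n + 1 gaps.\<close>

definition split_kernel :: "nat \<Rightarrow> nat \<Rightarrow> nat \<Rightarrow> real" where
  "split_kernel m n k = real m * split_prob m n k * (real (k + 1) / real (n + 1))"

lemma split_kernel_nonneg: "0 \<le> split_kernel m n k"
  by (simp add: split_kernel_def split_prob_nonneg)

lemma sum_split_kernel:
  assumes "m \<ge> 2" "m - 1 \<le> n"
  shows "(\<Sum>k\<le>n. split_kernel m n k) = 1"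
proof -
  have "(\<Sum>k\<le>n. split_kernel m n k) = real m * (\<Sum>k\<le>n. split_prob m n k * real (k + 1)) / real (n + 1)"
    by (simp add: split_kernel_def sum_distrib_left sum_divide_distrib mult.assoc)
  then show ?thesis unfolding sum_split_prob_linear[OF assms] by simp
qed

text \<open>In the bulk the kernel is at least a constant over n, by the bound (N / K)^K for N
  choose K. For m = 2 the base contains a division by 0, but its exponent is 0.\<close>

lemma split_kernel_lower:
  assumes m: "m \<ge> 2" and \<eta>: "0 < \<eta>" "\<eta> \<le> 1" and n: "real n * \<eta> \<ge> 4 * m" and j: "\<eta> / 2 * n \<le> j" "real j \<le>
    (1 - \<eta>) * n"
  shows "split_kernel m n j \<ge> real m * (\<eta> / (4 * real (m - 2))) ^ (m - 2) * (\<eta> / 4) / real n"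
proof -
  have n0: "real n > 0" using n m \<eta> by (cases "n = 0") auto
  have \<eta>n: "\<eta> * n \<ge> 4 * m" using n by (simp add: mult.commute)
  have d: "real n - 1 - j \<ge> \<eta> / 4 * n" using j(2) \<eta>n m by (simp add: algebra_simps)
  then have jn: "j + 1 \<le> n" "real (n - 1 - j) = real n - 1 - real j"
    using \<eta>n m n0 \<eta> by (auto simp: of_nat_diff)
  have "real (m - 2) \<le> real (n - 1 - j)" using d \<eta>n m unfolding jn by simp
  then have d2: "m - 2 \<le> n - 1 - j" by simp
  have "(\<eta> / (4 * real (m - 2))) ^ (m - 2) * real n ^ (m - 2) = (\<eta> / 4 * n / real (m - 2)) ^ (m - 2)"
    by (simp add: power_mult_distrib[symmetric])
  also have "\<dots> \<le> (real (n - 1 - j) / real (m - 2)) ^ (m - 2)"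
    using d \<eta> jn by (intro power_mono divide_right_mono) auto
  also have "\<dots> \<le> real (n - 1 - j choose (m - 2))"
    by (rule binomial_ge_n_over_k_pow_k[OF d2])
  finally have A: "(\<eta> / (4 * real (m - 2))) ^ (m - 2) * real n ^ (m - 2) \<le>
    real (n - 1 - j choose (m - 2))" .
  have mn: "m - 1 \<le> n" using d2 jn m by linarith
  have "real (n choose (m - 1)) \<le> real n ^ (m - 1)"
    using binomial_le_pow[OF mn] by (simp flip: of_nat_power)
  also have "\<dots> = real n ^ (m - 2) * real n"
  proof -
    have "m - 1 = Suc (m - 2)" using m by simp
    then show ?thesis by simp
  qed
  finally have B: "real (n choose (m - 1)) \<le> real n ^ (m - 2) * real n" .
  have "(\<eta> / (4 * real (m - 2))) ^ (m - 2) / real n =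
    (\<eta> / (4 * real (m - 2))) ^ (m - 2) * real n ^ (m - 2) / (real n ^ (m - 2) * real n)"
    using n0 by simp
  also have "\<dots> \<le> real (n - 1 - j choose (m - 2)) / real (n choose (m - 1))"
    using A B choose_pos[OF mn] by (intro frac_le) auto
  also have "\<dots> = split_prob m n j" using d2 jn m by (simp add: split_prob_def)
  finally have C: "(\<eta> / (4 * real (m - 2))) ^ (m - 2) / real n \<le> split_prob m n j" .
  have D: "\<eta> / 4 \<le> real (j + 1) / real (n + 1)"
  proof -
    have "\<eta> / 4 * real (n + 1) \<le> real (j + 1)" using j(1) \<eta> n0 by (simp add: algebra_simps)
    then show ?thesis by (simp add: field_simps)
  qed
  have "real m * ((\<eta> / (4 * real (m - 2))) ^ (m - 2) / real n) * (\<eta> / 4) \<le>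
    real m * split_prob m n j * (real (j + 1) / real (n + 1))"
    using C D \<eta> by (intro mult_mono mult_left_mono) (auto simp: split_prob_nonneg)
  then show ?thesis by (simp add: split_kernel_def mult_ac)
qed

text \<open>Makes any fixed finite range of k negligible as n grows.\<close>

lemma split_kernel_le:
  assumes "m \<ge> 2" "m - 1 \<le> n"
  shows "split_kernel m n k \<le> real m * real m * real (k + 1) / (real n * real (n + 1))"
proof -
  have "split_kernel m n k \<le> real m * (real (m - 1) / real n) * (real (k + 1) / real (n + 1))"
    unfolding split_kernel_def using split_prob_le[OF assms] by (intro mult_right_mono mult_left_mono) auto
  also have "\<dots> \<le> real m * (real m / real n) * (real (k + 1) / real (n + 1))"
    by (intro mult_right_mono mult_left_mono divide_right_mono) auto
  finally show ?thesis by simp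
qed

text \<open>If \<open>x n\<close> is close to the limit superior then so is \<open>x k\<close> for all \<open>k\<close> of the order
  of \<open>n\<close>, because \<open>x n\<close> is essentially an average of these values and \<open>x\<close> does not oscillate quickly.\<close>

lemma renewal_limsup_aux:
  fixes x r :: "nat \<Rightarrow> real" and M \<eta> :: real
  assumes m: "m \<ge> 2" and x1: "\<And>n. \<bar>x n\<bar> \<le> 1"
    and rec: "\<And>n. m - 1 \<le> n \<Longrightarrow> x n = r n + (\<Sum>k\<le>n. split_kernel m n k * x k)"
    and r: "r \<longlonglongrightarrow> 0"
    and reg: "\<And>\<eta> :: real. \<eta> > 0 \<Longrightarrow> \<exists>\<theta>::real. \<theta> > 0 \<and> (\<exists>k0. \<forall>k\<ge>k0. \<exists>I. (\<forall>j\<in>I. (1 - \<eta>) * k \<le> j \<and> real j \<le>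
      (1 + \<eta>) * k \<and> x j \<le> x k + \<eta>) \<and> \<theta> * k \<le> card I \<and> finite I)"
    and up: "\<And>\<epsilon>. \<epsilon> > 0 \<Longrightarrow> eventually (\<lambda>n. x n \<le> M + \<epsilon>) sequentially"
    and low: "\<And>\<epsilon>. \<epsilon> > 0 \<Longrightarrow> frequently (\<lambda>n. x n > M - \<epsilon>) sequentially"
    and M1: "\<bar>M\<bar> \<le> 1"
    and \<eta>: "0 < \<eta>" "\<eta> \<le> 1/4"
  shows "frequently (\<lambda>n. \<forall>k. \<eta> * n \<le> k \<and> real k \<le> (1 - 2 * \<eta>) * n \<longrightarrow> M - \<eta> \<le> x k) sequentially"
proof -
  from reg[of "\<eta> / 2"] \<eta> obtain \<theta> :: real and k0 :: nat where \<theta>: "\<theta> > 0" and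
    I: "\<And>k. k \<ge> k0 \<Longrightarrow> \<exists>I. (\<forall>j\<in>I. (1 - \<eta> / 2) * k \<le> j \<and> real j \<le> (1 + \<eta> / 2) * k \<and> x j \<le>
      x k + \<eta> / 2) \<and> \<theta> * k \<le> card I \<and> finite I"
    by auto
  define \<kappa> where "\<kappa> = real m * (\<eta> / (4 * real (m - 2))) ^ (m - 2) * (\<eta> / 4)"
  have "(\<eta> / (4 * real (m - 2))) ^ (m - 2) > 0" using \<eta> by (cases "m - 2 = 0") auto
  then have \<kappa>: "\<kappa> > 0" unfolding \<kappa>_def using m \<eta> by simp
  \<comment> \<open>Lower bound for the kernel mass of the block around k: at least \<theta> \<eta>
    n indices with mass at least \<kappa> / n each.\<close>
  define \<gamma> where "\<gamma> = \<kappa> * (\<theta> * \<eta>)"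
  have \<gamma>: "\<gamma> > 0" unfolding \<gamma>_def using \<kappa> \<theta> \<eta> by simp
  \<comment> \<open>The block lowers the average by \<gamma> \<eta> / 2 = 4 \<epsilon>. This exceeds
    the sum of all errors: \<epsilon> / 2 each from \<open>r\<close> and from the indices below
    \<open>k1\<close>, \<epsilon> from the other indices, and \<epsilon> from x n > M -
    \<epsilon>.\<close>
  define \<epsilon> where "\<epsilon> = \<gamma> * \<eta> / 8"
  have \<epsilon>: "\<epsilon> > 0" unfolding \<epsilon>_def using \<gamma> \<eta> by simp
  from up[OF \<epsilon>] obtain k1 where k1: "\<And>k. k \<ge> k1 \<Longrightarrow> x k \<le> M + \<epsilon>" by (auto simp: eventually_sequentially)
  have e1: "eventually (\<lambda>n. \<bar>r n\<bar> \<le> \<epsilon> / 2) sequentially"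
    using tendstoD[OF r, of "\<epsilon> / 2"] \<epsilon> by (auto elim!: eventually_mono)
  have e2: "eventually (\<lambda>n. 2 * (real k1 * (real m * real m * real k1 / (real n * real (n + 1)))) \<le>
    \<epsilon> / 2) sequentially"
  proof -
    have "(\<lambda>n. 1 / (real n * real (n + 1))) \<longlonglongrightarrow> 0" by real_asymp
    from tendsto_mult_right_zero[OF this, of "2 * (real k1 * (real m * real m * real k1))"]
    have "(\<lambda>n. 2 * (real k1 * (real m * real m * real k1 / (real n * real (n + 1))))) \<longlonglongrightarrow> 0" by simp
    from order_tendstoD(2)[OF this, of "\<epsilon> / 2"] \<epsilon> show ?thesis by (auto elim!: eventually_mono)
  qed
  have e3: "eventually (\<lambda>n. real n * \<eta> \<ge> 4 * m) sequentially"
  proof -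
    have "filterlim (\<lambda>n. real n * \<eta>) at_top sequentially"
      using \<eta> by (intro filterlim_at_top_mult_tendsto_pos[OF tendsto_const _ filterlim_real_sequentially])
    then show ?thesis by (auto simp: filterlim_at_top)
  qed
  have e4: "eventually (\<lambda>n. \<eta> * real n \<ge> k0) sequentially"
  proof -
    have "filterlim (\<lambda>n. \<eta> * real n) at_top sequentially"
      using \<eta> by (intro filterlim_tendsto_pos_mult_at_top[OF tendsto_const _ filterlim_real_sequentially])
    then show ?thesis by (auto simp: filterlim_at_top)
  qed
  have "frequently (\<lambda>n. x n > M - \<epsilon> \<and> (\<bar>r n\<bar> \<le> \<epsilon> / 2 \<and> 2 * (real k1 * (real m * real m * real k1 / (real n
    * real (n + 1)))) \<le> \<epsilon> / 2 \<and>
      real n * \<eta> \<ge> 4 * m \<and> \<eta> * real n \<ge> k0)) sequentially"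
    by (rule frequently_rev_mp[OF low[OF \<epsilon>]]) (use e1 e2 e3 e4 in eventually_elim, auto)
  then show ?thesis
  proof (rule frequently_elim1)
    fix n
    assume n: "x n > M - \<epsilon> \<and> (\<bar>r n\<bar> \<le> \<epsilon> / 2 \<and> 2 * (real k1 * (real m * real m * real k1 / (real n * real (n
      + 1)))) \<le> \<epsilon> / 2 \<and>
      real n * \<eta> \<ge> 4 * m \<and> \<eta> * real n \<ge> k0)"
    have n0: "real n > 0" using n m by (cases "n = 0") auto
    have "real n * \<eta> \<le> real n * 1" using \<eta> by (intro mult_left_mono) auto
    then have mn: "m - 1 \<le> n" using n m by linarith
    show "\<forall>k. \<eta> * n \<le> k \<and> real k \<le> (1 - 2 * \<eta>) * n \<longrightarrow> M - \<eta> \<le> x k"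
    proof (intro allI impI, rule ccontr)
      fix k assume k: "\<eta> * n \<le> k \<and> real k \<le> (1 - 2 * \<eta>) * n" and neg: "\<not> M - \<eta> \<le> x k"
      have "k0 \<le> k" using k n by (metis of_nat_le_iff order_trans)
      from I[OF this] obtain J where J: "\<And>j. j \<in> J \<Longrightarrow>
        (1 - \<eta> / 2) * k \<le> j \<and> real j \<le> (1 + \<eta> / 2) * k \<and> x j \<le> x k + \<eta> / 2"
        and cJ: "\<theta> * k \<le> card J" and fJ: "finite J" by blast
      have jr: "\<eta> / 2 * n \<le> j \<and> real j \<le> (1 - \<eta>) * n" if "j \<in> J" for j
      proof -
        have "\<eta> / 2 * n \<le> 1 / 2 * (\<eta> * n)" by simp
        also have "\<dots> \<le> (1 - \<eta> / 2) * k" using k \<eta> n0 by (intro mult_mono) auto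
        also have "\<dots> \<le> j" using J[OF that] by simp
        finally have a: "\<eta> / 2 * n \<le> j" .
        have "real j \<le> (1 + \<eta> / 2) * k" using J[OF that] by simp
        also have "\<dots> \<le> (1 + \<eta> / 2) * ((1 - 2 * \<eta>) * n)" using k \<eta> by (intro mult_left_mono) auto
        also have "\<dots> = ((1 + \<eta> / 2) * (1 - 2 * \<eta>)) * n" by simp
        also have "\<dots> \<le> (1 - \<eta>) * n"
          using \<eta> by (intro mult_right_mono) (auto simp: algebra_simps)
        finally show ?thesis using a by simp
      qed
      have Jn: "J \<subseteq> {..n}"
      proof
        fix j assume "j \<in> J"
        then have "real j \<le> (1 - \<eta>) * n" using jr by blast
        also have "\<dots> \<le> 1 * real n" using \<eta> by (intro mult_right_mono) auto
        finally show "j \<in> {..n}" by simp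
      qed
      let ?K = "split_kernel m n"
      have KJ: "\<gamma> \<le> (\<Sum>j\<in>J. ?K j)"
      proof -
        have "\<gamma> = \<kappa> / n * (\<theta> * (\<eta> * n))" unfolding \<gamma>_def using n0 by simp
        also have "\<dots> \<le> \<kappa> / n * (\<theta> * k)" using k \<theta> \<kappa> n0 by (intro mult_left_mono) auto
        also have "\<dots> \<le> \<kappa> / n * card J" using cJ \<kappa> n0 by (intro mult_left_mono) auto
        also have "\<dots> = (\<Sum>j\<in>J. \<kappa> / n)" by simp
        also have "\<dots> \<le> (\<Sum>j\<in>J. ?K j)"
          unfolding \<kappa>_def using jr n \<eta> by (intro sum_mono split_kernel_lower m) auto
        finally show ?thesis .
      qed
      \<comment> \<open>The trivial bound 2 below \<open>k1\<close>, \<epsilon> above, and the gain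
        - \<eta> / 2 on the block, where x j <= x k + \<eta> / 2 < M - \<eta> / 2.\<close>
      have b: "?K j * (x j - M) \<le> (if j < k1 then 2 * ?K j else 0) + \<epsilon> * ?K j + (if j \<in> J then - (\<eta> / 2) *
        ?K j else 0)" if "j \<le> n" for j
      proof -
        have K: "0 \<le> ?K j" by (rule split_kernel_nonneg)
        have "x j - M \<le> (if j < k1 then 2 else 0) + \<epsilon> + (if j \<in> J then - (\<eta> / 2) else 0)"
        proof (cases "j \<in> J")
          case True
          then have "x j - M \<le> - (\<eta> / 2)" using J[OF True] neg by simp
          then show ?thesis using True \<epsilon> by auto
        next
          case False
          then show ?thesis using k1[of j] x1[of j] M1 \<epsilon> by (auto simp: abs_le_iff)
        qed
        from mult_left_mono[OF this K] show ?thesis by (auto simp: algebra_simps)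
      qed
      have "x n - M = r n + (\<Sum>j\<le>n. ?K j * (x j - M))"
        using rec[OF mn] sum_split_kernel[OF m mn]
        by (simp add: right_diff_distrib sum_subtractf sum_distrib_right[symmetric])
      also have "\<dots> \<le> \<epsilon> / 2 + (\<Sum>j\<le>n. (if j < k1 then 2 * ?K j else 0) + \<epsilon> * ?K j + (if j \<in> J then - (\<eta> / 2)
        * ?K j else 0))"
        using n b by (intro add_mono sum_mono) auto
      also have "(\<Sum>j\<le>n. (if j < k1 then 2 * ?K j else 0) + \<epsilon> * ?K j + (if j \<in> J then - (\<eta> / 2) * ?K j else
        0)) =
         (\<Sum>j\<le>n. (if j < k1 then 2 * ?K j else 0)) + \<epsilon> * (\<Sum>j\<le>n. ?K j) + (\<Sum>j\<le>n.
           if j \<in> J then - (\<eta> / 2) * ?K j else 0)"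
        by (simp add: sum.distrib sum_distrib_left)
      also have "(\<Sum>j\<le>n. if j \<in> J then - (\<eta> / 2) * ?K j else 0) = - (\<eta> / 2) * (\<Sum>j\<in>J. ?K j)"
        using Jn by (simp add: sum.inter_restrict[symmetric] Int_absorb1 sum_distrib_left)
      also have "\<dots> \<le> - (\<eta> / 2) * \<gamma>" using KJ \<eta> by (intro mult_left_mono_neg) auto
      also have "(\<Sum>j\<le>n. ?K j) = 1" by (rule sum_split_kernel[OF m mn])
      also have "(\<Sum>j\<le>n. (if j < k1 then 2 * ?K j else 0)) \<le> \<epsilon> / 2"
      proof -
        have "(\<Sum>j\<le>n. (if j < k1 then 2 * ?K j else 0)) = (\<Sum>j\<in>{..n} \<inter> {..<k1}. 2 * ?K j)"
          by (subst sum.inter_restrict) auto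
        also have "\<dots> \<le> (\<Sum>j\<in>{..<k1}. 2 * ?K j)"
          by (intro sum_mono2) (auto simp: split_kernel_nonneg)
        also have "\<dots> \<le> (\<Sum>j\<in>{..<k1}. 2 * (real m * real m * real k1 / (real n * real (n + 1))))"
        proof (intro sum_mono mult_left_mono)
          fix j assume j: "j \<in> {..<k1}"
          have "?K j \<le> real m * real m * real (j + 1) / (real n * real (n + 1))"
            by (rule split_kernel_le[OF m mn])
          also have "\<dots> \<le> real m * real m * real k1 / (real n * real (n + 1))"
            using j by (intro divide_right_mono mult_left_mono) auto
          finally show "?K j \<le> real m * real m * real k1 / (real n * real (n + 1))" .
        qed auto
        also have "\<dots> = 2 * (real k1 * (real m * real m * real k1 / (real n * real (n + 1))))" by simp
        also have "\<dots> \<le> \<epsilon> / 2" using n by blast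
        finally show ?thesis .
      qed
      finally have "x n - M \<le> 2 * \<epsilon> - \<eta> / 2 * \<gamma>" by simp
      moreover have "\<eta> / 2 * \<gamma> = 4 * \<epsilon>" unfolding \<epsilon>_def by simp
      ultimately show False using n \<epsilon> by linarith
    qed
  qed
qed

text \<open>Let M be the limit superior. There are large n with x >= M - \<eta> on
  [\<eta> n, (1 - 2 \<eta>) n]. Stopping at N, the integer part of (1 - 2 \<eta>) n, the exit
  weights put all of their mass \<open>total_exit m\<close> except O(\<eta>^2) on this range, so
  that S >= (M - \<eta>) \<open>total_exit m\<close> - O(\<eta>^2). The regularity hypothesis is
  one-sided in order to fit both a sequence and its negative.\<close>

lemma renewal_limsup:
  fixes x r :: "nat \<Rightarrow> real" and S \<epsilon> :: real
  assumes m: "m \<ge> 2" and x1: "\<And>n. \<bar>x n\<bar> \<le> 1"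
    and rec: "\<And>n. m - 1 \<le> n \<Longrightarrow> x n = r n + (\<Sum>k\<le>n. split_kernel m n k * x k)"
    and r: "r \<longlonglongrightarrow> 0"
    and reg: "\<And>\<eta> :: real. \<eta> > 0 \<Longrightarrow> \<exists>\<theta>::real. \<theta> > 0 \<and> (\<exists>k0. \<forall>k\<ge>k0. \<exists>I. (\<forall>j\<in>I. (1 - \<eta>) * k \<le> j \<and> real j \<le>
      (1 + \<eta>) * k \<and> x j \<le> x k + \<eta>) \<and> \<theta> * k \<le> card I \<and> finite I)"
    and S: "(\<lambda>N. \<Sum>k\<le>N. exit_weight m N k * (real (k + 1) * x k)) \<longlonglongrightarrow> S"
    and \<epsilon>: "\<epsilon> > 0"
  shows "eventually (\<lambda>n. x n \<le> S / total_exit m + \<epsilon>) sequentially"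
proof -
  \<comment> \<open>The eventual upper bounds of x; their infimum M is the limit superior.\<close>
  define B where "B = {y. eventually (\<lambda>n. x n \<le> y) sequentially}"
  define M where "M = Inf B"
  have x1': "- 1 \<le> x n" "x n \<le> 1" for n using x1[of n] by auto
  have B1: "1 \<in> B" unfolding B_def using x1' by simp
  have Bl: "- 1 \<le> y" if "y \<in> B" for y
  proof -
    from that obtain n where "x n \<le> y" unfolding B_def eventually_sequentially by blast
    then show ?thesis using x1'(1)[of n] by linarith
  qed
  then have bdd: "bdd_below B" by (intro bdd_belowI)
  have M1: "\<bar>M\<bar> \<le> 1"
  proof -
    have "M \<le> 1" unfolding M_def by (rule cInf_lower[OF B1 bdd])
    moreover have "- 1 \<le> M" unfolding M_def using B1 Bl by (intro cInf_greatest) auto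
    ultimately show ?thesis by simp
  qed
  have up: "eventually (\<lambda>n. x n \<le> M + e) sequentially" if "e > 0" for e
  proof -
    have "Inf B < M + e" using that by (simp add: M_def)
    then obtain y where "y \<in> B" "y < M + e" using cInf_lessD[of B] B1 by blast
    then show ?thesis unfolding B_def by (auto elim!: eventually_mono)
  qed
  have low: "frequently (\<lambda>n. x n > M - e) sequentially" if "e > 0" for e
  proof (rule ccontr)
    assume "\<not> frequently (\<lambda>n. x n > M - e) sequentially"
    then have "M - e \<in> B" by (simp add: not_frequently not_less B_def)
    from cInf_lower[OF this bdd] that show False by (simp add: M_def)
  qed
  let ?h = "total_exit m"
  \<comment> \<open>At most 2 \<eta> n indices lie below \<eta> n; each loses at most 3 times its
    weight, the exit weight is at most 4 m^2 / n^2, and k + 1 <= 2 \<eta> n. The constants multiply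
    to 2 * 3 * 4 * 2 = 48.\<close>
  let ?C = "48 * real m * real m"
  let ?S = "\<lambda>N. \<Sum>k\<le>N. exit_weight m N k * (real (k + 1) * x k)"
  have key: "(M - \<eta>) * ?h - ?C * \<eta>\<^sup>2 \<le> S" if \<eta>: "0 < \<eta>" "\<eta> \<le> 1 / 4" for \<eta> :: real
  proof (rule ccontr)
    assume "\<not> (M - \<eta>) * ?h - ?C * \<eta>\<^sup>2 \<le> S"
    then have "eventually (\<lambda>N. ?S N < (M - \<eta>) * ?h - ?C * \<eta>\<^sup>2) sequentially"
      by (intro order_tendstoD(2)[OF S]) simp
    then obtain N0 where N0: "\<And>N. N \<ge> N0 \<Longrightarrow> ?S N < (M - \<eta>) * ?h - ?C * \<eta>\<^sup>2"
      by (auto simp: eventually_sequentially)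
    have fr: "frequently (\<lambda>n. \<forall>k. \<eta> * n \<le> k \<and> real k \<le> (1 - 2 * \<eta>) * n \<longrightarrow> M - \<eta> \<le> x k) sequentially"
      by (rule renewal_limsup_aux[OF m x1 rec r reg up low M1 \<eta>])
    have "filterlim (\<lambda>n. real n * \<eta>) at_top sequentially"
      using \<eta> by (intro filterlim_at_top_mult_tendsto_pos[OF tendsto_const _ filterlim_real_sequentially])
    then have e: "eventually (\<lambda>n. real n * \<eta> \<ge> 2 * real N0 + m + 2) sequentially"
      by (auto simp: filterlim_at_top)
    obtain n where n: "\<And>k. \<eta> * n \<le> k \<Longrightarrow> real k \<le> (1 - 2 * \<eta>) * n \<Longrightarrow> M - \<eta> \<le> x k"
        and big: "real n * \<eta> \<ge> 2 * real N0 + m + 2"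
      using frequently_ex[OF frequently_eventually_conj[OF fr e]] by blast
    define N where "N = nat \<lfloor>(1 - 2 * \<eta>) * n\<rfloor>"
    have "(1 - 2 * \<eta>) * n \<ge> 0" using \<eta> by simp
    then have Nle: "real N \<le> (1 - 2 * \<eta>) * n" and Nge: "(1 - 2 * \<eta>) * n < real N + 1"
      unfolding N_def by linarith+
    have h2: "real n / 2 \<le> (1 - 2 * \<eta>) * n"
    proof -
      have "1 / 2 * real n \<le> (1 - 2 * \<eta>) * n" using \<eta> by (intro mult_right_mono) auto
      then show ?thesis by simp
    qed
    have n4: "real n * \<eta> \<le> real n * (1 / 4)" using \<eta> by (intro mult_left_mono) auto
    then have N1: "real n / 2 < real N + 1" "N0 \<le> N" "m - 1 \<le> N" using Nge h2 big by linarith+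
    let ?w = "\<lambda>k. exit_weight m N k * real (k + 1)"
    have w0: "0 \<le> ?w k" for k using exit_weight_nonneg[OF m] by simp
    have "(M - \<eta>) * ?h - (\<Sum>k\<le>N. if real k < \<eta> * n then 3 * ?w k else 0) =
      (\<Sum>k\<le>N. ?w k * (M - \<eta>) - (if real k < \<eta> * n then 3 * ?w k else 0))"
      unfolding sum_exit_weight[OF m N1(3), symmetric]
        by (simp add: sum_subtractf sum_distrib_left mult.commute)
    also have "\<dots> \<le> (\<Sum>k\<le>N. ?w k * x k)"
    proof (rule sum_mono)
      fix k assume k: "k \<in> {..N}"
      show "?w k * (M - \<eta>) - (if real k < \<eta> * n then 3 * ?w k else 0) \<le> ?w k * x k"
      proof (cases "real k < \<eta> * n")
        case True
        have "M - \<eta> - 3 \<le> x k" using M1 \<eta> x1'(1)[of k] by auto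
        from mult_left_mono[OF this w0[of k]] True show ?thesis by (simp add: right_diff_distrib mult_ac)
      next
        case False
        have "real k \<le> real N" using k by simp
        then have "M - \<eta> \<le> x k" using False Nle by (intro n) auto
        from mult_left_mono[OF this w0[of k]] False show ?thesis by simp
      qed
    qed
    also have "\<dots> = ?S N" by (simp add: mult.assoc)
    finally have A: "(M - \<eta>) * ?h - (\<Sum>k\<le>N. if real k < \<eta> * n then 3 * ?w k else 0) \<le> ?S N" .
    have "(\<Sum>k\<le>N. if real k < \<eta> * n then 3 * ?w k else 0) = (\<Sum>k\<in>{k\<in>{..N}. real k < \<eta> * n}. 3 * ?w k)"
      by (rule sum.inter_filter[symmetric]) simp
    also have "\<dots> \<le> (\<Sum>k\<in>{k\<in>{..N}. real k < \<eta> * n}. 3 * (real m * real m / (real n / 2 * (real n / 2)) * (2 *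
      \<eta> * n)))"
    proof (intro sum_mono mult_left_mono)
      fix k assume k: "k \<in> {k \<in> {..N}. real k < \<eta> * n}"
      have "exit_weight m N k \<le> real m * real (m - 1) / (real (N + 1) * real (N + 2))"
        by (rule exit_weight_le[OF m])
      also have "\<dots> \<le> real m * real m / (real n / 2 * (real n / 2))"
        using N1 big m n4 by (intro frac_le mult_mono mult_pos_pos) auto
      finally have "exit_weight m N k \<le> real m * real m / (real n / 2 * (real n / 2))" .
      moreover have "real (k + 1) \<le> 2 * \<eta> * n"
      proof -
        have "real k < \<eta> * n" "1 \<le> \<eta> * n" using k big by (auto simp: mult.commute)
        moreover have "2 * \<eta> * n = 2 * (\<eta> * n)" by simp
        ultimately show ?thesis by linarith
      qed
      ultimately show "?w k \<le> real m * real m / (real n / 2 * (real n / 2)) * (2 * \<eta> * n)"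
        by (intro mult_mono) auto
    qed auto
    also have "\<dots> = real (card {k\<in>{..N}. real k < \<eta> * n}) * (3 * (real m * real m / (real n / 2 * (real n /
      2)) * (2 * \<eta> * n)))" by simp
    also have "\<dots> \<le> (2 * \<eta> * n) * (3 * (real m * real m / (real n / 2 * (real n / 2)) * (2 * \<eta> * n)))"
    proof (intro mult_right_mono)
      have "{k\<in>{..N}. real k < \<eta> * n} \<subseteq> {..nat \<lfloor>\<eta> * n\<rfloor>}" by (auto simp: le_nat_floor less_imp_le)
      then have "card {k\<in>{..N}. real k < \<eta> * n} \<le> Suc (nat \<lfloor>\<eta> * n\<rfloor>)"
        using card_mono[of "{..nat \<lfloor>\<eta> * n\<rfloor>}"] by (metis card_atMost finite_atMost)
      then have "real (card {k\<in>{..N}. real k < \<eta> * n}) \<le> 1 + real (nat \<lfloor>\<eta> * n\<rfloor>)" by linarith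
      also have "real (nat \<lfloor>\<eta> * n\<rfloor>) \<le> \<eta> * n" using \<eta> by (intro of_nat_floor) auto
      also have "1 + \<eta> * n \<le> 2 * \<eta> * n" using big by (simp add: mult.commute)
      finally show "real (card {k\<in>{..N}. real k < \<eta> * n}) \<le> 2 * \<eta> * n" by simp
    qed (use \<eta> in auto)
    also have "\<dots> = ?C * \<eta>\<^sup>2"
    proof -
      have "n \<noteq> 0" using big by (cases n) auto
      then show ?thesis by (simp add: power2_eq_square field_simps)
    qed
    finally have "(M - \<eta>) * ?h - ?C * \<eta>\<^sup>2 \<le> ?S N" using A by simp
    then show False using N0[OF N1(2)] by simp
  qed
  have "M * ?h \<le> S"
  proof (rule tendsto_upperbound)
    have "((\<lambda>\<eta>. (M - \<eta>) * ?h - ?C * \<eta>\<^sup>2) \<longlongrightarrow> (M - 0) * ?h - ?C * 0\<^sup>2) (at_right 0)"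
      by (intro tendsto_intros)
    then show "((\<lambda>\<eta>. (M - \<eta>) * ?h - ?C * \<eta>\<^sup>2) \<longlongrightarrow> M * ?h) (at_right 0)" by simp
    show "eventually (\<lambda>\<eta>. (M - \<eta>) * ?h - ?C * \<eta>\<^sup>2 \<le> S) (at_right 0)"
      unfolding eventually_at_right_field by (intro exI[of _ "1 / 4"]) (auto intro!: key)
  qed simp
  then have "M \<le> S / ?h" using total_exit_pos[OF m] by (simp add: pos_le_divide_eq)
  with up[OF \<epsilon>] show ?thesis by (auto elim!: eventually_mono)
qed

text \<open>The upper bound is applied to x = a / (n + 1) and to - x. Monotonicity of
  \<open>a\<close> supplies the regularity: x cannot drop much between an index and a slightly
  larger one, so the block is taken below k for x and above k for - x.\<close>

lemma mean_limit:
  fixes a \<beta> :: "nat \<Rightarrow> real"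
  assumes m: "m \<ge> 2" and a: "incseq a" "\<And>n. 0 \<le> a n" "\<And>n. a n \<le> n"
    and \<beta>: "\<And>n. \<beta> n = a n - real m * (\<Sum>k\<le>n. split_prob m n k * a k)" "\<And>n. \<bar>\<beta> n\<bar> \<le> B"
  shows "summable (\<lambda>n. fringe_prob n * \<beta> n)"
    and "(\<lambda>n. a n / (n + 1)) \<longlonglongrightarrow> (\<Sum>n. fringe_prob n * \<beta> n) / total_exit m"
proof -
  have B: "0 \<le> B" using \<beta>(2)[of 0] by linarith
  show summ: "summable (\<lambda>n. fringe_prob n * \<beta> n)"
  proof (rule summable_comparison_test)
    have "(\<lambda>n. 2 / (real n + 1)) \<longlonglongrightarrow> 0" by real_asymp
    from telescope_summable'[OF this] have "summable (\<lambda>n. B * (2 / (real n + 1) - 2 / (real (Suc n) + 1)))"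
      by (rule summable_mult)
    then show "summable (\<lambda>n. B * fringe_prob n)"
      by (simp add: fringe_prob_def divide_simps add_ac algebra_simps)
    have "norm (fringe_prob n * \<beta> n) \<le> B * fringe_prob n" for n
      using mult_left_mono[OF \<beta>(2)[of n] less_imp_le[OF fringe_prob_pos[of n]]] fringe_prob_pos[of n]
      by (simp add: abs_mult mult.commute)
    then show "\<exists>N. \<forall>n\<ge>N. norm (fringe_prob n * \<beta> n) \<le> B * fringe_prob n" by blast
  qed
  define S where "S = (\<Sum>n. fringe_prob n * \<beta> n)"
  define x where "x = (\<lambda>n. a n / (n + 1))"
  define r where "r = (\<lambda>n. \<beta> n / (n + 1))"
  have ax: "a n = real (n + 1) * x n" for n by (simp add: x_def)
  have x0: "0 \<le> x n" "x n \<le> 1" for n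
    unfolding x_def using a(2)[of n] a(3)[of n] by (auto simp: field_simps)
  have rec: "x n = r n + (\<Sum>k\<le>n. split_kernel m n k * x k)" for n
  proof -
    have "a n = \<beta> n + real m * (\<Sum>k\<le>n. split_prob m n k * a k)" using \<beta>(1)[of n] by simp
    then have "x n = r n + real m * (\<Sum>k\<le>n. split_prob m n k * a k) / (n + 1)"
      by (simp add: x_def r_def add_divide_distrib)
    also have "real m * (\<Sum>k\<le>n. split_prob m n k * a k) / (n + 1) = (\<Sum>k\<le>n. split_kernel m n k * x k)"
      unfolding ax split_kernel_def by (simp add: sum_distrib_left sum_divide_distrib mult.assoc)
    finally show ?thesis .
  qed
  have r0: "r \<longlonglongrightarrow> 0"
  proof (rule Lim_null_comparison)
    show "eventually (\<lambda>n. norm (r n) \<le> B * (1 / (real n + 1))) sequentially"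
      using \<beta>(2) by (intro always_eventually allI) (simp add: r_def divide_right_mono add.commute)
    have "(\<lambda>n. 1 / (real n + 1)) \<longlonglongrightarrow> 0" by real_asymp
    from tendsto_mult_right_zero[OF this] show "(\<lambda>n. B * (1 / (real n + 1))) \<longlonglongrightarrow> 0" .
  qed
  have SN: "(\<lambda>N. \<Sum>k\<le>N. exit_weight m N k * (real (k + 1) * x k)) \<longlonglongrightarrow> S"
  proof -
    have "(\<Sum>k\<le>N. exit_weight m N k * (real (k + 1) * x k)) = (\<Sum>n\<le>N. fringe_prob n * \<beta> n)" for N
      unfolding ax[symmetric] \<beta>(1) by (rule sum_fringe_exit[symmetric])
    then show ?thesis unfolding S_def using summable_LIMSEQ'[OF summ] by simp
  qed
  have up: "eventually (\<lambda>n. x n \<le> S / total_exit m + \<epsilon>) sequentially" if "\<epsilon> > 0" for \<epsilon>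
  proof (rule renewal_limsup[OF m _ rec r0 _ SN that])
    show "\<bar>x n\<bar> \<le> 1" for n using x0[of n] by simp
    fix \<eta> :: real assume \<eta>: "\<eta> > 0"
    \<comment> \<open>\<theta> <= 1 / 2 gives k <= 2 j on the block, and 2 \<theta> <= \<eta> bounds
      the resulting difference of x j and x k.\<close>
    define \<theta> where "\<theta> = min \<eta> 1 / 2"
    have \<theta>: "0 < \<theta>" "\<theta> \<le> 1 / 2" "2 * \<theta> \<le> \<eta>" using \<eta> by (auto simp: \<theta>_def)
    show "\<exists>\<theta>::real. \<theta> > 0 \<and> (\<exists>k0. \<forall>k\<ge>k0. \<exists>I. (\<forall>j\<in>I. (1 - \<eta>) * k \<le> j \<and> real j \<le> (1 + \<eta>) * k \<and> x j \<le>
      x k + \<eta>) \<and> \<theta> * k \<le> card I \<and> finite I)"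
    proof (rule exI[of _ \<theta>], rule conjI[OF \<theta>(1)], rule exI[of _ 0], intro allI impI)
      fix k :: nat
      let ?I = "{k - nat \<lfloor>\<theta> * k\<rfloor>..k}"
      have "\<theta> * k \<le> 1 * real k" using \<theta> by (intro mult_right_mono) auto
      then have fl: "nat \<lfloor>\<theta> * k\<rfloor> \<le> k" by linarith
      have fl2: "real (nat \<lfloor>\<theta> * k\<rfloor>) \<le> \<theta> * k" using \<theta> by (intro of_nat_floor) auto
      have "(1 - \<eta>) * k \<le> j \<and> real j \<le> (1 + \<eta>) * k \<and> x j \<le> x k + \<eta>" if "j \<in> ?I" for j
      proof -
        have j: "real k - real j \<le> \<theta> * k" "j \<le> k" using that fl fl2 by (auto simp: of_nat_diff)
        have "2 * \<theta> * k \<le> \<eta> * k" using \<theta> by (intro mult_right_mono) auto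
        moreover have "0 \<le> \<theta> * k" "0 \<le> \<eta> * k" using \<theta> \<eta> by auto
        moreover have "x j \<le> x k + 2 * \<theta>"
        proof -
          have "\<theta> * k \<le> 1 / 2 * real k" using \<theta> by (intro mult_right_mono) auto
          then have j2: "k \<le> 2 * real j" using j by simp
          have "x j \<le> a k / (j + 1)" unfolding x_def using incseqD[OF a(1) j(2)]
            by (intro divide_right_mono) auto
          also have "\<dots> = x k + x k * ((real k - j) / (j + 1))" unfolding ax by (simp add: field_simps)
          also have "\<dots> \<le> x k + 1 * ((real k - j) / (j + 1))"
            using x0[of k] j by (intro add_left_mono mult_right_mono) auto
          also have "(real k - j) / (j + 1) \<le> 2 * \<theta>"
          proof -
            have "real k - j \<le> \<theta> * k" by (rule j)
            also have "\<dots> \<le> \<theta> * (2 * j)" using j2 \<theta> by (intro mult_left_mono) auto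
            also have "\<dots> \<le> 2 * \<theta> * (j + 1)" using \<theta> by (simp add: algebra_simps)
            finally show ?thesis by (simp add: pos_divide_le_eq)
          qed
          finally show ?thesis by simp
        qed
        ultimately show ?thesis using j \<theta>(3) by (simp add: algebra_simps)
      qed
      moreover have "\<theta> * k \<le> card ?I" using fl by (simp add: of_nat_diff) linarith
      ultimately show "\<exists>I. (\<forall>j\<in>I. (1 - \<eta>) * k \<le> j \<and> real j \<le> (1 + \<eta>) * k \<and> x j \<le> x k + \<eta>) \<and> \<theta> * k \<le>
        card I \<and> finite I"
        by (intro exI[of _ ?I]) auto
    qed
  qed
  have dn: "eventually (\<lambda>n. - x n \<le> (- S) / total_exit m + \<epsilon>) sequentially" if "\<epsilon> > 0" for \<epsilon>
  proof (rule renewal_limsup[where r = "\<lambda>n. - r n", OF m _ _ _ _ _ that])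
    show "\<bar>- x n\<bar> \<le> 1" for n using x0[of n] by simp
    show "- x n = - r n + (\<Sum>k\<le>n. split_kernel m n k * - x k)" for n
      using rec[of n] by (simp add: sum_negf)
    show "(\<lambda>n. - r n) \<longlonglongrightarrow> 0" using tendsto_minus[OF r0] by simp
    show "(\<lambda>N. \<Sum>k\<le>N. exit_weight m N k * (real (k + 1) * - x k)) \<longlonglongrightarrow> - S"
      using tendsto_minus[OF SN] by (simp add: sum_negf)
    fix \<eta> :: real assume \<eta>: "\<eta> > 0"
    show "\<exists>\<theta>::real. \<theta> > 0 \<and> (\<exists>k0. \<forall>k\<ge>k0. \<exists>I. (\<forall>j\<in>I. (1 - \<eta>) * k \<le> j \<and> real j \<le> (1 + \<eta>) * k \<and> - x j \<le>
      - x k + \<eta>) \<and> \<theta> * k \<le> card I \<and> finite I)"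
    proof (rule exI[of _ \<eta>], rule conjI[OF \<eta>], rule exI[of _ 0], intro allI impI)
      fix k :: nat
      let ?I = "{k..k + nat \<lfloor>\<eta> * k\<rfloor>}"
      have fl2: "real (nat \<lfloor>\<eta> * k\<rfloor>) \<le> \<eta> * k" using \<eta> by (intro of_nat_floor) auto
      have "(1 - \<eta>) * k \<le> j \<and> real j \<le> (1 + \<eta>) * k \<and> - x j \<le> - x k + \<eta>" if "j \<in> ?I" for j
      proof -
        have j: "real j - real k \<le> \<eta> * k" "k \<le> j" using that fl2 by auto
        have "0 \<le> \<eta> * k" using \<eta> by auto
        moreover have "x k - \<eta> \<le> x j"
        proof -
          have "(real j - k) / (j + 1) \<le> \<eta>"
          proof -
            have "real j - k \<le> \<eta> * k" by (rule j)
            also have "\<dots> \<le> \<eta> * (j + 1)" using j \<eta> by (intro mult_left_mono) auto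
            finally show ?thesis by (simp add: pos_divide_le_eq)
          qed
          moreover have "x k * ((real j - k) / (j + 1)) \<le> 1 * ((real j - k) / (j + 1))"
            using x0[of k] j by (intro mult_right_mono) auto
          ultimately have "x k - \<eta> \<le> x k - x k * ((real j - k) / (j + 1))" by simp
          also have "\<dots> = a k / (j + 1)" unfolding ax by (simp add: field_simps)
          also have "\<dots> \<le> x j" unfolding x_def using incseqD[OF a(1) j(2)] by (intro divide_right_mono) auto
          finally show ?thesis .
        qed
        ultimately show ?thesis using j by (simp add: algebra_simps)
      qed
      moreover have "\<eta> * k \<le> card ?I" by simp linarith
      ultimately show "\<exists>I. (\<forall>j\<in>I. (1 - \<eta>) * k \<le> j \<and> real j \<le> (1 + \<eta>) * k \<and> - x j \<le> - x k + \<eta>) \<and> \<eta> * k \<le>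
        card I \<and> finite I"
        by (intro exI[of _ ?I]) auto
    qed
  qed
  have "x \<longlonglongrightarrow> S / total_exit m"
  proof (rule tendstoI)
    fix \<epsilon> :: real assume "\<epsilon> > 0"
    then have "\<epsilon> / 2 > 0" by simp
    from up[OF this] dn[OF this] show "eventually (\<lambda>n. dist (x n) (S / total_exit m) < \<epsilon>) sequentially"
      by eventually_elim (use \<open>\<epsilon> > 0\<close> in \<open>auto simp: dist_real_def abs_less_iff\<close>)
  qed
  then show "(\<lambda>n. a n / (n + 1)) \<longlonglongrightarrow> (\<Sum>n. fringe_prob n * \<beta> n) / total_exit m"
    by (simp add: x_def S_def)
qed

section \<open>The limiting infinite tree\<close>

lemma emeasure_exponential_1: "emeasure (exponential 1) {..x} = ennreal (weight 0 1 x)"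
  unfolding exponential_def
  by (subst emeasure_erlang_density) (auto simp: erlang_CDF_def weight_def)

lemma AE_exponential_nonneg: "AE x in exponential r. 0 \<le> x"
proof -
  have "(\<lambda>x. ennreal (exponential_density r x)) \<in> borel_measurable lborel" by simp
  then show ?thesis unfolding exponential_def
    by (subst AE_density) (auto intro!: AE_I2 simp: exponential_density_def)
qed

lemma measurable_exponential_component:
  assumes "i \<in> I"
  shows "(\<lambda>Y. Y i) \<in> PiM I (\<lambda>j. exponential (a j)) \<rightarrow>\<^sub>M borel"
proof -
  have "(\<lambda>Y. Y i) \<in> PiM I (\<lambda>j. exponential (a j)) \<rightarrow>\<^sub>M exponential (a i)"
    by (rule measurable_component_singleton[OF assms])
  then show ?thesis by (simp only: measurable_cong_sets[OF refl sets_exponential])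
qed

text \<open>Outside \<open>I\<close> the component is the constant \<open>undefined\<close>; with
  this case included, the heir position may be an arbitrary number in measurability
  arguments.\<close>

lemma measurable_PiM_component:
  "(\<lambda>\<l>. \<l> i) \<in> PiM I (\<lambda>_. borel :: real measure) \<rightarrow>\<^sub>M borel"
proof (cases "i \<in> I")
  case False
  have "(\<lambda>\<l>. \<l> i) \<in> PiM I (\<lambda>_. borel :: real measure) \<rightarrow>\<^sub>M borel \<longleftrightarrow>
     (\<lambda>_. undefined) \<in> PiM I (\<lambda>_. borel :: real measure) \<rightarrow>\<^sub>M (borel :: real measure)"
    using False by (intro measurable_cong) (auto simp: space_PiM PiE_def extensional_def)
  then show ?thesis by simp
qed (rule measurable_component_singleton)

lemma measurable_life [measurable]:
  "(\<lambda>(Y, X). \<lambda>i\<in>{1..m}. (\<Sum>j=2..m-1. Y j) + X i)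
   \<in> PiM {2..m-1} (\<lambda>j. exponential (a j)) \<Otimes>\<^sub>M PiM {1..m} (\<lambda>i. exponential (b i)) \<rightarrow>\<^sub>M PiM {1..m} (\<lambda>_. borel
     :: real measure)"
proof -
  show ?thesis unfolding case_prod_beta
    by (intro measurable_restrict borel_measurable_add borel_measurable_sum
        measurable_compose[OF measurable_fst measurable_exponential_component]
        measurable_compose[OF measurable_snd measurable_exponential_component])
qed

lemma sets_life_law [simp, measurable_cong]: "sets (life_law m a b) = sets (PiM {1..m} (\<lambda>_. borel))"
  by (simp add: life_law_def)

lemma prob_space_life_law:
  assumes "\<And>j. j \<in> {2..m-1} \<Longrightarrow> a j > 0" "\<And>i. i \<in> {1..m} \<Longrightarrow> b i > 0"
  shows "prob_space (life_law m a b)"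
proof -
  interpret A: prob_space "PiM {2..m-1} (\<lambda>j. exponential (a j))"
    using assms by (intro prob_space_PiM prob_space_exponential)
  interpret B: prob_space "PiM {1..m} (\<lambda>i. exponential (b i))"
    using assms by (intro prob_space_PiM prob_space_exponential)
  interpret AB: pair_prob_space "PiM {2..m-1} (\<lambda>j. exponential (a j))" "PiM {1..m} (\<lambda>i. exponential (b i))"
    ..
  show ?thesis unfolding life_law_def by (rule AB.prob_space_distr) measurable
qed

lemma nn_integral_life_law:
  assumes "\<And>i. i \<in> {1..m} \<Longrightarrow> b i > 0"
    and g [measurable]: "g \<in> borel_measurable (PiM {1..m} (\<lambda>_. borel))"
  shows "(\<integral>\<^sup>+\<l>. g \<l> \<partial>life_law m a b) =
    (\<integral>\<^sup>+Y. \<integral>\<^sup>+X. g (\<lambda>i\<in>{1..m}. (\<Sum>j=2..m-1. Y j) + X i) \<partial>PiM {1..m} (\<lambda>i. exponential (b i)) \<partial>PiM {2..m-1}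
      (\<lambda>j. exponential (a j)))"
proof -
  interpret B: prob_space "PiM {1..m} (\<lambda>i. exponential (b i))"
    using assms(1) by (intro prob_space_PiM prob_space_exponential)
  have "(\<integral>\<^sup>+\<l>. g \<l> \<partial>life_law m a b) = (\<integral>\<^sup>+p. g ((\<lambda>(Y, X). \<lambda>i\<in>{1..m}. (\<Sum>j=2..m-1. Y j) + X i) p)
      \<partial>(PiM {2..m-1} (\<lambda>j. exponential (a j)) \<Otimes>\<^sub>M PiM {1..m} (\<lambda>i. exponential (b i))))"
    unfolding life_law_def by (rule nn_integral_distr) measurable
  also have "\<dots> = (\<integral>\<^sup>+Y. \<integral>\<^sup>+X. g ((\<lambda>(Y, X). \<lambda>i\<in>{1..m}. (\<Sum>j=2..m-1. Y j) + X i) (Y, X))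
      \<partial>PiM {1..m} (\<lambda>i. exponential (b i)) \<partial>PiM {2..m-1} (\<lambda>j. exponential (a j)))"
    by (rule B.nn_integral_fst[symmetric]) measurable
  finally show ?thesis by simp
qed

text \<open>A product of distribution functions 1 - exp (- x). For x < 0 the weight is 0 whereas an
  empty product would be 1, so \<open>I\<close> must be nonempty.\<close>

lemma emeasure_all_le:
  assumes I: "finite I" "I \<noteq> {}" and b: "\<And>i. i \<in> I \<Longrightarrow> b i = 1" "\<And>i. b i > 0"
  shows "(\<integral>\<^sup>+X. (if \<forall>i\<in>I. X i \<le> x then c else 0) \<partial>PiM I (\<lambda>i. exponential (b i))) =
    c * ennreal (weight 0 (card I) x)"
proof -
  interpret product_sigma_finite "\<lambda>i. exponential (b i)"
    using b(2) by (simp add: product_sigma_finite_def sigma_finite_exponential less_imp_le)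
  let ?M = "PiM I (\<lambda>i. exponential (b i))"
  have S: "PiE I (\<lambda>_. {..x}) \<in> sets ?M" using I(1) by (intro sets_PiM_I_finite) auto
  have "(\<integral>\<^sup>+X. (if \<forall>i\<in>I. X i \<le> x then c else 0) \<partial>?M) = (\<integral>\<^sup>+X. c * indicator (PiE I (\<lambda>_. {..x})) X \<partial>?M)"
    by (intro nn_integral_cong) (auto simp: indicator_def space_PiM PiE_iff)
  also have "\<dots> = c * emeasure ?M (PiE I (\<lambda>_. {..x}))" by (rule nn_integral_cmult_indicator[OF S])
  also have "emeasure ?M (PiE I (\<lambda>_. {..x})) = (\<Prod>i\<in>I. emeasure (exponential (b i)) {..x})"
    by (rule emeasure_PiM) (use I in auto)
  also have "\<dots> = ennreal (weight 0 1 x) ^ card I"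
    using b(1) emeasure_exponential_1[of x] by simp
  also have "\<dots> = ennreal (weight 0 (card I) x)"
    using I by (auto simp: weight_def ennreal_power zero_power card_gt_0_iff)
  finally show ?thesis .
qed

definition ordinary_full :: "nat \<Rightarrow> real \<Rightarrow> ennreal" where
  "ordinary_full m t = (\<integral>\<^sup>+\<l>. (if \<forall>i\<in>{1..m}. \<l> i \<le> t then 1 else 0) \<partial>ordinary_law m)"

lemma sets_ordinary_law [simp, measurable_cong]: "sets (ordinary_law m) = sets (PiM {1..m} (\<lambda>_. borel))"
  by (simp add: ordinary_law_def)

lemma prob_space_ordinary_law: "prob_space (ordinary_law m)"
  unfolding ordinary_law_def by (intro prob_space_life_law) auto

lemma ordinary_full_eq:
  assumes m: "m \<ge> 2"
  shows "ordinary_full m t = (\<integral>\<^sup>+Y. ennreal (weight 0 m (t - (\<Sum>j=2..m-1. Y j))) \<partial>exp_product (m - 1) 0)"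
proof -
  have "ordinary_full m t = (\<integral>\<^sup>+Y. \<integral>\<^sup>+X. (if \<forall>i\<in>{1..m}. (\<lambda>i\<in>{1..m}. (\<Sum>j=2..m-1. Y j) + X i) i \<le>
    t then 1 else 0)
      \<partial>PiM {1..m} (\<lambda>i. exponential 1) \<partial>PiM {2..m-1} (\<lambda>j. exponential (real j)))"
    unfolding ordinary_full_def ordinary_law_def by (rule nn_integral_life_law) auto
  also have "\<dots> = (\<integral>\<^sup>+Y. ennreal (weight 0 m (t - (\<Sum>j=2..m-1. Y j))) \<partial>PiM {2..m-1} (\<lambda>j. exponential (real
    j)))"
  proof (rule nn_integral_cong)
    fix Y :: "nat \<Rightarrow> real"
    let ?S = "\<Sum>j=2..m-1. Y j"
    have "(\<integral>\<^sup>+X. (if \<forall>i\<in>{1..m}. (\<lambda>i\<in>{1..m}. ?S + X i) i \<le>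
      t then 1 else 0) \<partial>PiM {1..m} (\<lambda>i. exponential 1)) =
       (\<integral>\<^sup>+X. (if \<forall>i\<in>{1..m}. X i \<le> t - ?S then 1 else 0) \<partial>PiM {1..m} (\<lambda>i. exponential 1))"
      by (intro nn_integral_cong) (auto simp: algebra_simps)
    also have "\<dots> = 1 * ennreal (weight 0 (card {1..m}) (t - ?S))"
      using m by (intro emeasure_all_le) auto
    finally show "(\<integral>\<^sup>+X. (if \<forall>i\<in>{1..m}. (\<lambda>i\<in>{1..m}. ?S + X i) i \<le>
      t then 1 else 0) \<partial>PiM {1..m} (\<lambda>i. exponential 1)) =
       ennreal (weight 0 m (t - ?S))" by simp
  qed
  finally show ?thesis by simp
qed

lemma borel_measurable_ordinary_full [measurable]: "ordinary_full m \<in> borel_measurable borel"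
proof -
  interpret prob_space "ordinary_law m" by (rule prob_space_ordinary_law)
  have "Measurable.pred (borel \<Otimes>\<^sub>M ordinary_law m) (\<lambda>p. \<forall>i\<in>{1..m}. snd p i \<le> fst p)"
  proof (intro pred_intros_finite)
    fix i
    have [measurable]: "(\<lambda>p. snd p i) \<in> borel_measurable (borel \<Otimes>\<^sub>M ordinary_law m)"
      by (rule measurable_compose[OF measurable_snd])
        (simp only: measurable_cong_sets[OF sets_ordinary_law refl] measurable_PiM_component)
    show "Measurable.pred (borel \<Otimes>\<^sub>M ordinary_law m) (\<lambda>p. snd p i \<le> fst p)" by measurable
  qed simp
  then have mm: "(\<lambda>p. if \<forall>i\<in>{1..m}. snd p i \<le> fst p then 1 else 0 :: ennreal) \<in> borel_measurable (borel \<Otimes>\<^sub>M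
    ordinary_law m)"
    by (intro measurable_If borel_measurable_const predE)
  show ?thesis unfolding ordinary_full_def
    by (rule borel_measurable_nn_integral) (use mm in \<open>simp only: case_prod_unfold\<close>)
qed

text \<open>Fubini postpones the integration over the Y j, and a translation moves their sum into
  the argument of \<open>q'\<close>, the form required by \<open>full_expand\<close>.\<close>

lemma nn_integral_ordinary_full:
  assumes m: "m \<ge> 2" and q [measurable]: "q \<in> borel_measurable borel"
  shows "(\<integral>\<^sup>+t. ordinary_full m t * q t \<partial>exponential 1) =
    (\<Sum>n. ennreal (1 - nonfull_prob m n) * size_weight n q)"
proof -
  define q' where "q' = (\<lambda>t. ennreal (exponential_density 1 t) * q t)"
  have [measurable]: "q' \<in> borel_measurable borel" unfolding q'_def by simp
  let ?E = "exp_product (m - 1) 0"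
  interpret product_sigma_finite "\<lambda>j::nat. exponential (real j + 0)"
    by (rule product_sigma_finite_exponential) simp
  interpret E: sigma_finite_measure ?E by (rule sigma_finite) simp
  interpret P: pair_sigma_finite lborel ?E ..
  have [measurable]: "(\<lambda>Y. \<Sum>j=2..m-1. Y j) \<in> borel_measurable ?E"
    by (intro borel_measurable_sum measurable_exponential_component)
  have "(\<integral>\<^sup>+t. ordinary_full m t * q t \<partial>exponential 1) = (\<integral>\<^sup>+t. ordinary_full m t * q' t \<partial>lborel)"
    unfolding q'_def by (subst nn_integral_exponential) (auto simp: mult_ac)
  also have "\<dots> = (\<integral>\<^sup>+t. \<integral>\<^sup>+Y. ennreal (weight 0 m (t - (\<Sum>j=2..m-1. Y j))) * q' t \<partial>?E \<partial>lborel)"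
    unfolding ordinary_full_eq[OF m] by (intro nn_integral_cong nn_integral_multc[symmetric]) measurable
  also have "\<dots> = (\<integral>\<^sup>+Y. \<integral>\<^sup>+t. ennreal (weight 0 m (t - (\<Sum>j=2..m-1. Y j))) * q' t \<partial>lborel \<partial>?E)"
    by (rule P.Fubini'[symmetric]) measurable
  also have "\<dots> = (\<integral>\<^sup>+Y. \<integral>\<^sup>+s. ennreal (weight 0 m s) * q' (s + (\<Sum>j=2..m-1. Y j)) \<partial>lborel \<partial>?E)"
  proof (rule nn_integral_cong)
    fix Y :: "nat \<Rightarrow> real"
    show "(\<integral>\<^sup>+t. ennreal (weight 0 m (t - (\<Sum>j=2..m-1. Y j))) * q' t \<partial>lborel) =
      (\<integral>\<^sup>+s. ennreal (weight 0 m s) * q' (s + (\<Sum>j=2..m-1. Y j)) \<partial>lborel)"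
      by (subst nn_integral_real_affine[where c = 1 and t = "\<Sum>j=2..m-1. Y j"]) (auto simp: algebra_simps)
  qed
  also have "\<dots> = (\<integral>\<^sup>+s. \<integral>\<^sup>+Y. ennreal (weight 0 m s) * q' (s + (\<Sum>j=2..m-1. Y j)) \<partial>?E \<partial>lborel)"
    by (rule P.Fubini') measurable
  also have "\<dots> = weighted 0 m (\<lambda>s. \<integral>\<^sup>+Y. q' (s + (\<Sum>j=2..m-1. Y j)) \<partial>?E)"
    unfolding weighted_def by (intro nn_integral_cong nn_integral_cmult) measurable
  also have "\<dots> = (\<Sum>n. ennreal (1 - nonfull_prob m n) * size_weight n q)"
    unfolding q'_def by (rule full_expand[OF m q])
  finally show ?thesis .
qed

section \<open>The step from an individual to its parent\<close>

abbreviation history_space :: "nat \<Rightarrow> (nat \<times> (nat \<Rightarrow> real)) measure" where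
  "history_space m \<equiv> count_space UNIV \<Otimes>\<^sub>M PiM {1..m} (\<lambda>_. borel)"

abbreviation heir_age :: "nat \<times> (nat \<Rightarrow> real) \<Rightarrow> real" where
  "heir_age x \<equiv> snd x (fst x)"

lemma measurable_heir_age: "heir_age \<in> history_space m \<rightarrow>\<^sub>M borel"
  by (rule measurable_pair_measure_countable1) (auto intro: measurable_PiM_component)

lemma measurable_heir_step_integrand:
  assumes q: "q \<in> borel_measurable borel"
  shows "(\<lambda>p. if \<forall>i\<in>{1..m}. snd (snd p) i \<le> fst p + heir_age (snd p) then q (fst p + heir_age (snd p)) else
    0 :: ennreal)
    \<in> borel_measurable (borel \<Otimes>\<^sub>M history_space m)"
proof -
  let ?N = "borel \<Otimes>\<^sub>M history_space m"
  have a: "(\<lambda>p. fst p + heir_age (snd p)) \<in> borel_measurable ?N"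
    by (intro borel_measurable_add measurable_fst measurable_compose[OF measurable_snd measurable_heir_age])
  have b: "(\<lambda>p. snd (snd p) i) \<in> borel_measurable ?N" for i
    by (intro measurable_compose[OF measurable_snd] measurable_PiM_component)
  have "Measurable.pred ?N (\<lambda>p. \<forall>i\<in>{1..m}. snd (snd p) i \<le> fst p + heir_age (snd p))"
    by (intro pred_intros_finite finite_atLeastAtMost) (unfold pred_def, rule borel_measurable_le[OF b a])
  then show ?thesis
    by (intro measurable_If borel_measurable_const measurable_compose[OF a q] predE)
qed

lemma measurable_ancestor_kernel:
  "(\<lambda>h. distr (life_law m (\<lambda>j. real (j + 1)) (\<lambda>i. if i = h then 2 else 1)) (history_space m) (Pair h))
    \<in> measure_pmf (pmf_of_set {1..m}) \<rightarrow>\<^sub>M subprob_algebra (history_space m)"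
proof -
  have "distr (life_law m (\<lambda>j. real (j + 1)) (\<lambda>i. if i = h then 2 else 1)) (history_space m) (Pair h)
     \<in> space (subprob_algebra (history_space m))" for h
  proof -
    interpret prob_space "life_law m (\<lambda>j. real (j + 1)) (\<lambda>i. if i = h then 2 else 1)"
      by (rule prob_space_life_law) auto
    have "prob_space (distr (life_law m (\<lambda>j. real (j + 1)) (\<lambda>i.
      if i = h then 2 else 1)) (history_space m) (Pair h))"
      by (rule prob_space_distr) measurable
    then show ?thesis by (auto simp: space_subprob_algebra prob_space_imp_subprob_space)
  qed
  then show ?thesis by simp
qed

lemma sets_ancestor_law [simp, measurable_cong]: "sets (ancestor_law m) = sets (history_space m)"
  unfolding ancestor_law_def by (rule sets_bind, rule sets_distr, simp)

lemma prob_space_ancestor_law: "prob_space (ancestor_law m)"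
proof -
  show ?thesis unfolding ancestor_law_def
  proof (rule prob_space.prob_space_bind[OF prob_space_measure_pmf _ measurable_ancestor_kernel])
    show "AE h in measure_pmf (pmf_of_set {1..m}). prob_space (distr (life_law m (\<lambda>j. real (j + 1)) (\<lambda>i.
      if i = h then 2 else 1)) (history_space m) (Pair h))"
    proof (intro AE_I2)
      fix h
      interpret prob_space "life_law m (\<lambda>j. real (j + 1)) (\<lambda>i. if i = h then 2 else 1)"
        by (rule prob_space_life_law) auto
      show "prob_space (distr (life_law m (\<lambda>j. real (j + 1)) (\<lambda>i.
        if i = h then 2 else 1)) (history_space m) (Pair h))"
        by (rule prob_space_distr) measurable
    qed
  qed
qed

lemma nn_integral_ancestor_law:
  assumes m: "m \<ge> 2" and g [measurable]: "g \<in> borel_measurable (history_space m)"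
  shows "(\<integral>\<^sup>+x. g x \<partial>ancestor_law m) =
     (\<Sum>h=1..m. \<integral>\<^sup>+\<l>. g (h, \<l>) \<partial>life_law m (\<lambda>j. real (j + 1)) (\<lambda>i. if i = h then 2 else 1)) / of_nat m"
proof -
  have "(\<integral>\<^sup>+x. g x \<partial>ancestor_law m) = (\<integral>\<^sup>+h. \<integral>\<^sup>+x. g x \<partial>distr (life_law m (\<lambda>j. real (j + 1)) (\<lambda>i.
    if i = h then 2 else 1)) (history_space m) (Pair h)
      \<partial>measure_pmf (pmf_of_set {1..m}))"
    unfolding ancestor_law_def by (rule nn_integral_bind[OF g measurable_ancestor_kernel])
  also have "\<dots> = (\<integral>\<^sup>+h. \<integral>\<^sup>+\<l>. g (h, \<l>) \<partial>life_law m (\<lambda>j. real (j + 1)) (\<lambda>i. if i = h then 2 else 1)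
      \<partial>measure_pmf (pmf_of_set {1..m}))"
    by (intro nn_integral_cong nn_integral_distr) measurable
  also have "\<dots> = (\<Sum>h=1..m. \<integral>\<^sup>+\<l>. g (h, \<l>) \<partial>life_law m (\<lambda>j. real (j + 1)) (\<lambda>i.
    if i = h then 2 else 1)) / of_nat m"
    using m by (subst nn_integral_pmf_of_set) auto
  finally show ?thesis .
qed

text \<open>Here t is the age of the heir, hence t + heir_age that of the parent, and
  \<open>q\<close> is a function of the parent's age. The condition says that all children of the
  parent are born by now.\<close>

definition heir_step :: "nat \<Rightarrow> (real \<Rightarrow> ennreal) \<Rightarrow> real \<Rightarrow> ennreal" where
  "heir_step m q t = (\<integral>\<^sup>+x. (if \<forall>i\<in>{1..m}. snd x i \<le>
    t + heir_age x then q (t + heir_age x) else 0) \<partial>ancestor_law m)"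

lemma measurable_history_integrand:
  fixes m h :: nat and t S :: real
  assumes q: "q \<in> borel_measurable borel"
  shows "(\<lambda>X. if \<forall>i\<in>{1..m}. X i \<le> t + X h then q (t + X h + S) else 0 :: ennreal)
    \<in> borel_measurable (PiM {1..m} (\<lambda>_. borel))"
proof -
  let ?N = "PiM {1..m} (\<lambda>_. borel) :: (nat \<Rightarrow> real) measure"
  have a: "(\<lambda>X. t + X h) \<in> borel_measurable ?N" "(\<lambda>X. t + X h + S) \<in> borel_measurable ?N"
    by (intro borel_measurable_add borel_measurable_const measurable_PiM_component)+
  have "Measurable.pred ?N (\<lambda>X. \<forall>i\<in>{1..m}. X i \<le> t + X h)"
    by (intro pred_intros_finite finite_atLeastAtMost)
      (unfold pred_def, rule borel_measurable_le[OF measurable_PiM_component a(1)])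
  then show ?thesis
    by (intro measurable_If borel_measurable_const measurable_compose[OF a(2) q] predE)
qed

lemma borel_measurable_heir_step [measurable]:
  assumes [measurable]: "q \<in> borel_measurable borel"
  shows "heir_step m q \<in> borel_measurable borel"
proof -
  interpret prob_space "ancestor_law m" by (rule prob_space_ancestor_law)
  have "(\<lambda>p. if \<forall>i\<in>{1..m}. snd (snd p) i \<le> fst p + heir_age (snd p) then q (fst p + heir_age (snd p)) else
    0)
    \<in> borel_measurable (borel \<Otimes>\<^sub>M ancestor_law m)"
    using measurable_heir_step_integrand[OF assms, of m]
    by (simp cong: measurable_cong_sets sets_pair_measure_cong)
  then show ?thesis unfolding heir_step_def
    by (intro borel_measurable_nn_integral) (simp only: case_prod_unfold)
qed

text \<open>The common sum of the Y j cancels when two siblings are compared, and the heir meets its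
  own condition because t >= 0. The other m - 1 conditions X i <= t + X h produce
  \<open>weight 0 (m - 1)\<close>. The result is the same for every heir position h, so averaging
  over h changes nothing.\<close>

lemma heir_step_eq:
  assumes m: "m \<ge> 2" and q [measurable]: "q \<in> borel_measurable borel" and t: "t \<ge> 0"
  shows "heir_step m q t = (\<integral>\<^sup>+x. ennreal (weight 0 (m - 1) (t + x)) *
      (\<integral>\<^sup>+Y. q (t + x + (\<Sum>j=2..m-1. Y j)) \<partial>exp_product (m - 1) 1) \<partial>exponential 2)"
proof -
  let ?E = "exp_product (m - 1) 1"
  let ?R = "\<integral>\<^sup>+x. ennreal (weight 0 (m - 1) (t + x)) * (\<integral>\<^sup>+Y. q (t + x + (\<Sum>j=2..m-1. Y j)) \<partial>?E)
    \<partial>exponential 2"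
  interpret product_sigma_finite "\<lambda>j::nat. exponential (real j + 1)"
    by (rule product_sigma_finite_exponential) simp
  interpret E: sigma_finite_measure ?E by (rule sigma_finite) simp
  interpret X: sigma_finite_measure "exponential 2" by (rule sigma_finite_exponential) simp
  interpret P: pair_sigma_finite "exponential 2" ?E ..
  have [measurable]: "(\<lambda>Y. \<Sum>j=2..m-1. Y j) \<in> borel_measurable ?E"
    by (intro borel_measurable_sum measurable_exponential_component)
  have "(\<integral>\<^sup>+\<l>. (if \<forall>i\<in>{1..m}. snd (h, \<l>) i \<le> t + heir_age (h, \<l>) then q (t + heir_age (h, \<l>)) else 0)
       \<partial>life_law m (\<lambda>j. real (j + 1)) (\<lambda>i. if i = h then 2 else 1)) = ?R" if h: "h \<in> {1..m}" for h
  proof -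
    let ?b = "\<lambda>i. if i = h then 2 else 1 :: real"
    interpret B: product_sigma_finite "\<lambda>i. exponential (?b i)"
      by (simp add: product_sigma_finite_def sigma_finite_exponential)
    let ?I = "{1..m} - {h}"
    have I: "{1..m} = insert h ?I" "finite ?I" "h \<notin> ?I" "card ?I = m - 1" "?I \<noteq> {}"
    proof -
      show "card ?I = m - 1" using h by simp
      then have "card ?I > 0" using m by linarith
      then show "?I \<noteq> {}" by (metis card.empty less_irrefl)
    qed (use h in auto)
    have "(\<integral>\<^sup>+\<l>. (if \<forall>i\<in>{1..m}. snd (h, \<l>) i \<le> t + heir_age (h, \<l>) then q (t + heir_age (h, \<l>)) else 0)
       \<partial>life_law m (\<lambda>j. real (j + 1)) ?b) =
      (\<integral>\<^sup>+Y. \<integral>\<^sup>+X. (if \<forall>i\<in>{1..m}. (\<lambda>i\<in>{1..m}. (\<Sum>j=2..m-1. Y j) + X i) i \<le>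
        t + (\<lambda>i\<in>{1..m}. (\<Sum>j=2..m-1. Y j) + X i) h
          then q (t + (\<lambda>i\<in>{1..m}. (\<Sum>j=2..m-1. Y j) + X i) h) else 0)
        \<partial>PiM {1..m} (\<lambda>i. exponential (?b i)) \<partial>PiM {2..m-1} (\<lambda>j. exponential (real (j + 1))))"
      unfolding fst_conv snd_conv by (rule nn_integral_life_law[OF _ measurable_history_integrand[OF q, of
        m t h 0, unfolded add_0_right]]) auto
    also have "\<dots> = (\<integral>\<^sup>+Y. \<integral>\<^sup>+x. q (t + x + (\<Sum>j=2..m-1. Y j)) * ennreal (weight 0 (m - 1) (t + x))
      \<partial>exponential 2
        \<partial>PiM {2..m-1} (\<lambda>j. exponential (real (j + 1))))"
    proof (rule nn_integral_cong)
      fix Y :: "nat \<Rightarrow> real"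
      let ?S = "\<Sum>j=2..m-1. Y j"
      have mb: "(\<lambda>X. if \<forall>i\<in>{1..m}. X i \<le> t + X h then q (t + X h + ?S) else 0)
          \<in> borel_measurable (PiM (insert h ?I) (\<lambda>i. exponential (?b i)))"
      proof -
        have "sets (PiM (insert h ?I) (\<lambda>i. exponential (?b i))) = sets (PiM (insert h ?I) (\<lambda>i. borel))"
          by (intro sets_PiM_cong) auto
        moreover have "(\<lambda>X. if \<forall>i\<in>{1..m}. X i \<le> t + X h then q (t + X h + ?S) else 0)
          \<in> borel_measurable (PiM (insert h ?I) (\<lambda>i. borel))"
          unfolding I(1)[symmetric] by (rule measurable_history_integrand[OF q])
        ultimately show ?thesis by (simp cong: measurable_cong_sets)
      qed
      have "(\<integral>\<^sup>+X. (if \<forall>i\<in>{1..m}. (\<lambda>i\<in>{1..m}. ?S + X i) i \<le> t + (\<lambda>i\<in>{1..m}. ?S + X i) h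
          then q (t + (\<lambda>i\<in>{1..m}. ?S + X i) h) else 0) \<partial>PiM {1..m} (\<lambda>i. exponential (?b i))) =
        (\<integral>\<^sup>+X. (if \<forall>i\<in>{1..m}. X i \<le> t + X h then q (t + X h + ?S) else 0) \<partial>PiM (insert h ?I) (\<lambda>i.
          exponential (?b i)))"
        using h unfolding I(1)[symmetric] by (intro nn_integral_cong) (auto simp: algebra_simps)
      also have "\<dots> = (\<integral>\<^sup>+x. \<integral>\<^sup>+X. (if \<forall>i\<in>{1..m}. (X(h := x)) i \<le>
        t + (X(h := x)) h then q (t + (X(h := x)) h + ?S) else 0)
          \<partial>PiM ?I (\<lambda>i. exponential (?b i)) \<partial>exponential 2)"
        using B.product_nn_integral_insert_rev[OF I(2,3) mb] by (simp only: simp_thms if_True)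
      also have "\<dots> = (\<integral>\<^sup>+x. \<integral>\<^sup>+X. (if \<forall>i\<in>?I. X i \<le> t + x then q (t + x + ?S) else 0)
          \<partial>PiM ?I (\<lambda>i. exponential (?b i)) \<partial>exponential 2)"
      proof (rule nn_integral_cong, rule nn_integral_cong)
        fix x :: real and X :: "nat \<Rightarrow> real"
        have "(\<forall>i\<in>{1..m}. (X(h := x)) i \<le> t + (X(h := x)) h) \<longleftrightarrow> (\<forall>i\<in>?I. X i \<le> t + x)"
          using t h by auto
        then show "(if \<forall>i\<in>{1..m}. (X(h := x)) i \<le> t + (X(h := x)) h then q (t + (X(h := x)) h + ?S) else 0)
          =
          (if \<forall>i\<in>?I. X i \<le> t + x then q (t + x + ?S) else 0)" by (simp only: fun_upd_same)
      qed
      also have "\<dots> = (\<integral>\<^sup>+x. q (t + x + ?S) * ennreal (weight 0 (m - 1) (t + x)) \<partial>exponential 2)"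
        by (subst emeasure_all_le) (use I in auto)
      finally show "(\<integral>\<^sup>+X. (if \<forall>i\<in>{1..m}. (\<lambda>i\<in>{1..m}. ?S + X i) i \<le> t + (\<lambda>i\<in>{1..m}. ?S + X i) h
          then q (t + (\<lambda>i\<in>{1..m}. ?S + X i) h) else 0) \<partial>PiM {1..m} (\<lambda>i. exponential (?b i))) =
         (\<integral>\<^sup>+x. q (t + x + ?S) * ennreal (weight 0 (m - 1) (t + x)) \<partial>exponential 2)" .
    qed
    also have "\<dots> = (\<integral>\<^sup>+Y. \<integral>\<^sup>+x. ennreal (weight 0 (m - 1) (t + x)) * q (t + x + (\<Sum>j=2..m-1. Y j))
      \<partial>exponential 2 \<partial>?E)"
      by (simp add: mult.commute add.commute)
    also have "\<dots> = (\<integral>\<^sup>+x. \<integral>\<^sup>+Y. ennreal (weight 0 (m - 1) (t + x)) * q (t + x + (\<Sum>j=2..m-1. Y j)) \<partial>?E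
      \<partial>exponential 2)"
      by (rule P.Fubini') measurable
    also have "\<dots> = ?R"
      by (intro nn_integral_cong nn_integral_cmult) measurable
    finally show ?thesis .
  qed
  note life = this
  have "Pair t \<in> history_space m \<rightarrow>\<^sub>M borel \<Otimes>\<^sub>M history_space m" by (rule measurable_Pair1') simp
  from measurable_compose[OF this measurable_heir_step_integrand[OF q, of m]]
  have int: "(\<lambda>x. if \<forall>i\<in>{1..m}. snd x i \<le> t + heir_age x then q (t + heir_age x) else 0) \<in> borel_measurable
    (history_space m)"
    by (simp only: fst_conv snd_conv)
  have "heir_step m q t = (\<Sum>h=1..m. \<integral>\<^sup>+\<l>. (if \<forall>i\<in>{1..m}. snd (h, \<l>) i \<le>
    t + heir_age (h, \<l>) then q (t + heir_age (h, \<l>)) else 0)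
       \<partial>life_law m (\<lambda>j. real (j + 1)) (\<lambda>i. if i = h then 2 else 1)) / of_nat m"
    unfolding heir_step_def by (rule nn_integral_ancestor_law[OF m int])
  also have "\<dots> = (\<Sum>h=1..m. ?R) / of_nat m"
    by (rule arg_cong[of _ _ "\<lambda>x. x / of_nat m"], rule sum.cong[OF refl], rule life)
  also have "\<dots> = ?R"
  proof -
    have "of_nat m * x / of_nat m = x" for x :: ennreal
      using m by (subst mult.commute, intro ennreal_mult_divide_eq) auto
    then show ?thesis by simp
  qed
  finally show ?thesis .
qed

text \<open>The link between ages and split probabilities. The heir's Exp(2) time turns exponent 3
  into 2 with a factor 2 / k, cancelled by the k in \<open>size_weight\<close>; the presence of the
  siblings multiplies by (1 - exp (- s))^(m - 1). What remains is
  \<open>heir_expand_split\<close>.\<close>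

lemma size_weight_heir_step:
  assumes m: "m \<ge> 2" and k: "k > 0" and q [measurable]: "q \<in> borel_measurable borel"
  shows "size_weight k (heir_step m q) = (\<Sum>n. ennreal (real m * split_prob_full m n k) * size_weight n q)"
proof -
  let ?Q = "\<lambda>s. \<integral>\<^sup>+Y. q (s + (\<Sum>j=2..m-1. Y j)) \<partial>exp_product (m - 1) 1"
  let ?G = "\<lambda>s. ennreal (weight 0 (m - 1) s) * ?Q s"
  have [measurable]: "?Q \<in> borel_measurable borel" by (rule measurable_exp_product_integral[OF q]) simp
  have Gm: "?G \<in> borel_measurable borel" by measurable
  have "weighted 3 (k - 1) (heir_step m q) = weighted (2 + 1) (k - 1) (\<lambda>t. \<integral>\<^sup>+x. ?G (t + x) \<partial>exponential 2)"
    unfolding weighted_def by (intro nn_integral_cong) (auto simp: weight_def heir_step_eq[OF m q])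
  also have "\<dots> = ennreal (2 / (real (k - 1) + 1)) * weighted 2 (Suc (k - 1)) ?G"
    using weighted_exponential[OF _ Gm, of 2 "k - 1"] by (simp add: add.commute)
  also have "weighted 2 (Suc (k - 1)) ?G = weighted 2 (k + (m - 1)) ?Q"
    unfolding weighted_def
  proof (intro nn_integral_cong)
    fix s :: real
    have "weight 2 (Suc (k - 1)) s * weight 0 (m - 1) s = weight 2 (k + (m - 1)) s"
      using k by (auto simp: weight_def power_add)
    then show "ennreal (weight 2 (Suc (k - 1)) s) * (ennreal (weight 0 (m - 1) s) * ?Q s) =
      ennreal (weight 2 (k + (m - 1)) s) * ?Q s"
      by (simp only: mult.assoc[symmetric] ennreal_mult[OF weight_nonneg weight_nonneg, symmetric])
  qed
  finally have "size_weight k (heir_step m q) = ennreal (real k) * (ennreal (2 / (real (k - 1) + 1)) *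
    weighted 2 (k + (m - 1)) ?Q)"
    by (simp add: size_weight_def)
  also have "\<dots> = 2 * weighted 2 (k + (m - 1)) ?Q"
  proof -
    have "real k * (2 / (real (k - 1) + 1)) = 2" using k by simp
    then show ?thesis by (simp only: mult.assoc[symmetric] ennreal_mult'[symmetric] of_nat_0_le_iff
      ennreal_numeral)
  qed
  also have "\<dots> = (\<Sum>n. ennreal (real m * split_prob_full m n k) * size_weight n q)"
    by (rule heir_expand_split[OF m q])
  finally show ?thesis .
qed

section \<open>The first K ancestors\<close>

text \<open>\<open>anc_full m t A k\<close> says that \<open>o\<^sup>(\<^sup>k\<^sup>+\<^sup>1\<^sup>)\<close> has all its \<open>m\<close> children at time \<open>t\<close>.\<close>

definition anc_full :: "nat \<Rightarrow> real \<Rightarrow> anc_lives \<Rightarrow> nat \<Rightarrow> bool" where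
  "anc_full m t A k \<longleftrightarrow> (\<forall>i\<in>{1..m}. snd (A (Suc k)) i \<le> t - ancestor_birth A (Suc k))"

lemma ancestor_birth_cong: "(\<And>i. i \<in> {1..k} \<Longrightarrow> A i = A' i) \<Longrightarrow> ancestor_birth A k = ancestor_birth A' k"
  by (induction k) auto

lemma measurable_ancestor_birth:
  "{1..k} \<subseteq> J \<Longrightarrow> (\<lambda>A. ancestor_birth A k) \<in> borel_measurable (PiM J (\<lambda>_. ancestor_law m))"
proof (induction k)
  case (Suc k)
  have J: "{1..k} \<subseteq> J" using Suc.prems by auto
  have "(\<lambda>A. A (Suc k)) \<in> PiM J (\<lambda>_. ancestor_law m) \<rightarrow>\<^sub>M ancestor_law m"
    using Suc.prems by (intro measurable_component_singleton) auto
  then have "(\<lambda>A. A (Suc k)) \<in> PiM J (\<lambda>_. ancestor_law m) \<rightarrow>\<^sub>M history_space m"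
    by (simp only: measurable_cong_sets[OF refl sets_ancestor_law])
  note h = measurable_compose[OF this measurable_heir_age]
  show ?case unfolding ancestor_birth.simps by (intro borel_measurable_diff Suc.IH J h)
qed simp

lemma measurable_history_component:
  assumes "k \<in> J"
  shows "(\<lambda>A. snd (A k) i) \<in> borel_measurable (PiM J (\<lambda>_. ancestor_law m))"
    and "(\<lambda>A. fst (A k)) \<in> PiM J (\<lambda>_. ancestor_law m) \<rightarrow>\<^sub>M count_space UNIV"
    and "(\<lambda>A. heir_age (A k)) \<in> borel_measurable (PiM J (\<lambda>_. ancestor_law m))"
proof -
  have "(\<lambda>A. A k) \<in> PiM J (\<lambda>_. ancestor_law m) \<rightarrow>\<^sub>M ancestor_law m"
    using assms by (intro measurable_component_singleton) auto
  then have c: "(\<lambda>A. A k) \<in> PiM J (\<lambda>_. ancestor_law m) \<rightarrow>\<^sub>M history_space m"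
    by (simp only: measurable_cong_sets[OF refl sets_ancestor_law])
  show "(\<lambda>A. snd (A k) i) \<in> borel_measurable (PiM J (\<lambda>_. ancestor_law m))"
    by (rule measurable_compose[OF c]) (rule measurable_compose[OF measurable_snd measurable_PiM_component])
  show "(\<lambda>A. fst (A k)) \<in> PiM J (\<lambda>_. ancestor_law m) \<rightarrow>\<^sub>M count_space UNIV"
    by (rule measurable_compose[OF c measurable_fst])
  show "(\<lambda>A. heir_age (A k)) \<in> borel_measurable (PiM J (\<lambda>_. ancestor_law m))"
    by (rule measurable_compose[OF c measurable_heir_age])
qed

lemma pred_anc_full:
  assumes "{1..Suc k} \<subseteq> J"
  shows "Measurable.pred (borel \<Otimes>\<^sub>M PiM J (\<lambda>_. ancestor_law m)) (\<lambda>p. anc_full m (fst p) (snd p) k)"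
  unfolding anc_full_def
proof (intro pred_intros_finite)
  fix i assume "i \<in> {1..m}"
  have k: "Suc k \<in> J" using assms by auto
  have a: "(\<lambda>p. snd (snd p (Suc k)) i) \<in> borel_measurable (borel \<Otimes>\<^sub>M PiM J (\<lambda>_. ancestor_law m))"
    by (rule measurable_compose[OF measurable_snd measurable_history_component(1)[OF k]])
  have b: "(\<lambda>p. fst p - ancestor_birth (snd p) (Suc k)) \<in> borel_measurable (borel \<Otimes>\<^sub>M PiM J (\<lambda>_.
    ancestor_law m))"
    by (intro borel_measurable_diff measurable_fst measurable_compose[OF measurable_snd
      measurable_ancestor_birth[OF assms]])
  show "Measurable.pred (borel \<Otimes>\<^sub>M PiM J (\<lambda>_. ancestor_law m)) (\<lambda>p. snd (snd p (Suc k)) i \<le>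
    fst p - ancestor_birth (snd p) (Suc k))"
    unfolding pred_def by (rule borel_measurable_le[OF a b])
qed simp

lemma measurable_anc_full_integrand:
  assumes J: "{1..K} \<subseteq> J" and q: "q \<in> borel_measurable borel"
  shows "(\<lambda>p. if \<forall>k<K. anc_full m (fst p) (snd p) k then q (fst p - ancestor_birth (snd p) K) else 0 ::
    ennreal)
    \<in> borel_measurable (borel \<Otimes>\<^sub>M PiM J (\<lambda>_. ancestor_law m))"
proof (intro measurable_If borel_measurable_const predE)
  show "(\<lambda>p. q (fst p - ancestor_birth (snd p) K)) \<in> borel_measurable (borel \<Otimes>\<^sub>M PiM J (\<lambda>_. ancestor_law
    m))"
    by (intro measurable_compose[OF _ q] borel_measurable_diff measurable_fst measurable_compose[OF
      measurable_snd measurable_ancestor_birth[OF J]])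
  have "Measurable.pred (borel \<Otimes>\<^sub>M PiM J (\<lambda>_. ancestor_law m)) (\<lambda>p. \<forall>k\<in>{..<K}. anc_full m (fst p) (snd p)
    k)"
  proof (intro pred_intros_finite)
    fix k assume "k \<in> {..<K}"
    then have "{1..Suc k} \<subseteq> J" using J by auto
    then show "Measurable.pred (borel \<Otimes>\<^sub>M PiM J (\<lambda>_. ancestor_law m)) (\<lambda>p. anc_full m (fst p) (snd p) k)"
      by (rule pred_anc_full)
  qed simp
  then show "Measurable.pred (borel \<Otimes>\<^sub>M PiM J (\<lambda>_. ancestor_law m)) (\<lambda>p. \<forall>k<K. anc_full m (fst p) (snd p)
    k)"
    by (simp only: Ball_def lessThan_iff)
qed

lemma borel_measurable_heir_steps:
  "q \<in> borel_measurable borel \<Longrightarrow> (heir_step m ^^ K) q \<in> borel_measurable borel"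
  by (induction K) auto

text \<open>The induction integrates out the most distant ancestor first: its life history enters
  only through its own fullness and its \<open>heir_age\<close>.\<close>

lemma heir_steps_eq:
  assumes "q \<in> borel_measurable borel"
  shows "(\<integral>\<^sup>+A. (if \<forall>k<K. anc_full m t A k then q (t - ancestor_birth A K) else 0) \<partial>PiM {1..K} (\<lambda>_.
    ancestor_law m))
    = (heir_step m ^^ K) q t"
  using assms
proof (induction K arbitrary: q)
  case 0
  then show ?case by (simp add: PiM_empty nn_integral_count_space_finite)
next
  case (Suc K)
  interpret product_prob_space "\<lambda>_::nat. ancestor_law m" UNIV
    by (simp add: product_prob_space_def product_prob_space_axioms_def product_sigma_finite_def
        prob_space_ancestor_law prob_space_imp_sigma_finite)
  have I: "{1..Suc K} = insert (Suc K) {1..K}" by auto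
  let ?f = "\<lambda>A. if \<forall>k<Suc K. anc_full m t A k then q (t - ancestor_birth A (Suc K)) else 0"
  have pt: "Pair t \<in> PiM {1..Suc K} (\<lambda>_. ancestor_law m) \<rightarrow>\<^sub>M borel \<Otimes>\<^sub>M PiM {1..Suc K} (\<lambda>_. ancestor_law m)"
    by (rule measurable_Pair1') simp
  have mf: "?f \<in> borel_measurable (PiM (insert (Suc K) {1..K}) (\<lambda>_. ancestor_law m))"
    using measurable_compose[OF pt measurable_anc_full_integrand[OF order_refl Suc.prems]]
    unfolding I by (simp only: fst_conv snd_conv)
  have "(\<integral>\<^sup>+A. ?f A \<partial>PiM {1..Suc K} (\<lambda>_. ancestor_law m)) =
     (\<integral>\<^sup>+A. \<integral>\<^sup>+x. ?f (A(Suc K := x)) \<partial>ancestor_law m \<partial>PiM {1..K} (\<lambda>_. ancestor_law m))"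
    unfolding I by (rule product_nn_integral_insert[OF _ _ mf]) auto
  also have "\<dots> = (\<integral>\<^sup>+A. (if \<forall>k<K. anc_full m t A k then heir_step m q (t - ancestor_birth A K) else 0) \<partial>PiM
    {1..K} (\<lambda>_. ancestor_law m))"
  proof (rule nn_integral_cong)
    fix A :: anc_lives
    have b: "ancestor_birth (A(Suc K := x)) k = ancestor_birth A k" if "k \<le> K" for x k
      using that by (intro ancestor_birth_cong) auto
    have f: "anc_full m t (A(Suc K := x)) k \<longleftrightarrow> anc_full m t A k" if "k < K" for x k
      using that b[of "Suc k" x] by (auto simp: anc_full_def simp del: ancestor_birth.simps)
    have bs: "ancestor_birth (A(Suc K := x)) (Suc K) = ancestor_birth A K - heir_age x" for x
      using b[of K x] by simp
    have "?f (A(Suc K := x)) = (if \<forall>k<K. anc_full m t A k then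
        (if \<forall>i\<in>{1..m}. snd x i \<le> (t - ancestor_birth A K) + heir_age x then q ((t - ancestor_birth A K) +
          heir_age x) else 0) else 0)" for x
    proof -
      have e1: "(\<forall>k<Suc K. anc_full m t (A(Suc K := x)) k) \<longleftrightarrow> (\<forall>k<K. anc_full m t A k) \<and> anc_full m t (A(Suc
        K := x)) K"
        using f by (auto simp: less_Suc_eq)
      have e2: "anc_full m t (A(Suc K := x)) K \<longleftrightarrow> (\<forall>i\<in>{1..m}. snd x i \<le>
        (t - ancestor_birth A K) + heir_age x)"
        unfolding anc_full_def bs by (simp add: algebra_simps)
      have e3: "t - ancestor_birth (A(Suc K := x)) (Suc K) = (t - ancestor_birth A K) + heir_age x"
        unfolding bs by simp
      have if_conj: "(if P \<and> Q then a else b) = (if P then if Q then a else b else b)"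
        for P Q and a b :: ennreal
        by simp
      show ?thesis unfolding e1 e2 e3 by (rule if_conj)
    qed
    note eq = this
    show "(\<integral>\<^sup>+x. ?f (A(Suc K := x)) \<partial>ancestor_law m) =
       (if \<forall>k<K. anc_full m t A k then heir_step m q (t - ancestor_birth A K) else 0)"
    proof (cases "\<forall>k<K. anc_full m t A k")
      case True
      then show ?thesis unfolding eq heir_step_def by (simp only: if_P)
    next
      case False
      then show ?thesis unfolding eq by (simp only: if_not_P) simp
    qed
  qed
  also have "\<dots> = (heir_step m ^^ K) (heir_step m q) t"
    using Suc.prems by (intro Suc.IH borel_measurable_heir_step)
  also have "\<dots> = (heir_step m ^^ Suc K) q t" by (simp only: funpow_Suc_right o_apply)
  finally show ?case .
qed

lemma nn_integral_ancestors:
  assumes q: "q \<in> borel_measurable borel"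
  shows "(\<integral>\<^sup>+A. (if \<forall>k<K. anc_full m t A k then q (t - ancestor_birth A K) else 0) \<partial>PiM {1..} (\<lambda>_.
    ancestor_law m))
    = (heir_step m ^^ K) q t"
proof -
  interpret product_prob_space "\<lambda>_::nat. ancestor_law m" UNIV
    by (simp add: product_prob_space_def product_prob_space_axioms_def product_sigma_finite_def
        prob_space_ancestor_law prob_space_imp_sigma_finite)
  interpret J: product_prob_space "\<lambda>_::nat. ancestor_law m" "{1..}"
    by (simp add: product_prob_space_def product_prob_space_axioms_def product_sigma_finite_def
        prob_space_ancestor_law prob_space_imp_sigma_finite)
  let ?f = "\<lambda>A. if \<forall>k<K. anc_full m t A k then q (t - ancestor_birth A K) else 0"
  let ?r = "\<lambda>A. restrict A {1..K}"
  have pt: "Pair t \<in> PiM {1..K} (\<lambda>_. ancestor_law m) \<rightarrow>\<^sub>M borel \<Otimes>\<^sub>M PiM {1..K} (\<lambda>_. ancestor_law m)"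
    by (rule measurable_Pair1') simp
  have mf: "?f \<in> borel_measurable (PiM {1..K} (\<lambda>_. ancestor_law m))"
    using measurable_compose[OF pt measurable_anc_full_integrand[OF order_refl q]]
    by (simp only: fst_conv snd_conv)
  have "?f (?r A) = ?f A" for A
  proof -
    have b: "ancestor_birth (?r A) k = ancestor_birth A k" if "k \<le> K" for k
      using that by (intro ancestor_birth_cong) auto
    have "anc_full m t (?r A) k \<longleftrightarrow> anc_full m t A k" if "k < K" for k
      using that b[of "Suc k"] by (auto simp: anc_full_def simp del: ancestor_birth.simps)
    then have "(\<forall>k<K. anc_full m t (?r A) k) \<longleftrightarrow> (\<forall>k<K. anc_full m t A k)" by blast
    then show ?thesis using b[of K] by (simp only: order_refl)
  qed
  then have "(\<integral>\<^sup>+A. ?f A \<partial>PiM {1..} (\<lambda>_. ancestor_law m)) =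
    (\<integral>\<^sup>+A. ?f (?r A) \<partial>PiM {1..} (\<lambda>_. ancestor_law m))"
    by simp
  also have "\<dots> = (\<integral>\<^sup>+A. ?f A \<partial>distr (PiM {1..} (\<lambda>_. ancestor_law m)) (PiM {1..K} (\<lambda>_. ancestor_law m)) ?r)"
    using mf by (intro nn_integral_distr[symmetric] measurable_restrict_subset) auto
  also have "distr (PiM {1..} (\<lambda>_. ancestor_law m)) (PiM {1..K} (\<lambda>_. ancestor_law m)) ?r =
    PiM {1..K} (\<lambda>_. ancestor_law m)"
    by (rule J.distr_PiM_restrict_finite) auto
  finally show ?thesis using heir_steps_eq[OF q] by simp
qed

section \<open>Duality between ages and numbers of keys\<close>

definition restricted_step :: "nat \<Rightarrow> (nat \<Rightarrow> real) \<Rightarrow> nat \<Rightarrow> real" where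
  "restricted_step m \<alpha> n = real m * (\<Sum>k\<le>n. split_prob_full m n k * \<alpha> k)"

definition clade_prob :: "nat \<Rightarrow> nat \<Rightarrow> real" where
  "clade_prob m n = (if n = 0 then 0 else nonfull_prob m n)"

lemma nonfull_prob_bounds: "0 \<le> nonfull_prob m n" "nonfull_prob m n \<le> 1"
proof -
  have "real (n - m choose (m - 1)) \<le> real (n choose (m - 1))"
    by (intro of_nat_mono binomial_right_mono) simp
  then have "real (n - m choose (m - 1)) / real (n choose (m - 1)) \<le> 1"
    by (metis divide_le_eq_1 of_nat_0_le_iff order_le_less divide_eq_0_iff zero_le_one)
  then show "0 \<le> nonfull_prob m n" "nonfull_prob m n \<le> 1" by (simp_all add: nonfull_prob_def)
qed

lemma clade_prob_bounds: "0 \<le> clade_prob m n" "clade_prob m n \<le> 1"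
  using nonfull_prob_bounds by (simp_all add: clade_prob_def)

lemma restricted_step_nonneg: "(\<And>k. 0 \<le> \<alpha> k) \<Longrightarrow> 0 \<le> restricted_step m \<alpha> n"
  by (simp add: restricted_step_def sum_nonneg split_prob_full_nonneg)

lemma restricted_step_0: "\<alpha> 0 = 0 \<Longrightarrow> restricted_step m \<alpha> 0 = 0"
  by (simp add: restricted_step_def)

lemma restricted_steps_nonneg: "(\<And>k. 0 \<le> \<alpha> k) \<Longrightarrow> 0 \<le> (restricted_step m ^^ K) \<alpha> n"
  by (induction K arbitrary: n) (auto intro: restricted_step_nonneg)

lemma restricted_steps_0: "\<alpha> 0 = 0 \<Longrightarrow> (restricted_step m ^^ K) \<alpha> 0 = 0"
  by (induction K) (auto intro: restricted_step_0)

lemma suminf_swap_ennreal: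
  fixes f :: "nat \<Rightarrow> nat \<Rightarrow> ennreal"
  shows "(\<Sum>k. \<Sum>n. f k n) = (\<Sum>n. \<Sum>k. f k n)"
  using nn_integral_suminf[of "\<lambda>k n. f k n" "count_space UNIV"]
  by (simp add: nn_integral_count_space_nat)

text \<open>\<open>heir_step\<close> on functions of the age is dual to
  \<open>restricted_step\<close> on functions of the number of keys; everything is nonnegative, so
  sums may be exchanged. The condition at 0 reflects k > 0 in
  \<open>size_weight_heir_step\<close>.\<close>

lemma sum_size_weight_heir_step:
  assumes m: "m \<ge> 2" and q: "q \<in> borel_measurable borel" and \<alpha>: "\<And>k. 0 \<le> \<alpha> k" "\<alpha> 0 = 0"
  shows "(\<Sum>k. ennreal (\<alpha> k) * size_weight k (heir_step m q)) =
    (\<Sum>n. ennreal (restricted_step m \<alpha> n) * size_weight n q)"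
proof -
  have "ennreal (\<alpha> k) * size_weight k (heir_step m q) =
    (\<Sum>n. ennreal (\<alpha> k * (real m * split_prob_full m n k)) * size_weight n q)" for k
  proof (cases "k = 0")
    case False
    have "(\<Sum>n. ennreal (\<alpha> k * (real m * split_prob_full m n k)) * size_weight n q) =
       (\<Sum>n. ennreal (\<alpha> k) * (ennreal (real m * split_prob_full m n k) * size_weight n q))"
      using \<alpha> by (intro suminf_cong) (simp add: ennreal_mult split_prob_full_nonneg mult.assoc)
    then show ?thesis using False size_weight_heir_step[OF m _ q, of k] by simp
  qed (simp add: \<alpha>)
  then have "(\<Sum>k. ennreal (\<alpha> k) * size_weight k (heir_step m q)) =
     (\<Sum>k. \<Sum>n. ennreal (\<alpha> k * (real m * split_prob_full m n k)) * size_weight n q)" by simp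
  also have "\<dots> = (\<Sum>n. \<Sum>k. ennreal (\<alpha> k * (real m * split_prob_full m n k)) * size_weight n q)"
    by (rule suminf_swap_ennreal)
  also have "\<dots> = (\<Sum>n. ennreal (restricted_step m \<alpha> n) * size_weight n q)"
  proof (rule suminf_cong)
    fix n
    have "(\<Sum>k. ennreal (\<alpha> k * (real m * split_prob_full m n k)) * size_weight n q) =
       (\<Sum>k\<le>n. ennreal (\<alpha> k * (real m * split_prob_full m n k)) * size_weight n q)"
      by (intro suminf_finite) (auto simp: split_prob_full_def)
    also have "\<dots> = (\<Sum>k\<le>n. ennreal (\<alpha> k * (real m * split_prob_full m n k))) * size_weight n q"
      by (simp add: sum_distrib_right)
    also have "(\<Sum>k\<le>n. ennreal (\<alpha> k * (real m * split_prob_full m n k))) = ennreal (restricted_step m \<alpha> n)"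
      using \<alpha> by (subst sum_ennreal) (auto simp: restricted_step_def sum_distrib_left mult_ac
        split_prob_full_nonneg)
    finally show "(\<Sum>k. ennreal (\<alpha> k * (real m * split_prob_full m n k)) * size_weight n q) =
       ennreal (restricted_step m \<alpha> n) * size_weight n q" .
  qed
  finally show ?thesis .
qed

lemma sum_size_weight_heir_steps:
  assumes m: "m \<ge> 2" and q: "q \<in> borel_measurable borel" and \<alpha>: "\<And>k. 0 \<le> \<alpha> k" "\<alpha> 0 = 0"
  shows "(\<Sum>k. ennreal (\<alpha> k) * size_weight k ((heir_step m ^^ K) q)) =
    (\<Sum>n. ennreal ((restricted_step m ^^ K) \<alpha> n) * size_weight n q)"
  using \<alpha>
proof (induction K arbitrary: \<alpha>)
  case (Suc K)
  have "(\<Sum>k. ennreal (\<alpha> k) * size_weight k ((heir_step m ^^ Suc K) q)) =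
    (\<Sum>n. ennreal (restricted_step m \<alpha> n) * size_weight n ((heir_step m ^^ K) q))"
    by (simp only: funpow.simps o_apply)
      (rule sum_size_weight_heir_step[where \<alpha> = \<alpha>, OF m borel_measurable_heir_steps[OF q, where K =
        K and m = m] Suc.prems])
  also have "\<dots> = (\<Sum>n. ennreal ((restricted_step m ^^ K) (restricted_step m \<alpha>) n) * size_weight n q)"
    using Suc.prems by (intro Suc.IH restricted_step_nonneg restricted_step_0)
  finally show ?case by (simp only: funpow_Suc_right o_apply)
qed simp

section \<open>The probability that o is a clade and its first ancestors are not\<close>

definition ordinary_clade :: "nat \<Rightarrow> real \<Rightarrow> ennreal" where
  "ordinary_clade m t = (\<integral>\<^sup>+\<l>. (if \<exists>i\<in>{1..m}. t < \<l> i then 1 else 0) \<partial>ordinary_law m)"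

lemma ordinary_clade_eq: "ordinary_clade m t = 1 - ordinary_full m t"
  and ordinary_full_le_1: "ordinary_full m t \<le> 1"
proof -
  interpret prob_space "ordinary_law m" by (rule prob_space_ordinary_law)
  let ?S = "{\<l> \<in> space (ordinary_law m). \<forall>i\<in>{1..m}. \<l> i \<le> t}"
  have "Measurable.pred (ordinary_law m) (\<lambda>\<l>. \<forall>i\<in>{1..m}. \<l> i \<le> t)"
  proof (intro pred_intros_finite)
    fix i
    have "(\<lambda>\<l>. \<l> i) \<in> borel_measurable (ordinary_law m)"
      by (simp only: measurable_cong_sets[OF sets_ordinary_law refl] measurable_PiM_component)
    then show "Measurable.pred (ordinary_law m) (\<lambda>\<l>. \<l> i \<le> t)"
      unfolding pred_def by (rule borel_measurable_le) simp
  qed simp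
  then have S: "?S \<in> sets (ordinary_law m)" by (rule predE)
  have f: "ordinary_full m t = emeasure (ordinary_law m) ?S"
    unfolding ordinary_full_def nn_integral_indicator[OF S, symmetric]
    by (intro nn_integral_cong) (auto simp: indicator_def)
  have "ordinary_clade m t = emeasure (ordinary_law m) (space (ordinary_law m) - ?S)"
    unfolding ordinary_clade_def nn_integral_indicator[OF sets.compl_sets[OF S], symmetric]
    by (intro nn_integral_cong) (auto simp: indicator_def simp del: not_le simp flip: not_le)
  also have "\<dots> = 1 - ordinary_full m t" unfolding f
    by (subst emeasure_compl[OF S]) (use emeasure_finite[of ?S] in \<open>simp_all only: emeasure_space_1
      infinity_ennreal_def not_False_eq_True\<close>)
  finally show "ordinary_clade m t = 1 - ordinary_full m t" .
  show "ordinary_full m t \<le> 1" unfolding f by (rule emeasure_le_1)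
qed

lemma borel_measurable_ordinary_clade: "ordinary_clade m \<in> borel_measurable borel"
  unfolding ordinary_clade_eq[abs_def] by measurable

text \<open>The complement of \<open>nn_integral_ordinary_full\<close> within
  \<open>total_expand\<close>; q <= 1 makes the sum that is cancelled finite.\<close>

lemma nn_integral_ordinary_clade:
  assumes m: "m \<ge> 2" and q [measurable]: "q \<in> borel_measurable borel" and q1: "\<And>t. q t \<le> 1"
  shows "(\<integral>\<^sup>+t. ordinary_clade m t * q t \<partial>exponential 1) = (\<Sum>n. ennreal (clade_prob m n) * size_weight n q)"
proof -
  interpret prob_space "exponential 1" by (rule prob_space_exponential) simp
  let ?c = "\<Sum>n. ennreal (1 - nonfull_prob m n) * size_weight n q"
  have [measurable]: "ordinary_clade m \<in> borel_measurable borel" by (rule borel_measurable_ordinary_clade)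
  have "(\<integral>\<^sup>+t. q t \<partial>exponential 1) \<le> (\<integral>\<^sup>+t. 1 \<partial>exponential 1)" by (intro nn_integral_mono q1)
  then have le1: "(\<Sum>n. size_weight n q) \<le> 1" using emeasure_space_1 by (simp add: total_expand[OF q])
  have "?c \<le> (\<Sum>n. size_weight n q)"
  proof (intro suminf_le)
    fix n
    have "ennreal (1 - nonfull_prob m n) \<le> 1" using nonfull_prob_bounds by simp
    from mult_right_mono[OF this, of "size_weight n q"]
    show "ennreal (1 - nonfull_prob m n) * size_weight n q \<le> size_weight n q" by simp
  qed auto
  then have fin: "?c < top" using le1 by (metis ennreal_one_less_top order_le_less_trans order_trans)
  have "(\<integral>\<^sup>+t. ordinary_clade m t * q t \<partial>exponential 1) + ?c =
     (\<integral>\<^sup>+t. ordinary_clade m t * q t + ordinary_full m t * q t \<partial>exponential 1)"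
    unfolding nn_integral_ordinary_full[OF m q, symmetric] by (rule nn_integral_add[symmetric]) measurable
  also have "\<dots> = (\<integral>\<^sup>+t. q t \<partial>exponential 1)"
  proof (rule nn_integral_cong)
    fix t
    have "ordinary_clade m t + ordinary_full m t = 1"
      unfolding ordinary_clade_eq using ordinary_full_le_1 by (rule diff_add_cancel_ennreal)
    then show "ordinary_clade m t * q t + ordinary_full m t * q t = q t"
      by (simp only: distrib_right[symmetric] mult_1)
  qed
  also have "\<dots> = (\<Sum>n. size_weight n q)" by (rule total_expand[OF q])
  also have "\<dots> = (\<Sum>n. ennreal (clade_prob m n) * size_weight n q + ennreal (1 - nonfull_prob m n) *
    size_weight n q)"
  proof (rule suminf_cong)
    fix n
    have "ennreal (nonfull_prob m n) + ennreal (1 - nonfull_prob m n) = 1"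
      using nonfull_prob_bounds by (simp flip: ennreal_plus)
    then show "size_weight n q = ennreal (clade_prob m n) * size_weight n q + ennreal (1 - nonfull_prob m
      n) * size_weight n q"
      by (cases "n = 0") (auto simp: clade_prob_def distrib_right[symmetric])
  qed
  also have "\<dots> = (\<Sum>n. ennreal (clade_prob m n) * size_weight n q) + ?c"
    by (rule suminf_add[symmetric]) auto
  finally show ?thesis using fin ennreal_add_left_cancel[of ?c]
    by (simp only: add.commute[of _ ?c] infinity_ennreal_def) auto
qed

abbreviation ancestors_law :: "nat \<Rightarrow> anc_lives measure" where
  "ancestors_law m \<equiv> PiM {1..} (\<lambda>_. ancestor_law m)"

abbreviation ordinaries_law :: "nat \<Rightarrow> ord_lives measure" where
  "ordinaries_law m \<equiv> PiM UNIV (\<lambda>_. ordinary_law m)"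

lemma prob_spaces:
  "prob_space (ancestors_law m)" "prob_space (ordinaries_law m)" "prob_space (exponential 1)"
  by (simp_all add: prob_space_PiM prob_space_ancestor_law prob_space_ordinary_law prob_space_exponential)

lemma prob_space_limit_space: "prob_space (limit_space m)"
proof -
  interpret A: prob_space "ancestors_law m" by (rule prob_spaces)
  interpret L: prob_space "ordinaries_law m" by (rule prob_spaces)
  interpret E: prob_space "exponential 1" by (rule prob_spaces)
  interpret AL: pair_prob_space "ancestors_law m" "ordinaries_law m" ..
  interpret EAL: pair_prob_space "exponential 1" "ancestors_law m \<Otimes>\<^sub>M ordinaries_law m" ..
  show ?thesis unfolding limit_space_def by unfold_locales
qed

lemma measurable_limit_space:
  "fst \<in> borel_measurable (limit_space m)"
  "(\<lambda>x. fst (snd x)) \<in> limit_space m \<rightarrow>\<^sub>M ancestors_law m"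
  "(\<lambda>x. snd (snd x) v i) \<in> borel_measurable (limit_space m)"
proof -
  have "fst \<in> limit_space m \<rightarrow>\<^sub>M exponential 1" unfolding limit_space_def by (rule measurable_fst)
  then show "fst \<in> borel_measurable (limit_space m)"
    by (simp only: measurable_cong_sets[OF refl sets_exponential])
  show "(\<lambda>x. fst (snd x)) \<in> limit_space m \<rightarrow>\<^sub>M ancestors_law m"
    unfolding limit_space_def by (rule measurable_compose[OF measurable_snd measurable_fst])
  have "(\<lambda>x. snd (snd x)) \<in> limit_space m \<rightarrow>\<^sub>M ordinaries_law m"
    unfolding limit_space_def by (rule measurable_compose[OF measurable_snd measurable_snd])
  from measurable_compose[OF this measurable_component_singleton[OF UNIV_I]]
  have c: "(\<lambda>x. snd (snd x) v) \<in> limit_space m \<rightarrow>\<^sub>M ordinary_law m" .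
  have "(\<lambda>\<l>. \<l> i) \<in> borel_measurable (ordinary_law m)"
    by (simp only: measurable_cong_sets[OF sets_ordinary_law refl] measurable_PiM_component)
  from measurable_compose[OF c this] show "(\<lambda>x. snd (snd x) v i) \<in> borel_measurable (limit_space m)" .
qed

definition clade_event :: "nat \<Rightarrow> (real \<times> anc_lives \<times> ord_lives) \<Rightarrow> bool" where
  "clade_event m x \<longleftrightarrow> (\<exists>i\<in>{1..m}. fst x < snd (snd x) (0, []) i)"

definition full_event :: "nat \<Rightarrow> nat \<Rightarrow> (real \<times> anc_lives \<times> ord_lives) \<Rightarrow> bool" where
  "full_event m K x \<longleftrightarrow> (\<forall>k<K. anc_full m (fst x) (fst (snd x)) k)"

lemma pred_events:
  "Measurable.pred (limit_space m) (clade_event m)"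
  "Measurable.pred (limit_space m) (full_event m K)"
proof -
  show "Measurable.pred (limit_space m) (clade_event m)"
    unfolding clade_event_def
  proof (intro pred_intros_finite)
    show "Measurable.pred (limit_space m) (\<lambda>x. fst x < snd (snd x) (0, []) i)" for i
      unfolding pred_def by (rule borel_measurable_less[OF measurable_limit_space(1,3)])
  qed simp
  have pr: "(\<lambda>x. (fst x, fst (snd x))) \<in> limit_space m \<rightarrow>\<^sub>M borel \<Otimes>\<^sub>M ancestors_law m"
    by (intro measurable_Pair measurable_limit_space)
  have "Measurable.pred (limit_space m) (\<lambda>x. \<forall>k\<in>{..<K}. anc_full m (fst x) (fst (snd x)) k)"
  proof (intro pred_intros_finite)
    fix k
    have "Measurable.pred (borel \<Otimes>\<^sub>M ancestors_law m) (\<lambda>p. anc_full m (fst p) (snd p) k)"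
      by (rule pred_anc_full) auto
    from measurable_compose[OF pr this]
    show "Measurable.pred (limit_space m) (\<lambda>x. anc_full m (fst x) (fst (snd x)) k)"
      by (simp only: fst_conv snd_conv)
  qed simp
  then show "Measurable.pred (limit_space m) (full_event m K)"
    by (simp only: full_event_def[abs_def] Ball_def lessThan_iff)
qed

text \<open>Given the age of \<open>o\<close>, its own life history and those of its ancestors are
  independent, so the integral factorises. Duality then transfers the K steps from the constant
  function 1 of the age to \<open>clade_prob\<close>.\<close>

lemma emeasure_events:
  assumes m: "m \<ge> 2"
  shows "emeasure (limit_space m) {x \<in> space (limit_space m). clade_event m x \<and> full_event m K x} =
    (\<Sum>n. ennreal ((restricted_step m ^^ K) (clade_prob m) n * fringe_prob n))"
proof -
  interpret A: prob_space "ancestors_law m" by (rule prob_spaces)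
  interpret L: prob_space "ordinaries_law m" by (rule prob_spaces)
  interpret E: prob_space "exponential 1" by (rule prob_spaces)
  interpret AL: pair_prob_space "ancestors_law m" "ordinaries_law m" ..
  interpret EAL: pair_prob_space "exponential 1" "ancestors_law m \<Otimes>\<^sub>M ordinaries_law m" ..
  let ?S = "{x \<in> space (limit_space m). clade_event m x \<and> full_event m K x}"
  let ?c = "\<lambda>t L. if \<exists>i\<in>{1..m}. t < L (0, []) i then 1 else 0 :: ennreal"
  let ?f = "\<lambda>t A. if \<forall>k<K. anc_full m t A k then 1 else 0 :: ennreal"
  let ?g = "\<lambda>x. ?f (fst x) (fst (snd x)) * ?c (fst x) (snd (snd x))"
  have S: "?S \<in> sets (limit_space m)"
    using pred_events[of m] by (intro predE pred_intros_logic) auto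
  have "(\<lambda>x. if clade_event m x then 1 else 0 :: ennreal) \<in> borel_measurable (limit_space m)"
    "(\<lambda>x. if full_event m K x then 1 else 0 :: ennreal) \<in> borel_measurable (limit_space m)"
    by (intro measurable_If borel_measurable_const predE pred_events)+
  from borel_measurable_times_ennreal[OF this(2,1)]
  have g: "?g \<in> borel_measurable (exponential 1 \<Otimes>\<^sub>M (ancestors_law m \<Otimes>\<^sub>M ordinaries_law m))"
    unfolding clade_event_def full_event_def limit_space_def[symmetric] .
  have q1: "(heir_step m ^^ K) (\<lambda>_. 1) t = (\<integral>\<^sup>+A. ?f t A \<partial>ancestors_law m)" for t
    by (rule nn_integral_ancestors[symmetric]) simp
  have "emeasure (limit_space m) ?S = (\<integral>\<^sup>+x. ?g x \<partial>limit_space m)"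
    unfolding nn_integral_indicator[OF S, symmetric]
    by (intro nn_integral_cong) (auto simp: indicator_def clade_event_def full_event_def)
  also have "\<dots> = (\<integral>\<^sup>+t. \<integral>\<^sup>+y. ?g (t, y) \<partial>(ancestors_law m \<Otimes>\<^sub>M ordinaries_law m) \<partial>exponential 1)"
    unfolding limit_space_def by (rule AL.nn_integral_fst[OF g, symmetric])
  also have "\<dots> = (\<integral>\<^sup>+t. ordinary_clade m t * (heir_step m ^^ K) (\<lambda>_. 1) t \<partial>exponential 1)"
  proof (rule nn_integral_cong)
    fix t :: real assume "t \<in> space (exponential 1)"
    from measurable_compose[OF measurable_Pair1'[OF this] g]
    have gt: "(\<lambda>y. ?g (t, y)) \<in> borel_measurable (ancestors_law m \<Otimes>\<^sub>M ordinaries_law m)" .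
    have pt: "Pair t \<in> ancestors_law m \<rightarrow>\<^sub>M borel \<Otimes>\<^sub>M ancestors_law m" by (rule measurable_Pair1') simp
    have K: "{1..K} \<subseteq> {1..}" by auto
    have ft: "?f t \<in> borel_measurable (ancestors_law m)"
      using measurable_compose[OF pt measurable_anc_full_integrand[OF K, of "\<lambda>_. 1"]]
        by (simp only: fst_conv snd_conv borel_measurable_const)
    have c0: "(\<lambda>\<l>. if \<exists>i\<in>{1..m}. t < \<l> i then 1 else 0 :: ennreal) \<in> borel_measurable (ordinary_law m)"
    proof (intro measurable_If borel_measurable_const predE pred_intros_finite)
      fix i
      have "(\<lambda>\<l>. \<l> i) \<in> borel_measurable (ordinary_law m)"
        by (simp only: measurable_cong_sets[OF sets_ordinary_law refl] measurable_PiM_component)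
      then show "Measurable.pred (ordinary_law m) (\<lambda>\<l>. t < \<l> i)"
        unfolding pred_def by (intro borel_measurable_less borel_measurable_const)
    qed simp
    have comp: "(\<lambda>L. L (0, [])) \<in> ordinaries_law m \<rightarrow>\<^sub>M ordinary_law m"
      by (intro measurable_component_singleton) simp
    have ct: "?c t \<in> borel_measurable (ordinaries_law m)"
      by (rule measurable_compose[OF comp c0])
    have "(\<integral>\<^sup>+L. ?c t L \<partial>ordinaries_law m) = (\<integral>\<^sup>+\<l>. (if \<exists>i\<in>{1..m}. t < \<l> i then 1 else 0) \<partial>distr
      (ordinaries_law m) (ordinary_law m) (\<lambda>L. L (0, [])))"
      by (rule nn_integral_distr[OF comp, symmetric]) (simp only: measurable_distr_eq1 c0)
    also have "distr (ordinaries_law m) (ordinary_law m) (\<lambda>L. L (0, [])) = ordinary_law m"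
      by (rule distr_PiM_component) (auto simp: prob_space_ordinary_law)
    finally have c: "(\<integral>\<^sup>+L. ?c t L \<partial>ordinaries_law m) = ordinary_clade m t"
      by (simp only: ordinary_clade_def)
    have "(\<integral>\<^sup>+y. ?g (t, y) \<partial>(ancestors_law m \<Otimes>\<^sub>M ordinaries_law m)) =
       (\<integral>\<^sup>+A. \<integral>\<^sup>+L. ?g (t, (A, L)) \<partial>ordinaries_law m \<partial>ancestors_law m)"
      by (rule L.nn_integral_fst[OF gt, symmetric])
    also have "\<dots> = (\<integral>\<^sup>+A. ?f t A * ordinary_clade m t \<partial>ancestors_law m)"
      unfolding fst_conv snd_conv c[symmetric] by (intro nn_integral_cong nn_integral_cmult ct)
    also have "\<dots> = (heir_step m ^^ K) (\<lambda>_. 1) t * ordinary_clade m t"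
      unfolding q1 by (rule nn_integral_multc[OF ft])
    finally show "(\<integral>\<^sup>+y. ?g (t, y) \<partial>(ancestors_law m \<Otimes>\<^sub>M ordinaries_law m)) =
      ordinary_clade m t * (heir_step m ^^ K) (\<lambda>_. 1) t"
      by (simp only: mult.commute)
  qed
  also have "\<dots> = (\<Sum>n. ennreal (clade_prob m n) * size_weight n ((heir_step m ^^ K) (\<lambda>_. 1)))"
  proof (intro nn_integral_ordinary_clade m borel_measurable_heir_steps borel_measurable_const)
    fix t
    have "(\<integral>\<^sup>+A. ?f t A \<partial>ancestors_law m) \<le> (\<integral>\<^sup>+A. 1 \<partial>ancestors_law m)" by (intro nn_integral_mono) auto
    then show "(heir_step m ^^ K) (\<lambda>_. 1) t \<le> 1" unfolding q1 using A.emeasure_space_1 by simp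
  qed
  also have "\<dots> = (\<Sum>n. ennreal ((restricted_step m ^^ K) (clade_prob m) n) * size_weight n (\<lambda>_. 1))"
    by (rule sum_size_weight_heir_steps[OF m]) (auto simp: clade_prob_bounds, simp add: clade_prob_def)
  also have "\<dots> = (\<Sum>n. ennreal ((restricted_step m ^^ K) (clade_prob m) n * fringe_prob n))"
  proof (rule suminf_cong)
    fix n
    have z: "(restricted_step m ^^ K) (clade_prob m) 0 = 0"
      by (rule restricted_steps_0) (simp add: clade_prob_def)
    have nn: "0 \<le> (restricted_step m ^^ K) (clade_prob m) n"
      by (rule restricted_steps_nonneg) (rule clade_prob_bounds)
    show "ennreal ((restricted_step m ^^ K) (clade_prob m) n) * size_weight n (\<lambda>_. 1) =
       ennreal ((restricted_step m ^^ K) (clade_prob m) n * fringe_prob n)"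
      using z nn by (cases "n = 0") (simp_all add: size_weight_const ennreal_mult')
  qed
  finally show ?thesis .
qed

section \<open>Ancestors and maximal clades in the infinite tree\<close>

text \<open>Only the heir position leads to an individual with empty path. Its membership in {1..m}
  is recorded because the statement concerns every sample point, also those of probability
  0.\<close>

lemma edge_into_ancestor:
  "(u, (k, [])) \<in> edges m (indiv_child A) V \<longleftrightarrow>
    u = (Suc k, []) \<and> fst (A (Suc k)) \<in> {1..m} \<and> (Suc k, []) \<in> V \<and> (k, []) \<in> V"
proof (cases u)
  case (Pair k' w)
  show ?thesis unfolding Pair edges_def by (auto split: if_splits)
qed

lemma proper_ancestor_o:
  "proper_ancestor m (indiv_child A) V u (0, []) \<longleftrightarrow>
    (\<exists>k. u = (Suc k, []) \<and> (\<forall>j\<le>k. fst (A (Suc j)) \<in> {1..m}) \<and> (\<forall>j\<le>Suc k. (j, []) \<in> V))"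
proof
  let ?E = "edges m (indiv_child A) V"
  assume "proper_ancestor m (indiv_child A) V u (0, [])"
  then have "(u, (0, [])) \<in> ?E\<^sup>+" by (simp add: proper_ancestor_def)
  then show "\<exists>k. u = (Suc k, []) \<and> (\<forall>j\<le>k. fst (A (Suc j)) \<in> {1..m}) \<and> (\<forall>j\<le>Suc k. (j, []) \<in> V)"
  proof (induction rule: converse_trancl_induct)
    case (base y)
    then show ?case unfolding edge_into_ancestor by (auto simp: le_Suc_eq)
  next
    case (step y z)
    then obtain k where k: "z = (Suc k, [])" "\<forall>j\<le>k. fst (A (Suc j)) \<in> {1..m}" "\<forall>j\<le>Suc k. (j, []) \<in> V"
      by blast
    from step(1)[unfolded k(1) edge_into_ancestor] k(2,3) show ?case
      by (intro exI[of _ "Suc k"]) (auto simp: le_Suc_eq)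
  qed
next
  let ?E = "edges m (indiv_child A) V"
  assume "\<exists>k. u = (Suc k, []) \<and> (\<forall>j\<le>k. fst (A (Suc j)) \<in> {1..m}) \<and> (\<forall>j\<le>Suc k. (j, []) \<in> V)"
  then obtain k where k: "u = (Suc k, [])" "\<forall>j\<le>k. fst (A (Suc j)) \<in> {1..m}" "\<forall>j\<le>Suc k. (j, []) \<in> V" by blast
  have "((Suc k, []), (0, [])) \<in> ?E\<^sup>+" using k(2,3)
  proof (induction k)
    case 0
    then have "((Suc 0, []), (0, [])) \<in> ?E" unfolding edge_into_ancestor by auto
    then show ?case by blast
  next
    case (Suc k)
    then have "((Suc (Suc k), []), (Suc k, [])) \<in> ?E" unfolding edge_into_ancestor by auto
    moreover have "((Suc k, []), (0, [])) \<in> ?E\<^sup>+" using Suc by auto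
    ultimately show ?case by (rule trancl_into_trancl2)
  qed
  then show "proper_ancestor m (indiv_child A) V u (0, [])" by (simp add: proper_ancestor_def k(1))
qed

lemma ancestor_in_family_tree:
  "(k, []) \<in> family_tree m A L t \<longleftrightarrow> ancestor_birth A k \<le> t"
  by (simp add: family_tree_def individuals_def)

lemma clade_o: "clade m (indiv_child A) (family_tree m A L t) (0, []) \<longleftrightarrow> 0 \<le>
  t \<and> (\<exists>i\<in>{1..m}. t < L (0, []) i)"
proof -
  have "(0, [i]) \<in> family_tree m A L t \<longleftrightarrow> L (0, []) i \<le> t" if "i \<in> {1..m}" for i
    using that by (simp add: family_tree_def individuals_def)
  then show ?thesis unfolding clade_iff ancestor_in_family_tree by (auto simp: not_le)
qed

text \<open>The heir is present by assumption, so only a missing child in another position can make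
  the ancestor a clade.\<close>

lemma clade_ancestor:
  assumes "ancestor_birth A k \<le> t"
  shows "clade m (indiv_child A) (family_tree m A L t) (Suc k, []) \<longleftrightarrow> ancestor_birth A (Suc k) \<le> t \<and>
    (\<exists>i\<in>{1..m}. i \<noteq> fst (A (Suc k)) \<and> t < ancestor_birth A (Suc k) + snd (A (Suc k)) i)"
proof -
  have "indiv_child A (Suc k, []) i \<in> family_tree m A L t \<longleftrightarrow>
      i = fst (A (Suc k)) \<or> ancestor_birth A (Suc k) + snd (A (Suc k)) i \<le> t" if "i \<in> {1..m}" for i
    using that assms ancestor_in_family_tree[of k m A L t] by (auto simp: family_tree_def individuals_def)
  then show ?thesis unfolding clade_iff ancestor_in_family_tree by (auto simp: not_le)
qed

text \<open>Stated for all sample points, degenerate heir positions and ages included, since the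
  measurability of the event is read off from it.\<close>

lemma maximal_clade_o:
  "maximal_clade m (indiv_child A) (family_tree m A L t) (0, []) \<longleftrightarrow> 0 \<le> t \<and> (\<exists>i\<in>{1..m}. t < L (0, []) i) \<and>
    (\<forall>k. (\<forall>j\<le>k. fst (A (Suc j)) \<in> {1..m}) \<and> (\<forall>j\<le>Suc k. ancestor_birth A j \<le> t) \<longrightarrow>
      (\<forall>i\<in>{1..m}. i \<noteq> fst (A (Suc k)) \<longrightarrow> ancestor_birth A (Suc k) + snd (A (Suc k)) i \<le> t))"
proof -
  have "(\<forall>u. proper_ancestor m (indiv_child A) (family_tree m A L t) u (0, []) \<longrightarrow> \<not> clade m (indiv_child A)
    (family_tree m A L t) u) \<longleftrightarrow>
     (\<forall>k. (\<forall>j\<le>k. fst (A (Suc j)) \<in> {1..m}) \<and> (\<forall>j\<le>Suc k. ancestor_birth A j \<le> t) \<longrightarrow>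
       \<not> clade m (indiv_child A) (family_tree m A L t) (Suc k, []))"
    unfolding proper_ancestor_o ancestor_in_family_tree by blast
  also have "\<dots> \<longleftrightarrow> (\<forall>k. (\<forall>j\<le>k. fst (A (Suc j)) \<in> {1..m}) \<and> (\<forall>j\<le>Suc k. ancestor_birth A j \<le> t) \<longrightarrow>
      (\<forall>i\<in>{1..m}. i \<noteq> fst (A (Suc k)) \<longrightarrow> ancestor_birth A (Suc k) + snd (A (Suc k)) i \<le> t))"
  proof (intro iff_allI imp_cong refl)
    fix k assume "(\<forall>j\<le>k. fst (A (Suc j)) \<in> {1..m}) \<and> (\<forall>j\<le>Suc k. ancestor_birth A j \<le> t)"
    then have "ancestor_birth A k \<le> t" "ancestor_birth A (Suc k) \<le> t" by (blast intro: le_SucI)+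
    then show "(\<not> clade m (indiv_child A) (family_tree m A L t) (Suc k, [])) \<longleftrightarrow>
      (\<forall>i\<in>{1..m}. i \<noteq> fst (A (Suc k)) \<longrightarrow> ancestor_birth A (Suc k) + snd (A (Suc k)) i \<le> t)"
      unfolding clade_ancestor[OF \<open>ancestor_birth A k \<le> t\<close>]
        by (auto simp: not_less simp del: ancestor_birth.simps)
  qed
  finally show ?thesis unfolding maximal_clade_def clade_o by blast
qed

section \<open>Null sets, measurability and the passage to infinitely many ancestors\<close>

lemma AE_life_law_nonneg:
  assumes b: "\<And>i. i \<in> {1..m} \<Longrightarrow> b i > 0" and a: "\<And>j. j \<in> {2..m-1} \<Longrightarrow> a j > 0" and h: "h \<in> {1..m}"
  shows "AE \<l> in life_law m a b. 0 \<le> \<l> h"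
proof -
  let ?A = "PiM {2..m-1} (\<lambda>j. exponential (a j))" and ?B = "PiM {1..m} (\<lambda>i. exponential (b i))"
  let ?T = "\<lambda>(Y, X). \<lambda>i\<in>{1..m}. (\<Sum>j=2..m-1. Y j) + X i"
  interpret A: prob_space ?A using a by (intro prob_space_PiM prob_space_exponential)
  interpret B: prob_space ?B using b by (intro prob_space_PiM prob_space_exponential)
  interpret AB: pair_prob_space ?A ?B ..
  have hm: "(\<lambda>\<l>. \<l> h) \<in> borel_measurable (PiM {1..m} (\<lambda>_. borel :: real measure))"
    by (rule measurable_PiM_component)
  have T: "?T \<in> ?A \<Otimes>\<^sub>M ?B \<rightarrow>\<^sub>M PiM {1..m} (\<lambda>_. borel)" by (rule measurable_life)
  have Y: "AE Y in ?A. 0 \<le> Y j" if "j \<in> {2..m-1}" for j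
    using a that by (intro AE_PiM_component AE_exponential_nonneg prob_space_exponential) auto
  have Y: "AE Y in ?A. \<forall>j\<in>{2..m-1}. 0 \<le> Y j"
    by (intro eventually_ball_finite ballI Y) simp
  have X: "AE X in ?B. 0 \<le> X h"
    using b h by (intro AE_PiM_component AE_exponential_nonneg prob_space_exponential) auto
  have "AE p in ?A \<Otimes>\<^sub>M ?B. 0 \<le> ?T p h"
  proof (rule AB.AE_pair_measure)
    have "(\<lambda>p. ?T p h) \<in> borel_measurable (?A \<Otimes>\<^sub>M ?B)" by (rule measurable_compose[OF T hm])
    then show "{p \<in> space (?A \<Otimes>\<^sub>M ?B). 0 \<le> ?T p h} \<in> sets (?A \<Otimes>\<^sub>M ?B)"
      by (intro borel_measurable_le borel_measurable_const)
    show "AE Y in ?A. AE X in ?B. 0 \<le> ?T (Y, X) h"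
      using Y
    proof eventually_elim
      case (elim Y)
      from X show ?case
        by eventually_elim (use elim h in \<open>auto intro!: add_nonneg_nonneg sum_nonneg\<close>)
    qed
  qed
  then show ?thesis unfolding life_law_def
    by (subst AE_distr_iff[OF T borel_measurable_le[OF borel_measurable_const hm]])
qed

lemma AE_ancestor_good:
  assumes m: "m \<ge> 2"
  shows "AE x in ancestor_law m. fst x \<in> {1..m} \<and> 0 \<le> heir_age x"
  unfolding ancestor_law_def
proof (subst AE_bind[OF measurable_ancestor_kernel])
  have P1: "Measurable.pred (history_space m) (\<lambda>x. fst x \<in> {1..m})"
    by (rule measurable_compose[OF measurable_fst]) simp
  have P2: "Measurable.pred (history_space m) (\<lambda>x. 0 \<le> heir_age x)"
    unfolding pred_def by (rule borel_measurable_le[OF borel_measurable_const measurable_heir_age])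
  show P: "Measurable.pred (history_space m) (\<lambda>x. fst x \<in> {1..m} \<and> 0 \<le> heir_age x)"
    by (rule pred_intros_logic(3)[OF P1 P2])
  show "AE h in measure_pmf (pmf_of_set {1..m}).
       AE x in distr (life_law m (\<lambda>j. real (j + 1)) (\<lambda>i.
         if i = h then 2 else 1)) (history_space m) (Pair h).
         fst x \<in> {1..m} \<and> 0 \<le> heir_age x"
  proof (rule AE_pmfI)
    fix h assume "h \<in> set_pmf (pmf_of_set {1..m})"
    then have h: "h \<in> {1..m}" using m by simp
    let ?M = "life_law m (\<lambda>j. real (j + 1)) (\<lambda>i. if i = h then 2 else 1)"
    have T: "Pair h \<in> ?M \<rightarrow>\<^sub>M history_space m" by measurable
    have "AE \<l> in ?M. 0 \<le> \<l> h" using h by (intro AE_life_law_nonneg) auto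
    then show "AE x in distr ?M (history_space m) (Pair h). fst x \<in> {1..m} \<and> 0 \<le> heir_age x"
      using h by (subst AE_distr_iff[OF T predE[OF P]]) auto
  qed
qed

lemma AE_limit_space_good:
  assumes m: "m \<ge> 2"
  shows "AE x in limit_space m. 0 \<le> fst x \<and> (\<forall>k. fst (fst (snd x) (Suc k)) \<in> {1..m} \<and> 0 \<le>
    heir_age (fst (snd x) (Suc k)))"
proof -
  interpret A: prob_space "ancestors_law m" by (rule prob_spaces)
  interpret L: prob_space "ordinaries_law m" by (rule prob_spaces)
  interpret E: prob_space "exponential 1" by (rule prob_spaces)
  interpret AL: pair_prob_space "ancestors_law m" "ordinaries_law m" ..
  interpret EAL: pair_prob_space "exponential 1" "ancestors_law m \<Otimes>\<^sub>M ordinaries_law m" ..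
  let ?good = "\<lambda>x. fst x \<in> {1..m} \<and> 0 \<le> heir_age x"
  have "AE t in exponential 1. 0 \<le> t" by (rule AE_exponential_nonneg)
  then have "AE t in distr (exponential 1 \<Otimes>\<^sub>M (ancestors_law m \<Otimes>\<^sub>M ordinaries_law m)) (exponential 1) fst.
    0 \<le> t"
    by (simp only: AL.distr_pair_fst)
  then have t: "AE x in limit_space m. 0 \<le> fst x"
    unfolding limit_space_def by (rule AE_distrD[OF measurable_fst])
  have "AE A in ancestors_law m. ?good (A (Suc k))" for k
    using AE_PiM_component[of "{1..}" "\<lambda>_. ancestor_law m" "Suc k" ?good, OF prob_space_ancestor_law _
      AE_ancestor_good[OF m]]
    by simp
  then have A: "AE A in ancestors_law m. \<forall>k. ?good (A (Suc k))" by (simp only: AE_all_countable) blast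
  then have "AE A in distr (ancestors_law m \<Otimes>\<^sub>M ordinaries_law m) (ancestors_law m) fst. \<forall>k. ?good (A (Suc
    k))"
    by (simp only: L.distr_pair_fst)
  then have AL: "AE y in ancestors_law m \<Otimes>\<^sub>M ordinaries_law m. \<forall>k. ?good (fst y (Suc k))"
    by (rule AE_distrD[OF measurable_fst])
  have "AE x in exponential 1 \<Otimes>\<^sub>M (ancestors_law m \<Otimes>\<^sub>M ordinaries_law m). \<forall>k. ?good (fst (snd x) (Suc k))"
  proof (rule EAL.AE_pair_measure)
    have f: "(\<lambda>x. fst (snd x)) \<in> limit_space m \<rightarrow>\<^sub>M ancestors_law m" by (rule measurable_limit_space)
    have "{x \<in> space (limit_space m). ?good (fst (snd x) (Suc k))} \<in> sets (limit_space m)" for k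
    proof -
      have k: "Suc k \<in> {1..}" by simp
      note h = measurable_compose[OF f measurable_history_component(2)[OF k]]
        measurable_compose[OF f measurable_history_component(3)[OF k]]
      have "Measurable.pred (limit_space m) (\<lambda>x. fst (fst (snd x) (Suc k)) \<in> {1..m})"
        by (rule measurable_compose[OF h(1)]) simp
      moreover have "Measurable.pred (limit_space m) (\<lambda>x. 0 \<le> heir_age (fst (snd x) (Suc k)))"
        unfolding pred_def by (rule borel_measurable_le[OF borel_measurable_const h(2)])
      ultimately show ?thesis by (intro predE pred_intros_logic)
    qed
    then have "{x \<in> space (limit_space m). \<forall>k. ?good (fst (snd x) (Suc k))} \<in> sets (limit_space m)"
      by (rule sets.sets_Collect_countable_All)
    then show "{x \<in> space (exponential 1 \<Otimes>\<^sub>M (ancestors_law m \<Otimes>\<^sub>M ordinaries_law m)). \<forall>k. ?good (fst (snd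
      x) (Suc k))} \<in>
       sets (exponential 1 \<Otimes>\<^sub>M (ancestors_law m \<Otimes>\<^sub>M ordinaries_law m))"
      unfolding limit_space_def .
    show "AE t in exponential 1. AE y in ancestors_law m \<Otimes>\<^sub>M ordinaries_law m. \<forall>k. ?good (fst (snd (t, y))
      (Suc k))"
      by (rule AE_I2) (use AL in \<open>simp only: snd_conv\<close>)
  qed
  then have "AE x in limit_space m. \<forall>k. ?good (fst (snd x) (Suc k))" unfolding limit_space_def .
  with t show ?thesis by eventually_elim blast
qed

text \<open>Nonnegative ages make every ancestor present at time t, and then the condition of
  \<open>anc_full\<close> on the heir itself is automatic.\<close>

lemma maximal_clade_o_good:
  assumes t: "0 \<le> t" and good: "\<And>k. fst (A (Suc k)) \<in> {1..m} \<and> 0 \<le> heir_age (A (Suc k))"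
  shows "maximal_clade m (indiv_child A) (family_tree m A L t) (0, []) \<longleftrightarrow>
    clade_event m (t, A, L) \<and> (\<forall>K. full_event m K (t, A, L))"
proof -
  have "ancestor_birth A k \<le> 0" for k
  proof (induction k)
    case (Suc k)
    then show ?case using good[of k] by simp
  qed simp
  then have b: "ancestor_birth A k \<le> t" for k using t order_trans by blast
  have full: "anc_full m t A k \<longleftrightarrow> (\<forall>i\<in>{1..m}. i \<noteq> fst (A (Suc k)) \<longrightarrow> ancestor_birth A (Suc k) + snd (A (Suc
    k)) i \<le> t)" for k
  proof -
    have "ancestor_birth A (Suc k) + snd (A (Suc k)) (fst (A (Suc k))) \<le> t" using b[of k] by simp
    then show ?thesis unfolding anc_full_def by (auto simp: algebra_simps simp del: ancestor_birth.simps)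
  qed
  have all: "(\<forall>K k. k < K \<longrightarrow> Q k) \<longleftrightarrow> (\<forall>k. Q k)" for Q :: "nat \<Rightarrow> bool" by (meson lessI)
  have hyp: "(\<forall>k. (\<forall>j\<le>k. fst (A (Suc j)) \<in> {1..m}) \<and> (\<forall>j\<le>Suc k. ancestor_birth A j \<le> t) \<longrightarrow> Q k) \<longleftrightarrow> (\<forall>k. Q k)"
    for Q
    using b good by blast
  show ?thesis unfolding maximal_clade_o clade_event_def full_event_def fst_conv snd_conv all hyp full
    using t by (simp only: simp_thms)
qed

text \<open>Allows the event in \<open>P_mc\<close> to be changed on a null set.\<close>

lemma sets_maximal_clade_event:
  "{x \<in> space (limit_space m). maximal_clade m (indiv_child (fst (snd x))) (family_tree m (fst (snd x))
    (snd (snd x)) (fst x)) (0, [])}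
    \<in> sets (limit_space m)"
proof -
  let ?M = "limit_space m" and ?A = "\<lambda>x :: real \<times> anc_lives \<times> ord_lives. fst (snd x)"
  note f = measurable_limit_space(2)[of m]
  have b: "(\<lambda>x. ancestor_birth (?A x) k) \<in> borel_measurable ?M" for k
    by (rule measurable_compose[OF f measurable_ancestor_birth]) auto
  have pb: "Measurable.pred ?M (\<lambda>x. ancestor_birth (?A x) k \<le> fst x)" for k
    unfolding pred_def by (rule borel_measurable_le[OF b measurable_limit_space(1)])
  have k: "Suc k \<in> {1..}" for k by simp
  have ph: "Measurable.pred ?M (\<lambda>x. fst (?A x (Suc k)) \<in> S)" for k S
    by (rule measurable_compose[OF measurable_compose[OF f measurable_history_component(2)[OF k]]]) simp
  have pc: "Measurable.pred ?M (\<lambda>x. ancestor_birth (?A x) (Suc k) + snd (?A x (Suc k)) i \<le> fst x)" for k i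
    unfolding pred_def
    by (intro borel_measurable_le borel_measurable_add b measurable_limit_space(1)
        measurable_compose[OF f measurable_history_component(1)[OF k]])
  have p0: "Measurable.pred ?M (\<lambda>x. 0 \<le> fst x)"
    unfolding pred_def by (rule borel_measurable_le[OF borel_measurable_const measurable_limit_space(1)])
  have all_le: "Measurable.pred ?M (\<lambda>x. \<forall>j\<le>n. P j x)" if "\<And>j. Measurable.pred ?M (P j)" for P and n :: nat
  proof -
    have "Measurable.pred ?M (\<lambda>x. \<forall>j\<in>{..n}. P j x)" by (intro pred_intros_finite that) simp
    then show ?thesis by (simp only: Ball_def atMost_iff)
  qed
  have all_i: "Measurable.pred ?M (\<lambda>x. \<forall>i\<in>{1..m}. i \<noteq> fst (?A x (Suc k)) \<longrightarrow> ancestor_birth (?A x) (Suc k) +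
    snd (?A x (Suc k)) i \<le> fst x)" for k
  proof (intro pred_intros_finite)
    fix i
    have "Measurable.pred ?M (\<lambda>x. fst (?A x (Suc k)) \<in> - {i} \<longrightarrow> ancestor_birth (?A x) (Suc k) + snd (?A x
      (Suc k)) i \<le> fst x)"
      by (rule pred_intros_logic(4)[OF ph pc])
    then show "Measurable.pred ?M (\<lambda>x. i \<noteq> fst (?A x (Suc k)) \<longrightarrow> ancestor_birth (?A x) (Suc k) + snd (?A x
      (Suc k)) i \<le> fst x)"
      by (simp only: Compl_iff singleton_iff eq_commute[of i])
  qed simp
  have "Measurable.pred ?M (\<lambda>x. ((\<forall>j\<le>k. fst (?A x (Suc j)) \<in> {1..m}) \<and> (\<forall>j\<le>Suc k. ancestor_birth (?A x) j \<le>
    fst x)) \<longrightarrow>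
      (\<forall>i\<in>{1..m}. i \<noteq> fst (?A x (Suc k)) \<longrightarrow> ancestor_birth (?A x) (Suc k) + snd (?A x (Suc k)) i \<le> fst x))"
        for k
    by (rule pred_intros_logic(4)[OF pred_intros_logic(3)[OF all_le[OF ph] all_le[OF pb]] all_i])
  then have "Measurable.pred ?M (\<lambda>x. \<forall>k. ((\<forall>j\<le>k. fst (?A x (Suc j)) \<in> {1..m}) \<and> (\<forall>j\<le>Suc k. ancestor_birth
    (?A x) j \<le> fst x)) \<longrightarrow>
      (\<forall>i\<in>{1..m}. i \<noteq> fst (?A x (Suc k)) \<longrightarrow> ancestor_birth (?A x) (Suc k) + snd (?A x (Suc k)) i \<le> fst x))"
    by (rule pred_intros_countable(1))
  from predE[OF pred_intros_logic(3)[OF p0 pred_intros_logic(3)[OF pred_events(1)[unfolded clade_event_def]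
    this]]]
  show ?thesis unfolding maximal_clade_o .
qed

text \<open>Continuity from above in the number K of ancestors required to be full; the limiting
  event agrees with maximality outside a null set.\<close>

lemma P_mc_limit:
  assumes m: "m \<ge> 2"
  shows "(\<lambda>n. (restricted_step m ^^ K) (clade_prob m) n * fringe_prob n) sums
      measure (limit_space m) {x \<in> space (limit_space m). clade_event m x \<and> full_event m K x}" (is "?s K
        sums ?v K")
    and "(\<lambda>K. measure (limit_space m) {x \<in> space (limit_space m). clade_event m x \<and> full_event m K x}) \<longlonglongrightarrow>
      P_mc m"
proof -
  interpret prob_space "limit_space m" by (rule prob_space_limit_space)
  let ?S = "\<lambda>K. {x \<in> space (limit_space m). clade_event m x \<and> full_event m K x}"
  have S: "?S K \<in> sets (limit_space m)" for K
    by (rule predE[OF pred_intros_logic(3)[OF pred_events]])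
  have "0 \<le> ?s K n" for n
    by (intro mult_nonneg_nonneg restricted_steps_nonneg clade_prob_bounds less_imp_le[OF fringe_prob_pos])
  moreover have "(\<lambda>n. ennreal (?s K n)) sums ennreal (?v K)"
    using emeasure_events[OF m, of K] unfolding emeasure_eq_measure by (simp add: sums_iff)
  ultimately show "?s K sums ?v K" by (subst (asm) sums_ennreal) auto
  let ?E = "{x \<in> space (limit_space m). maximal_clade m (indiv_child (fst (snd x))) (family_tree m (fst
    (snd x)) (snd (snd x)) (fst x)) (0, [])}"
  have "?v \<longlonglongrightarrow> measure (limit_space m) (\<Inter>K. ?S K)"
  proof (rule finite_Lim_measure_decseq)
    show "decseq ?S" by (intro decseq_SucI) (auto simp: full_event_def)
  qed (use S in auto)
  also have "measure (limit_space m) (\<Inter>K. ?S K) = measure (limit_space m) ?E"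
  proof (rule measure_eq_AE)
    show "?E \<in> sets (limit_space m)" by (rule sets_maximal_clade_event)
    show "(\<Inter>K. ?S K) \<in> sets (limit_space m)" using S by auto
    show "AE x in limit_space m. x \<in> (\<Inter>K. ?S K) \<longleftrightarrow> x \<in> ?E"
      using AE_limit_space_good[OF m]
    proof eventually_elim
      case (elim x)
      obtain t A L where x: "x = (t, A, L)" by (cases x)
      from elim have "maximal_clade m (indiv_child A) (family_tree m A L t) (0, []) \<longleftrightarrow>
         clade_event m (t, A, L) \<and> (\<forall>K. full_event m K (t, A, L))"
        unfolding x by (intro maximal_clade_o_good) auto
      then show ?case unfolding x by auto
    qed
  qed
  also have "measure (limit_space m) ?E = P_mc m"
    unfolding P_mc_def by (simp add: case_prod_unfold)
  finally show "?v \<longlonglongrightarrow> P_mc m" .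
qed

section \<open>The limiting rate\<close>

definition free_step :: "nat \<Rightarrow> (nat \<Rightarrow> real) \<Rightarrow> nat \<Rightarrow> real" where
  "free_step m \<alpha> n = real m * (\<Sum>k\<le>n. split_prob m n k * \<alpha> k)"

lemma split_prob_full_le: "m \<ge> 2 \<Longrightarrow> split_prob_full m n k \<le> split_prob m n k"
  by (auto simp: split_prob_def split_prob_full_def intro!: divide_right_mono binomial_right_mono)

lemma restricted_le_free: "m \<ge> 2 \<Longrightarrow> (\<And>k. 0 \<le> \<alpha> k) \<Longrightarrow> restricted_step m \<alpha> n \<le> free_step m \<alpha> n"
  unfolding restricted_step_def free_step_def
  by (intro mult_left_mono sum_mono mult_right_mono split_prob_full_le) auto

text \<open>Invariance of \<open>fringe_prob\<close> in the form of \<open>fringe_adjoint\<close>;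
  nonnegativity permits exchanging the double sum in \<open>ennreal\<close>.\<close>

lemma free_step_sums:
  assumes m: "m \<ge> 2" and \<alpha>: "\<And>k. 0 \<le> \<alpha> k" and s: "(\<lambda>n. \<alpha> n * fringe_prob n) sums s"
  shows "(\<lambda>n. free_step m \<alpha> n * fringe_prob n) sums s"
proof -
  have f0: "0 \<le> fringe_prob n" for n by (rule less_imp_le[OF fringe_prob_pos])
  have s0: "0 \<le> s" using \<alpha> f0 by (intro sums_le[OF _ sums_zero s]) simp
  have nn: "0 \<le> free_step m \<alpha> n * fringe_prob n" for n
    using \<alpha> f0 by (simp add: free_step_def sum_nonneg split_prob_nonneg)
  have "ennreal (free_step m \<alpha> n * fringe_prob n) =
    (\<Sum>k. ennreal (\<alpha> k * (fringe_prob n * (real m * split_prob m n k))))" for n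
  proof -
    have "(\<Sum>k. ennreal (\<alpha> k * (fringe_prob n * (real m * split_prob m n k)))) =
       (\<Sum>k\<le>n. ennreal (\<alpha> k * (fringe_prob n * (real m * split_prob m n k))))"
      by (intro suminf_finite) (auto simp: split_prob_def)
    also have "\<dots> = ennreal (free_step m \<alpha> n * fringe_prob n)"
      using \<alpha> f0 by (subst sum_ennreal) (auto simp: free_step_def sum_distrib_left sum_distrib_right
        mult_ac split_prob_nonneg)
    finally show ?thesis by simp
  qed
  then have "(\<Sum>n. ennreal (free_step m \<alpha> n * fringe_prob n)) =
     (\<Sum>n. \<Sum>k. ennreal (\<alpha> k * (fringe_prob n * (real m * split_prob m n k))))" by simp
  also have "\<dots> = (\<Sum>k. \<Sum>n. ennreal (\<alpha> k * (fringe_prob n * (real m * split_prob m n k))))"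
    by (rule suminf_swap_ennreal)
  also have "\<dots> = (\<Sum>k. ennreal (\<alpha> k * fringe_prob k))"
  proof (rule suminf_cong)
    fix k
    show "(\<Sum>n. ennreal (\<alpha> k * (fringe_prob n * (real m * split_prob m n k)))) =
      ennreal (\<alpha> k * fringe_prob k)"
      using \<alpha> f0 by (intro suminf_ennreal_eq sums_mult fringe_adjoint m) (simp add: split_prob_nonneg)
  qed
  also have "\<dots> = ennreal s" using \<alpha> f0 by (intro suminf_ennreal_eq s) simp
  finally have "(\<lambda>n. ennreal (free_step m \<alpha> n * fringe_prob n)) sums ennreal s" by (simp add: sums_iff)
  then show ?thesis using nn s0 by (subst (asm) sums_ennreal) auto
qed

lemma restricted_step_add: "restricted_step m (\<lambda>k. \<alpha> k + \<beta> k) n =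
  restricted_step m \<alpha> n + restricted_step m \<beta> n"
  by (simp add: restricted_step_def distrib_left sum.distrib)

lemma restricted_step_sum: "restricted_step m (\<lambda>k. \<Sum>i<(L::nat). \<alpha> i k) n =
  (\<Sum>i<L. restricted_step m (\<alpha> i) n)"
  by (induction L) (simp_all add: restricted_step_add, simp add: restricted_step_def)

lemma free_step_sum: "free_step m (\<lambda>k. \<Sum>i<(L::nat). \<alpha> i k) n = (\<Sum>i<L. free_step m (\<alpha> i) n)"
proof (induction L)
  case (Suc L)
  have "free_step m (\<lambda>k. \<alpha> k + \<beta> k) n = free_step m \<alpha> n + free_step m \<beta> n" for \<alpha> \<beta>
    by (simp add: free_step_def distrib_left sum.distrib)
  with Suc show ?case by simp
qed (simp add: free_step_def)

text \<open>A step with all children present needs n >= k + 2 (m - 1), so each step adds at least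
  one key.\<close>

lemma restricted_steps_vanish:
  assumes m: "m \<ge> 2"
  shows "n < K \<Longrightarrow> (restricted_step m ^^ K) \<alpha> n = 0"
proof (induction K arbitrary: n)
  case (Suc K)
  have "split_prob_full m n k * (restricted_step m ^^ K) \<alpha> k = 0" for k
    using Suc m by (cases "k < K") (auto simp: split_prob_full_def)
  then have "(\<Sum>k\<le>n. split_prob_full m n k * (restricted_step m ^^ K) \<alpha> k) = 0" by (intro sum.neutral) blast
  then show ?case unfolding funpow.simps o_apply restricted_step_def[of m "(restricted_step m ^^ K) \<alpha>"]
    by simp
qed simp

lemma sum_fringe_prob: "(\<lambda>n. fringe_prob n * of_bool (0 < n)) sums 1"
proof -
  have "(\<lambda>n. 2 / (real n + 2)) \<longlonglongrightarrow> 0" by real_asymp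
  from telescope_sums'[OF this] have "(\<lambda>n. 2 / (real n + 2) - 2 / (real (Suc n) + 2)) sums 1" by simp
  moreover have "2 / (real n + 2) - 2 / (real (Suc n) + 2) = fringe_prob (Suc n)" for n
    by (simp add: fringe_prob_def field_simps)
  ultimately have "(\<lambda>n. fringe_prob (Suc n)) sums 1" by simp
  then show ?thesis using sums_Suc[of "\<lambda>n. fringe_prob n * of_bool (0 < n)" 1] by simp
qed

context tree_functional
begin

text \<open>Extends \<open>mean_rec\<close> to n < m - 1, where the kernel vanishes and
  \<open>nonfull_prob\<close> is 1 by its default values.\<close>

lemma mean_eq: "mean n = (if n = 0 then 0 else if b then 1 else nonfull_prob m n) + real m * (\<Sum>k\<le>n. kernel
  n k * mean k)"
proof (cases "m - 1 \<le> n")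
  case True
  then have "n \<noteq> 0" using m2 by auto
  then show ?thesis using mean_rec[OF True] by simp
next
  case False
  then have "kernel n k = 0" for k by (auto simp: kernel_def split_prob_def split_prob_full_def)
  moreover have "nonfull_prob m n = 1" using False by (simp add: nonfull_prob_def)
  ultimately show ?thesis using mean_short[of n] False by auto
qed

lemma mean_True: assumes b shows "mean n = of_bool (0 < n) + free_step m mean n"
proof -
  have "kernel = split_prob m" unfolding kernel_def using assms by (intro ext) (rule if_P)
  then show ?thesis using mean_eq[of n] assms by (simp only: free_step_def if_True) auto
qed

lemma mean_False: assumes "\<not> b" shows "mean n = clade_prob m n + restricted_step m mean n"
proof -
  have "kernel = split_prob_full m" unfolding kernel_def using assms by (intro ext) (rule if_not_P)
  then show ?thesis using mean_eq[of n] assms by (simp only: restricted_step_def clade_prob_def if_False)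
qed

text \<open>Toll relative to the free step, for which an invariant weight is known. The price is
  that for clades the toll involves \<open>mean\<close> itself.\<close>

definition toll :: "nat \<Rightarrow> real" where "toll n = mean n - free_step m mean n"

lemma toll_True: "b \<Longrightarrow> toll n = of_bool (0 < n)"
  using mean_True[of n] by (simp only: toll_def)

lemma toll_False: "\<not> b \<Longrightarrow> toll n = clade_prob m n - (free_step m mean n - restricted_step m mean n)"
  using mean_False[of n] by (simp only: toll_def) simp

lemma sum_F_subkeys_le: "(\<Sum>i=1..m. F (subkeys m xs i)) \<le> length xs"
proof -
  have "(\<Sum>i=1..m. F (subkeys m xs i)) \<le> (\<Sum>i=1..m. real (length (subkeys m xs i)))"
    using F_bounds by (intro sum_mono) auto
  also have "\<dots> = real (length xs - (m - 1))"
    using sum_length_subkeys[OF m2, of xs] by (simp flip: of_nat_sum)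
  finally show ?thesis by simp
qed

text \<open>The steps differ only if the root is not full, which has probability O(1 / n), while the
  subtrees contribute at most n.\<close>

lemma free_minus_restricted_le: "free_step m mean n - restricted_step m mean n \<le> real m * real m"
proof (cases "m - 1 \<le> n")
  case False
  then have "split_prob m n k = 0" "split_prob_full m n k = 0" for k
    by (auto simp: split_prob_def split_prob_full_def)
  then show ?thesis by (simp add: free_step_def restricted_step_def)
next
  case True
  have n0: "n > 0" using True m2 by auto
  have "free_step m mean n = avg n (\<lambda>xs. \<Sum>i=1..m. F (subkeys m xs i))"
    unfolding avg_sum free_step_def mean_def using avg_subkeys[OF m2 True _ order_invariant_F] by simp
  moreover have "restricted_step m mean n = avg n (\<lambda>xs. \<Sum>i=1..m. of_bool (full m xs) * F (subkeys m xs i))"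
    unfolding avg_sum restricted_step_def mean_def
      using avg_full_subkeys[OF m2 True _ order_invariant_F F_Nil] by simp
  ultimately have "free_step m mean n - restricted_step m mean n =
      avg n (\<lambda>xs. (\<Sum>i=1..m. F (subkeys m xs i)) - (\<Sum>i=1..m. of_bool (full m xs) * F (subkeys m xs i)))"
    by (simp add: avg_diff)
  also have "\<dots> \<le> avg n (\<lambda>xs. real n * (1 - of_bool (full m xs)))"
    using sum_F_subkeys_le by (intro avg_mono) (auto simp: sum_distrib_left[symmetric])
  also have "\<dots> = real n * nonfull_prob m n"
    unfolding avg_cmult avg_diff by (simp add: avg_full[OF m2 True] avg_const)
  also have "\<dots> \<le> real n * (real m * real (m - 1) / real n)"
    using nonfull_prob_le[OF m2 True] by (intro mult_left_mono) auto
  also have "\<dots> = real m * real (m - 1)" using n0 by simp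
  also have "\<dots> \<le> real m * real m" by (intro mult_left_mono) auto
  finally show ?thesis .
qed

lemma toll_bounded: "\<bar>toll n\<bar> \<le> 1 + real m * real m"
proof (cases b)
  case True
  then show ?thesis using toll_True[of n] by auto
next
  case False
  have "restricted_step m mean n \<le> free_step m mean n" by (intro restricted_le_free m2 mean_nonneg)
  then show ?thesis using toll_False[OF False, of n] free_minus_restricted_le[of n] clade_prob_bounds[of m
    n]
    by (auto simp: abs_le_iff)
qed

definition rate :: real where "rate = (\<Sum>n. fringe_prob n * toll n) / total_exit m"

lemma mean_tendsto: "(\<lambda>n. mean n / (n + 1)) \<longlonglongrightarrow> rate"
  and summable_toll: "summable (\<lambda>n. fringe_prob n * toll n)"
  unfolding rate_def
  using mean_limit[OF m2 mean_mono mean_nonneg mean_le _ toll_bounded]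
    by (auto simp: toll_def free_step_def)

lemma rate_True: "b \<Longrightarrow> rate = 1 / total_exit m"
  using sum_fringe_prob by (simp add: rate_def toll_True sums_iff)

lemma mean_eq_sum_levels:
  assumes b: "\<not> b"
  shows "mean n = (\<Sum>K<L. (restricted_step m ^^ K) (clade_prob m) n) + (restricted_step m ^^ L) mean n"
proof (induction L arbitrary: n)
  case (Suc L)
  have m: "mean = (\<lambda>k. clade_prob m k + restricted_step m mean k)" using mean_False[OF b] by (rule ext)
  have add: "(restricted_step m ^^ L) (\<lambda>k. \<alpha> k + \<beta> k) n =
    (restricted_step m ^^ L) \<alpha> n + (restricted_step m ^^ L) \<beta> n" for \<alpha> \<beta> n
  proof (induction L arbitrary: n)
    case (Suc L)
    have "(restricted_step m ^^ L) (\<lambda>k. \<alpha> k + \<beta> k) =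
      (\<lambda>k. (restricted_step m ^^ L) \<alpha> k + (restricted_step m ^^ L) \<beta> k)"
      using Suc by blast
    then show ?case by (simp add: restricted_step_add)
  qed simp
  have "(restricted_step m ^^ L) mean n = (restricted_step m ^^ L) (clade_prob m) n + (restricted_step m ^^
    Suc L) mean n"
    by (subst (1) m) (simp only: add funpow_Suc_right o_apply)
  with Suc[of n] show ?case by simp
qed simp

text \<open>The free step preserves the weighted sum, so replacing it by the restricted step loses v
  K - v (K + 1) on level K; summing over K < L telescopes. The truncation at L is made because
  \<open>mean\<close> may grow linearly and then is not summable against \<open>fringe_prob\<close>.
  In the limit the weighted toll is v 0 - (v 0 - P_mc m).\<close>

lemma rate_False:
  assumes b: "\<not> b"
  shows "rate = P_mc m / total_exit m"
proof -
  let ?\<alpha> = "\<lambda>K. (restricted_step m ^^ K) (clade_prob m)"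
  define v where "v K = measure (limit_space m) {x \<in>
    space (limit_space m). clade_event m x \<and> full_event m K x}" for K
  have v: "(\<lambda>n. ?\<alpha> K n * fringe_prob n) sums v K" for K unfolding v_def by (rule P_mc_limit(1)[OF m2])
  have lim: "v \<longlonglongrightarrow> P_mc m" using P_mc_limit(2)[OF m2] by (simp add: v_def[abs_def])
  have \<alpha>0: "0 \<le> ?\<alpha> K n" for K n by (intro restricted_steps_nonneg clade_prob_bounds)
  let ?A = "\<lambda>L k. \<Sum>K<L. ?\<alpha> K k"
  let ?\<gamma> = "\<lambda>\<alpha> n. free_step m \<alpha> n - restricted_step m \<alpha> n"
  have f0: "0 \<le> fringe_prob n" for n by (rule less_imp_le[OF fringe_prob_pos])
  have "(\<lambda>n. ?\<gamma> (?\<alpha> K) n * fringe_prob n) sums (v K - v (Suc K))" for K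
    using sums_diff[OF free_step_sums[OF m2 \<alpha>0 v[of K]] v[of "Suc K"]] by (simp add: left_diff_distrib)
  then have "(\<lambda>n. \<Sum>K<L. ?\<gamma> (?\<alpha> K) n * fringe_prob n) sums (\<Sum>K<L. v K - v (Suc K))" for L
    by (intro sums_sum)
  moreover have "(\<Sum>K<L. v K - v (Suc K)) = v 0 - v L" for L by (rule sum_lessThan_telescope')
  moreover have "(\<Sum>K<L. ?\<gamma> (?\<alpha> K) n * fringe_prob n) = ?\<gamma> (?A L) n * fringe_prob n" for L n
    by (simp add: free_step_sum restricted_step_sum sum_subtractf sum_distrib_right left_diff_distrib)
  ultimately have tel: "(\<lambda>n. ?\<gamma> (?A L) n * fringe_prob n) sums (v 0 - v L)" for L by simp
  have A: "?A L n \<le> mean n" for L n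
  proof -
    have "0 \<le> (restricted_step m ^^ L) mean n" by (intro restricted_steps_nonneg mean_nonneg)
    then show ?thesis using mean_eq_sum_levels[OF b, of n L] by simp
  qed
  have AL: "?A L n = mean n" if "n < L" for L n
    using mean_eq_sum_levels[OF b, of n L] restricted_steps_vanish[OF m2 that, of mean] by simp
  have \<gamma>eq: "?\<gamma> \<alpha> n = real m * (\<Sum>k\<le>n. (split_prob m n k - split_prob_full m n k) * \<alpha> k)" for \<alpha> n
    unfolding free_step_def restricted_step_def left_diff_distrib sum_subtractf right_diff_distrib ..
  have \<gamma>mono: "?\<gamma> (?A L) n \<le> ?\<gamma> mean n" for L n
    unfolding \<gamma>eq using A split_prob_full_le[OF m2] by (intro mult_left_mono sum_mono) auto
  have \<gamma>0: "0 \<le> ?\<gamma> (?A L) n" for L n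
    unfolding \<gamma>eq using \<alpha>0 split_prob_full_le[OF m2] by (intro mult_nonneg_nonneg sum_nonneg) auto
  have \<gamma>L: "?\<gamma> (?A L) n = ?\<gamma> mean n" if "n < L" for L n
    unfolding \<gamma>eq using AL that by (intro arg_cong2[of _ _ _ _ "(*)"] sum.cong) auto
  have st: "(\<lambda>n. toll n * fringe_prob n) sums (\<Sum>n. fringe_prob n * toll n)"
    using summable_sums[OF summable_toll] by (simp add: mult.commute)
  have "(\<lambda>n. ?\<alpha> 0 n * fringe_prob n - toll n * fringe_prob n) sums (v 0 - (\<Sum>n. fringe_prob n * toll n))"
    by (rule sums_diff[OF v st])
  moreover have "?\<alpha> 0 n * fringe_prob n - toll n * fringe_prob n = ?\<gamma> mean n * fringe_prob n" for n
    using toll_False[OF b, of n] by (simp add: left_diff_distrib)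
  ultimately have T: "(\<lambda>n. ?\<gamma> mean n * fringe_prob n) sums (v 0 - (\<Sum>n. fringe_prob n * toll n))" by simp
  \<comment> \<open>Squeezed between the partial sum over n < L, where the first L levels already
    add up to the mean, and the full series for the mean.\<close>
  have "(\<lambda>L. v 0 - v L) \<longlonglongrightarrow> v 0 - (\<Sum>n. fringe_prob n * toll n)"
  proof (rule tendsto_sandwich)
    show "eventually (\<lambda>L. (\<Sum>n<L. ?\<gamma> mean n * fringe_prob n) \<le> v 0 - v L) sequentially"
    proof (intro always_eventually allI)
      fix L
      have "(\<Sum>n<L. ?\<gamma> mean n * fringe_prob n) = (\<Sum>n<L. ?\<gamma> (?A L) n * fringe_prob n)"
        using \<gamma>L by (intro sum.cong) auto
      also have "\<dots> \<le> (\<Sum>n. ?\<gamma> (?A L) n * fringe_prob n)"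
        using \<gamma>0 f0 by (intro sum_le_suminf sums_summable[OF tel]) auto
      also have "\<dots> = v 0 - v L" by (rule sums_unique[OF tel, symmetric])
      finally show "(\<Sum>n<L. ?\<gamma> mean n * fringe_prob n) \<le> v 0 - v L" .
    qed
    show "eventually (\<lambda>L. v 0 - v L \<le> v 0 - (\<Sum>n. fringe_prob n * toll n)) sequentially"
      using \<gamma>mono f0 by (intro always_eventually allI sums_le[OF _ tel T] mult_right_mono)
    show "(\<lambda>L. \<Sum>n<L. ?\<gamma> mean n * fringe_prob n) \<longlonglongrightarrow> v 0 - (\<Sum>n. fringe_prob n * toll n)"
      using T by (simp only: sums_def)
  qed simp
  from tendsto_diff[OF tendsto_const[of "v 0"] this] have "v \<longlonglongrightarrow> (\<Sum>n. fringe_prob n * toll n)" by simp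
  then have "(\<Sum>n. fringe_prob n * toll n) = P_mc m" using lim by (rule LIMSEQ_unique)
  then show ?thesis by (simp add: rate_def)
qed

end

section \<open>Deviation from the mean\<close>

context tree_functional
begin

lemma rate_nonneg: "0 \<le> rate"
  by (rule tendsto_lowerbound[OF mean_tendsto]) (auto intro!: always_eventually simp: mean_nonneg)

text \<open>The tolerance is proportional to the number of keys plus one, because this quantity is
  additive over the children and the excess therefore propagates down the tree.\<close>

definition excess :: "real \<Rightarrow> nat \<Rightarrow> real list \<Rightarrow> real" where
  "excess \<epsilon> J xs = max 0 (\<bar>cond_mean J xs - rate * (real (length xs) + 1)\<bar> - \<epsilon> * (real (length xs) + 1))"

lemma excess_nonneg: "0 \<le> excess \<epsilon> J xs" by (simp add: excess_def)

lemma order_invariant_excess: "order_invariant (excess \<epsilon> J)"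
  using order_invariant_cond_mean[of J] by (simp add: excess_def order_invariant_def)

text \<open>Both the target and the tolerance split exactly among the children, leaving an error of
  at most 1 from the root. If the recursion stops at a clade, the conditional mean is 1 and the
  whole target is charged to the indicator.\<close>

lemma excess_Suc_le:
  assumes \<epsilon>: "0 \<le> \<epsilon>" and l: "m - 1 \<le> length xs"
  shows "excess \<epsilon> (Suc J) xs \<le> 1 + rate * (real (length xs) + 1) * (1 - of_bool (full m xs)) + (\<Sum>i=1..m.
    excess \<epsilon> J (subkeys m xs i))"
proof -
  let ?n = "real (length xs) + 1" and ?l = "\<lambda>i. real (length (subkeys m xs i)) + 1"
  let ?g = "\<lambda>i. cond_mean J (subkeys m xs i)"
  have R: "0 \<le> rate * ?n * (1 - of_bool (full m xs))" using rate_nonneg by simp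
  have E: "0 \<le> (\<Sum>i=1..m. excess \<epsilon> J (subkeys m xs i))" by (intro sum_nonneg excess_nonneg)
  have "\<bar>cond_mean (Suc J) xs - rate * ?n\<bar> - \<epsilon> * ?n \<le>
    1 + rate * ?n * (1 - of_bool (full m xs)) + (\<Sum>i=1..m. excess \<epsilon> J (subkeys m xs i))"
  proof (cases "b \<or> full m xs")
    case True
    have "(\<Sum>i=1..m. real (length (subkeys m xs i))) = real (length xs - (m - 1))"
      using sum_length_subkeys[OF m2, of xs] by (simp flip: of_nat_sum)
    then have n: "?n = (\<Sum>i=1..m. ?l i)" using l m2 by (simp add: sum.distrib of_nat_diff)
    have "cond_mean (Suc J) xs - rate * ?n = of_bool b + (\<Sum>i=1..m. ?g i - rate * ?l i)"
      using True l unfolding n by (simp add: sum_subtractf sum_distrib_left)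
    then have "\<bar>cond_mean (Suc J) xs - rate * ?n\<bar> \<le> 1 + (\<Sum>i=1..m. \<bar>?g i - rate * ?l i\<bar>)"
    proof -
      have "\<bar>of_bool b + S\<bar> \<le> 1 + \<bar>S\<bar>" for S :: real
        using abs_triangle_ineq[of "of_bool b" S] by (cases b) auto
      moreover have "cond_mean (Suc J) xs - rate * ?n = of_bool b + (\<Sum>i=1..m. ?g i - rate * ?l i) \<Longrightarrow>
          \<bar>of_bool b + (\<Sum>i=1..m. ?g i - rate * ?l i)\<bar> \<le> 1 + \<bar>\<Sum>i=1..m. ?g i - rate * ?l i\<bar> \<Longrightarrow> ?thesis"
        using sum_abs[of "\<lambda>i. ?g i - rate * ?l i" "{1..m}"] by linarith
      ultimately show ?thesis using \<open>cond_mean (Suc J) xs - rate * ?n = _\<close> by blast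
    qed
    then have "\<bar>cond_mean (Suc J) xs - rate * ?n\<bar> - \<epsilon> * ?n \<le> 1 + (\<Sum>i=1..m. \<bar>?g i - rate * ?l i\<bar> - \<epsilon> * ?l i)"
      unfolding n by (simp add: sum_subtractf sum_distrib_left)
    also have "(\<Sum>i=1..m. \<bar>?g i - rate * ?l i\<bar> - \<epsilon> * ?l i) \<le> (\<Sum>i=1..m. excess \<epsilon> J (subkeys m xs i))"
      by (intro sum_mono) (simp add: excess_def)
    finally show ?thesis using R by linarith
  next
    case False
    have nl: "\<not> length xs < m - 1" using l by simp
    have "cond_mean (Suc J) xs = 1" by (subst cond_mean.simps, subst if_not_P[OF nl], rule if_not_P[OF
      False])
    then have "\<bar>cond_mean (Suc J) xs - rate * ?n\<bar> \<le> 1 + rate * ?n"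
      using R rate_nonneg by (simp only: abs_le_iff) simp
    moreover have "0 \<le> \<epsilon> * ?n" using \<epsilon> by simp
    moreover have "rate * ?n * (1 - of_bool (full m xs)) = rate * ?n" using False by simp
    ultimately show ?thesis using E by linarith
  qed
  then show ?thesis using R E by (simp add: excess_def)
qed

lemma excess_Suc_short:
  assumes \<epsilon>: "0 \<le> \<epsilon>" and l: "length xs < m - 1"
  shows "excess \<epsilon> (Suc J) xs \<le> 1 + rate * m"
proof -
  let ?n = "real (length xs) + 1"
  have F: "0 \<le> F xs" "F xs \<le> 1" using F_bounds[of xs] F_short[of xs] l by (cases "xs = []"; auto)+
  have "rate * ?n \<le> rate * m" using l rate_nonneg by (intro mult_left_mono) auto
  moreover have "0 \<le> rate * ?n" "0 \<le> \<epsilon> * ?n" using rate_nonneg \<epsilon> by auto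
  moreover have "cond_mean (Suc J) xs = F xs" using l by simp
  ultimately show ?thesis using F by (simp only: excess_def)
qed

text \<open>Each level multiplies the bound by m and adds a constant, absorbed by passing to m + 1;
  a root that is not full costs rate (n + 1) with probability O(1 / n). The growth in J is harmless,
  as the bound does not depend on n.\<close>

lemma avg_excess:
  assumes \<epsilon>: "0 \<le> \<epsilon>" and C: "\<And>n. \<bar>mean n - rate * (real n + 1)\<bar> - \<epsilon> * (real n + 1) \<le> C" and C0: "0 \<le> C"
  shows "avg n (excess \<epsilon> J) \<le> (C + 1 + 2 * rate * m * m) * real (m + 1) ^ J"
proof (induction J arbitrary: n)
  case 0
  have "avg n (excess \<epsilon> 0) \<le> avg n (\<lambda>_. C + 1 + 2 * rate * m * m)"
  proof (rule avg_mono)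
    fix xs :: "real list" assume l: "length xs = n"
    have "0 \<le> 2 * rate * m * m" using rate_nonneg by simp
    moreover have "\<bar>cond_mean 0 xs - rate * (real (length xs) + 1)\<bar> - \<epsilon> * (real (length xs) + 1) \<le> C"
      using C[of n] l by simp
    ultimately show "excess \<epsilon> 0 xs \<le> C + 1 + 2 * rate * m * m"
      unfolding excess_def using C0 by (intro max.boundedI; linarith)
  qed
  then show ?case by (simp add: avg_const)
next
  case (Suc J)
  let ?D = "1 + 2 * rate * m * m" and ?B = "(C + 1 + 2 * rate * m * m) * real (m + 1) ^ J"
  have D0: "0 \<le> ?D" using rate_nonneg by simp
  have DB: "?D \<le> ?B"
  proof -
    have "?D * 1 \<le> (C + 1 + 2 * rate * m * m) * real (m + 1) ^ J"
      using C0 D0 by (intro mult_mono one_le_power) auto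
    then show ?thesis by simp
  qed
  have goal: "real m * ?B + ?B = (C + 1 + 2 * rate * m * m) * real (m + 1) ^ Suc J"
    by (simp add: algebra_simps)
  have B0: "0 \<le> ?B" using DB D0 by linarith
  show ?case
  proof (cases "m - 1 \<le> n")
    case False
    have "avg n (excess \<epsilon> (Suc J)) \<le> avg n (\<lambda>_. 1 + rate * m)"
      using False by (intro avg_mono excess_Suc_short \<epsilon>) auto
    also have "\<dots> \<le> ?D"
    proof -
      have "rate * m * 1 \<le> rate * m * (2 * m)" using m2 rate_nonneg by (intro mult_left_mono) auto
      then show ?thesis by (simp add: avg_const mult_ac)
    qed
    also have "\<dots> \<le> real m * ?B + ?B" using DB B0 m2 by (intro order_trans[OF DB]) auto
    finally show ?thesis unfolding goal .
  next
    case True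
    have n0: "n \<ge> 1" using True m2 by linarith
    have "avg n (excess \<epsilon> (Suc J)) \<le> avg n (\<lambda>xs. 1 + rate * (real n + 1) * (1 - of_bool (full m xs)) +
      (\<Sum>i=1..m. excess \<epsilon> J (subkeys m xs i)))"
      using True by (intro avg_mono order_trans[OF excess_Suc_le[OF \<epsilon>]]) auto
    also have "\<dots> = 1 + rate * (real n + 1) * nonfull_prob m n + (\<Sum>i=1..m. \<Sum>k\<le>n. split_prob m n k * avg k
      (excess \<epsilon> J))"
      unfolding avg_add avg_sum avg_cmult avg_diff avg_const avg_full[OF m2 True]
      using avg_subkeys[OF m2 True _ order_invariant_excess] by simp
    also have "rate * (real n + 1) * nonfull_prob m n \<le> 2 * rate * m * m"
    proof -
      have "rate * (real n + 1) * nonfull_prob m n \<le> rate * (real n + 1) * (real m * real (m - 1) / real n)"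
        using nonfull_prob_le[OF m2 True] rate_nonneg by (intro mult_left_mono) auto
      also have "\<dots> \<le> rate * (2 * real n) * (real m * real m / real n)"
        using rate_nonneg n0 by (intro mult_mono mult_left_mono divide_right_mono) auto
      also have "\<dots> = 2 * rate * m * m" using n0 by simp
      finally show ?thesis .
    qed
    also have "(\<Sum>i=1..m. \<Sum>k\<le>n. split_prob m n k * avg k (excess \<epsilon> J)) \<le>
      (\<Sum>i=1..m. \<Sum>k\<le>n. split_prob m n k * ?B)"
      using Suc by (intro sum_mono mult_left_mono) (auto simp: split_prob_nonneg)
    also have "\<dots> = real m * ((\<Sum>k\<le>n. split_prob m n k) * ?B)" by (simp only: sum_distrib_right) simp
    also have "\<dots> = real m * ?B" unfolding sum_split_prob[OF m2 True] by simp
    finally have "avg n (excess \<epsilon> (Suc J)) \<le> ?D + real m * ?B" by simp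
    also have "\<dots> \<le> real m * ?B + ?B" using DB by simp
    finally show ?thesis unfolding goal .
  qed
qed

definition far :: "real \<Rightarrow> real list \<Rightarrow> bool" where
  "far \<epsilon> xs \<longleftrightarrow> 3 * \<epsilon> * (real (length xs) + 1) < \<bar>F xs - rate * (real (length xs) + 1)\<bar>"

lemma order_invariant_far: "order_invariant (far \<epsilon>)"
  using order_invariant_F by (simp add: far_def order_invariant_def)

text \<open>One of the three \<epsilon> in \<open>far\<close> is the tolerance inside
  \<open>excess\<close>; one of the other two must be used up by \<open>dev\<close>, estimated by
  Chebyshev's inequality, or by \<open>excess\<close>, estimated by Markov's.\<close>

lemma avg_far_le:
  assumes \<epsilon>: "0 < \<epsilon>" and C: "\<And>n. \<bar>mean n - rate * (real n + 1)\<bar> - \<epsilon> * (real n + 1) \<le> C" and C0: "0 \<le> C"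
  shows "avg n (\<lambda>xs. of_bool (far \<epsilon> xs)) \<le> (2 / (m + 1)) ^ J / \<epsilon>\<^sup>2 + (C + 1 + 2 * rate * m * m) / \<epsilon> * (real
    (m + 1) ^ J / (real n + 1))"
proof -
  let ?n = "real n + 1"
  have n0: "?n > 0" by simp
  have "avg n (\<lambda>xs. of_bool (far \<epsilon> xs)) \<le> avg n (\<lambda>xs. 1 / (\<epsilon> * ?n)\<^sup>2 * (dev J xs)\<^sup>2 + 1 / (\<epsilon> * ?n) * excess
    \<epsilon> J xs)"
  proof (rule avg_mono)
    fix xs :: "real list" assume l: "length xs = n"
    have nn: "0 \<le> 1 / (\<epsilon> * ?n)\<^sup>2 * (dev J xs)\<^sup>2" "0 \<le> 1 / (\<epsilon> * ?n) * excess \<epsilon> J xs"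
      using \<epsilon> excess_nonneg by auto
    show "of_bool (far \<epsilon> xs) \<le> 1 / (\<epsilon> * ?n)\<^sup>2 * (dev J xs)\<^sup>2 + 1 / (\<epsilon> * ?n) * excess \<epsilon> J xs"
    proof (cases "far \<epsilon> xs")
      case True
      have en: "0 < \<epsilon> * ?n" using \<epsilon> by simp
      have "3 * (\<epsilon> * ?n) < \<bar>F xs - rate * ?n\<bar>" using True l by (simp add: far_def mult.assoc)
      also have "\<dots> \<le> \<bar>dev J xs\<bar> + (\<epsilon> * ?n + excess \<epsilon> J xs)"
        using l unfolding dev_def excess_def by (auto simp: max_def abs_if)
      finally consider "\<epsilon> * ?n \<le> \<bar>dev J xs\<bar>" | "\<epsilon> * ?n \<le> excess \<epsilon> J xs" by linarith
      then have "1 \<le> 1 / (\<epsilon> * ?n)\<^sup>2 * (dev J xs)\<^sup>2 \<or> 1 \<le> 1 / (\<epsilon> * ?n) * excess \<epsilon> J xs"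
      proof cases
        case 1
        then have "(\<epsilon> * ?n)\<^sup>2 \<le> \<bar>dev J xs\<bar>\<^sup>2" using en by (intro power_mono) auto
        then show ?thesis using en by (simp add: field_simps)
      next
        case 2
        then show ?thesis using en by (simp add: pos_le_divide_eq)
      qed
      moreover have "of_bool (far \<epsilon> xs) = (1 :: real)" using True by simp
      ultimately show ?thesis using nn by (elim disjE) linarith+
    qed (use nn in simp)
  qed
  also have "\<dots> = 1 / (\<epsilon> * ?n)\<^sup>2 * avg n (\<lambda>xs. (dev J xs)\<^sup>2) + 1 / (\<epsilon> * ?n) * avg n (excess \<epsilon> J)"
    by (simp only: avg_add avg_cmult)
  also have "\<dots> \<le> 1 / (\<epsilon> * ?n)\<^sup>2 * ((2 / (m + 1)) ^ J * ?n\<^sup>2) + 1 / (\<epsilon> * ?n) * ((C + 1 + 2 * rate * m * m) *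
    real (m + 1) ^ J)"
    using \<epsilon> avg_dev_square[of n J] avg_excess[OF less_imp_le[OF \<epsilon>] C C0, of n J]
    by (intro add_mono mult_left_mono) auto
  also have "\<dots> = (2 / (m + 1)) ^ J / \<epsilon>\<^sup>2 + (C + 1 + 2 * rate * m * m) / \<epsilon> * (real (m + 1) ^ J / ?n)"
  proof -
    have "1 / (\<epsilon> * N)\<^sup>2 * (x * N\<^sup>2) + 1 / (\<epsilon> * N) * (y * z) = x / \<epsilon>\<^sup>2 + y / \<epsilon> * (z / N)" if "N > 0"
      for N x y z :: real
      using that \<epsilon> by (simp add: power2_eq_square)
    from this[OF n0] show ?thesis .
  qed
  finally show ?thesis .
qed

text \<open>The error is o(n), so it is within the tolerance except at finitely many n.\<close>

lemma mean_error_bounded: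
  assumes \<epsilon>: "0 < \<epsilon>"
  shows "\<exists>C\<ge>0. \<forall>n. \<bar>mean n - rate * (real n + 1)\<bar> - \<epsilon> * (real n + 1) \<le> C"
proof -
  have "eventually (\<lambda>n. dist (mean n / (n + 1)) rate < \<epsilon>) sequentially"
    by (rule tendstoD[OF mean_tendsto \<epsilon>])
  then obtain N where N: "\<And>n. n \<ge> N \<Longrightarrow> dist (mean n / (n + 1)) rate < \<epsilon>"
    by (auto simp: eventually_sequentially)
  let ?e = "\<lambda>n. \<bar>mean n - rate * (real n + 1)\<bar>"
  let ?C = "\<Sum>n<N. ?e n"
  have "?e n - \<epsilon> * (real n + 1) \<le> ?C" for n
  proof (cases "n < N")
    case True
    then have "?e n \<le> ?C" by (intro member_le_sum) auto
    moreover have "0 \<le> \<epsilon> * (real n + 1)" using \<epsilon> by simp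
    ultimately show ?thesis by linarith
  next
    case False
    have "?e n = dist (mean n / (n + 1)) rate * (real n + 1)"
    proof -
      have "mean n - rate * (real n + 1) = (mean n / (n + 1) - rate) * (real n + 1)"
        by (simp add: field_simps)
      then show ?thesis by (simp only: dist_real_def abs_mult)
    qed
    also have "\<dots> \<le> \<epsilon> * (real n + 1)" using N[of n] False by (intro mult_right_mono) auto
    finally have "?e n - \<epsilon> * (real n + 1) \<le> 0" by simp
    also have "0 \<le> ?C" by (intro sum_nonneg) auto
    finally show ?thesis .
  qed
  moreover have "0 \<le> ?C" by (intro sum_nonneg) auto
  ultimately show ?thesis by blast
qed

text \<open>The depth is taken to be \<open>J = 4 l\<close> with \<open>2 ^ l\<close> about \<open>i\<close>, so that the variance
  term is at most \<open>4 / i\<^sup>2\<close>.\<close>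

lemma summable_far:
  obtains q where "q \<ge> 1" "\<And>\<epsilon>. 0 < \<epsilon> \<Longrightarrow> summable (\<lambda>i. avg (Suc i ^ q) (\<lambda>xs. of_bool (far \<epsilon> xs)))"
proof -
  obtain p where p: "m + 1 \<le> 2 ^ p" using ex_power_ivl2[of 2 "m + 1"] m2
    by (metis less_exp less_imp_le)
  \<comment> \<open>With 2^l <= Suc i the factor (m + 1)^(4 l) is at most (Suc i)^(4 p); the
    additional exponent 2 leaves a summable 1 / (Suc i)^2.\<close>
  let ?q = "4 * p + 2"
  have "summable (\<lambda>i. avg (Suc i ^ ?q) (\<lambda>xs. of_bool (far \<epsilon> xs)))" if \<epsilon>: "0 < \<epsilon>" for \<epsilon>
  proof -
    obtain C where C: "0 \<le> C" "\<And>n. \<bar>mean n - rate * (real n + 1)\<bar> - \<epsilon> * (real n + 1) \<le> C"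
      using mean_error_bounded[OF \<epsilon>] by blast
    define B where "B = (C + 1 + 2 * rate * m * m) / \<epsilon>"
    have B: "0 \<le> B" unfolding B_def using C rate_nonneg \<epsilon> by simp
    have bound: "avg (Suc i ^ ?q) (\<lambda>xs. of_bool (far \<epsilon> xs)) \<le> (4 / \<epsilon>\<^sup>2 + B) * (1 / real (Suc i) ^ 2)" for i
    proof -
      let ?i = "real (Suc i)"
      obtain l where l: "2 ^ l \<le> Suc i" "Suc i < 2 ^ (l + 1)" using ex_power_ivl1[of 2 "Suc i"] by auto
      have l1: "2 ^ l \<le> ?i" using l(1) by (metis of_nat_le_iff of_nat_numeral of_nat_power)
      have "real (Suc i) < real (2 ^ (l + 1))" using l(2) by (simp only: of_nat_less_iff)
      then have l2: "?i \<le> 2 * 2 ^ l" by simp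
      have "(2 / (m + 1) :: real) ^ (4 * l) \<le> (2 / 3) ^ (4 * l)"
        using m2 by (intro power_mono) (auto simp: field_simps)
      also have "\<dots> = ((2 / 3) ^ 4) ^ l" by (simp add: power_mult)
      \<comment> \<open>(2 / 3)^4 = 16 / 81 < 1 / 4, the reason for the 4 in the depth.\<close>
      also have "\<dots> \<le> (1 / 4) ^ l" by (intro power_mono) (auto simp: power_divide)
      also have "\<dots> = (1 / 2 ^ l)\<^sup>2" by (simp add: power_divide power_mult[symmetric] power2_eq_square flip:
        power_mult_distrib)
      also have "\<dots> \<le> (2 / ?i)\<^sup>2" using l2 by (intro power_mono) (auto simp: field_simps)
      also have "\<dots> = 4 * (1 / ?i ^ 2)" by (simp add: power_divide)
      finally have v: "(2 / (m + 1) :: real) ^ (4 * l) \<le> 4 * (1 / ?i ^ 2)" .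
      have "real (m + 1) ^ (4 * l) \<le> (2 ^ p) ^ (4 * l)" using p
        by (intro power_mono) (metis of_nat_le_iff of_nat_numeral of_nat_power, simp)
      also have "\<dots> = (2 ^ l) ^ (4 * p)" by (simp add: power_mult[symmetric] mult_ac)
      also have "\<dots> \<le> ?i ^ (4 * p)" using l1 by (intro power_mono) auto
      finally have e: "real (m + 1) ^ (4 * l) \<le> ?i ^ (4 * p)" .
      have "real (m + 1) ^ (4 * l) / (real (Suc i ^ ?q) + 1) \<le> ?i ^ (4 * p) / (?i ^ (4 * p) * ?i ^ 2)"
      proof (intro frac_le e)
        have "?i ^ (4 * p) * ?i ^ 2 = real (Suc i ^ ?q)" by (simp only: of_nat_power of_nat_mult power_add)
        then show "?i ^ (4 * p) * ?i ^ 2 \<le> real (Suc i ^ ?q) + 1" by linarith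
      qed auto
      also have "\<dots> = 1 / ?i ^ 2" by simp
      finally have e: "real (m + 1) ^ (4 * l) / (real (Suc i ^ ?q) + 1) \<le> 1 / ?i ^ 2" .
      have "avg (Suc i ^ ?q) (\<lambda>xs. of_bool (far \<epsilon> xs)) \<le>
        (2 / (m + 1)) ^ (4 * l) / \<epsilon>\<^sup>2 + B * (real (m + 1) ^ (4 * l) / (real (Suc i ^ ?q) + 1))"
        unfolding B_def by (rule avg_far_le[OF \<epsilon> C(2,1)])
      also have "\<dots> \<le> 4 * (1 / ?i ^ 2) / \<epsilon>\<^sup>2 + B * (1 / ?i ^ 2)"
        using v e B \<epsilon> by (intro add_mono divide_right_mono mult_left_mono) auto
      also have "4 * y / e + B * y = (4 / e + B) * y" for y e :: real by (simp add: distrib_right)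
      finally show ?thesis .
    qed
    show ?thesis
    proof (rule summable_comparison_test)
      have "0 \<le> avg n (\<lambda>xs. of_bool (far \<epsilon> xs))" for n
        using avg_mono[of n "\<lambda>_. 0" "\<lambda>xs. of_bool (far \<epsilon> xs)"] by (simp add: avg_const)
      then show "\<exists>N. \<forall>i\<ge>N. norm (avg (Suc i ^ ?q) (\<lambda>xs. of_bool (far \<epsilon> xs))) \<le>
        (4 / \<epsilon>\<^sup>2 + B) * (1 / real (Suc i) ^ 2)"
        using bound by auto
      have "summable (\<lambda>i. 1 / real (Suc i) ^ 2)"
        using inverse_power_summable[of 2, where 'a = real]
          by (subst summable_Suc_iff) (simp add: field_simps)
      then show "summable (\<lambda>i. (4 / \<epsilon>\<^sup>2 + B) * (1 / real (Suc i) ^ 2))" by (rule summable_mult)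
    qed
  qed
  then show thesis by (intro that[of ?q]) auto
qed

end

section \<open>Keys with a continuous distribution\<close>

text \<open>Because of the strict inequalities the events of different permutations are disjoint,
  and outcomes with ties among the keys belong to none of them.\<close>

definition pattern_event :: "'a measure \<Rightarrow> (nat \<Rightarrow> 'a \<Rightarrow> real) \<Rightarrow> real list \<Rightarrow> 'a set" where
  "pattern_event M X ys = {\<omega> \<in> space M. \<forall>i<length ys. \<forall>j<length ys. ys ! i < ys ! j \<longrightarrow> X i \<omega> < X j \<omega>}"

lemma nth_permutation_eq_rank:
  assumes ys: "ys \<in> permutations_of_set (real ` {..<n})" and i: "i < n"
  shows "ys ! i = real (card {j\<in>{..<n}. ys ! j < ys ! i})"
proof -
  have d: "distinct ys" "set ys = real ` {..<n}" using ys by (auto simp: permutations_of_set_def)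
  have l: "length ys = n" by (rule length_permutations_of_reals[OF ys])
  have "ys ! i \<in> real ` {..<n}" using d l i by (metis nth_mem)
  then obtain k where k: "ys ! i = real k" "k < n" by auto
  have "(\<lambda>j. ys ! j) ` {j\<in>{..<n}. ys ! j < ys ! i} = {y \<in> set ys. y < ys ! i}"
    using l by (auto simp: set_conv_nth)
  also have "\<dots> = real ` {..<k}" using k d by auto
  finally have img: "(\<lambda>j. ys ! j) ` {j\<in>{..<n}. ys ! j < ys ! i} = real ` {..<k}" .
  have "inj_on (\<lambda>j. ys ! j) {j\<in>{..<n}. ys ! j < ys ! i}"
    using d l by (auto simp: inj_on_def nth_eq_iff_index_eq)
  from card_image[OF this] have "k = card {j\<in>{..<n}. ys ! j < ys ! i}" unfolding img
    by (simp add: card_image)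
  then show ?thesis using k(1) by simp
qed

lemma pattern_event_unique:
  assumes ys: "ys \<in> permutations_of_set (real ` {..<n})" "ys' \<in> permutations_of_set (real ` {..<n})"
    and \<omega>: "\<omega> \<in> pattern_event M X ys" "\<omega> \<in> pattern_event M X ys'"
  shows "ys = ys'"
proof -
  have key: "zs ! i = real (card {j\<in>{..<n}. X j \<omega> < X i \<omega>})"
    if zs: "zs \<in> permutations_of_set (real ` {..<n})" and w: "\<omega> \<in> pattern_event M X zs" and i: "i < n"
      for zs i
  proof -
    have d: "distinct zs" "length zs = n"
      using zs length_permutations_of_reals[OF zs] by (auto simp: permutations_of_set_def)
    have imp: "zs ! a < zs ! b \<Longrightarrow> X a \<omega> < X b \<omega>" if "a < n" "b < n" for a b
      using w d that by (simp add: pattern_event_def)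
    have "zs ! j < zs ! i \<longleftrightarrow> X j \<omega> < X i \<omega>" if j: "j < n" for j
    proof (cases "j = i")
      case False
      then have "zs ! j \<noteq> zs ! i" using d i j by (simp add: nth_eq_iff_index_eq)
      then show ?thesis using imp[OF i j] imp[OF j i] by fastforce
    qed simp
    then have "{j\<in>{..<n}. zs ! j < zs ! i} = {j\<in>{..<n}. X j \<omega> < X i \<omega>}" by auto
    then show ?thesis using nth_permutation_eq_rank[OF zs i] by simp
  qed
  have "length ys = n" "length ys' = n" using ys length_permutations_of_reals by auto
  then show ?thesis using key[OF ys(1) \<omega>(1)] key[OF ys(2) \<omega>(2)] by (intro nth_equalityI) auto
qed

text \<open>The pattern is the list of ranks. Ranking is strictly increasing on the keys, so \<phi>
  does not see the difference.\<close>

lemma pattern_exists: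
  assumes inj: "inj_on (\<lambda>i. X i \<omega>) {..<n}" and \<omega>: "\<omega> \<in> space M" and \<phi>: "order_invariant \<phi>"
  obtains ys where "ys \<in> permutations_of_set (real ` {..<n})" "\<omega> \<in> pattern_event M X ys"
    "\<phi> (map (\<lambda>i. X i \<omega>) [0..<n]) = \<phi> ys"
proof -
  let ?x = "\<lambda>i. X i \<omega>"
  define S where "S = ?x ` {..<n}"
  let ?r = "\<lambda>x. real (card {y \<in> S. y < x})"
  have S: "finite S" "card S = n" unfolding S_def using inj by (simp_all add: card_image)
  have sm: "strict_mono_on S ?r" using bij_betw_rank(2)[OF S(1)] by (auto simp: strict_mono_on_def)
  have img: "?r ` S = real ` {..<n}"
  proof -
    have "?r ` S = real ` ((\<lambda>x. card {y \<in> S. y < x}) ` S)" by (simp add: image_image)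
    also have "(\<lambda>x. card {y \<in> S. y < x}) ` S = {..<card S}"
      using bij_betw_rank(1)[OF S(1)] by (simp add: bij_betw_def)
    finally show ?thesis unfolding S(2) .
  qed
  define ys where "ys = map ?r (map ?x [0..<n])"
  have set: "set (map ?x [0..<n]) = S" by (auto simp: S_def atLeast0LessThan)
  have "inj_on ?r S" by (rule strict_mono_on_imp_inj_on[OF sm])
  then have "distinct ys" unfolding ys_def using inj set
    by (simp only: distinct_map) (auto simp: atLeast0LessThan inj_on_def)
  moreover have "set ys = real ` {..<n}" unfolding ys_def using set img by (simp only: set_map)
  ultimately have 1: "ys \<in> permutations_of_set (real ` {..<n})" by (simp add: permutations_of_set_def)
  have 2: "\<omega> \<in> pattern_event M X ys"
  proof -
    have "X i \<omega> < X j \<omega>" if "i < n" "j < n" "?r (X i \<omega>) < ?r (X j \<omega>)" for i j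
    proof (rule ccontr)
      assume "\<not> X i \<omega> < X j \<omega>"
      then have "{y \<in> S. y < X j \<omega>} \<subseteq> {y \<in> S. y < X i \<omega>}" by auto
      then have "card {y \<in> S. y < X j \<omega>} \<le> card {y \<in> S. y < X i \<omega>}" using S(1) by (intro card_mono) auto
      then show False using that(3) by simp
    qed
    then show ?thesis using \<omega> by (simp add: pattern_event_def ys_def)
  qed
  have 3: "\<phi> (map ?x [0..<n]) = \<phi> ys"
    using \<phi>[unfolded order_invariant_def, rule_format, of "map ?x [0..<n]" ?r] sm unfolding ys_def set
      by simp
  from that[OF 1 2 3] show thesis .
qed

section \<open>Uniform distribution of the rank pattern\<close>

locale iid_continuous = prob_space +
  fixes X :: "nat \<Rightarrow> 'a \<Rightarrow> real" and \<mu> :: "real measure"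
  assumes indep: "indep_vars (\<lambda>_. borel) X UNIV"
    and law: "\<And>i. distr M borel (X i) = \<mu>"
    and cont: "continuous_on UNIV (cdf \<mu>)"
begin

lemma measurable_X [measurable]: "X i \<in> borel_measurable M"
  using indep by (simp add: indep_vars_def)

lemma real_distribution_law: "real_distribution \<mu>"
  using real_distribution_distr[OF measurable_X[of 0]] law by simp

sublocale \<mu>: real_distribution \<mu> by (rule real_distribution_law)

lemma measure_singleton: "emeasure \<mu> {x} = 0"
proof -
  have "isCont (cdf \<mu>) x" using cont by (simp add: continuous_on_eq_continuous_at)
  then show ?thesis by (simp add: \<mu>.isCont_cdf \<mu>.emeasure_eq_measure)
qed

sublocale P: product_prob_space "\<lambda>_::nat. \<mu>" I for I
  by (simp add: product_prob_space_def product_prob_space_axioms_def product_sigma_finite_def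
        \<mu>.prob_space_axioms prob_space_imp_sigma_finite)

lemma joint_law:
  "I \<noteq> {} \<Longrightarrow> distr M (PiM I (\<lambda>_. borel)) (\<lambda>\<omega>. \<lambda>i\<in>I. X i \<omega>) = PiM I (\<lambda>_. \<mu>)"
  using indep_vars_iff_distr_eq_PiM[of I X "\<lambda>_. borel"] indep_vars_subset[OF indep, of I] by (simp add: law)

text \<open>By Fubini: given one key, the other one avoids its value, as a law with continuous
  distribution function has no atoms.\<close>

lemma AE_neq:
  assumes "i \<noteq> j"
  shows "AE \<omega> in M. X i \<omega> \<noteq> X j \<omega>"
proof -
  let ?N = "PiM {i, j} (\<lambda>_. borel :: real measure)" and ?P = "PiM {i, j} (\<lambda>_. \<mu>)"
  let ?T = "\<lambda>\<omega>. \<lambda>i\<in>{i, j}. X i \<omega>"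
  let ?D = "{x \<in> space ?P. x i = x j}"
  have T: "?T \<in> M \<rightarrow>\<^sub>M ?N" by (intro measurable_restrict measurable_X)
  have sp: "sets ?P = sets ?N" by (intro sets_PiM_cong) auto
  have D: "?D \<in> sets ?P"
  proof -
    have "(\<lambda>x. x i) \<in> borel_measurable ?P" "(\<lambda>x. x j) \<in> borel_measurable ?P"
      using measurable_component_singleton[of i "{i, j}" "\<lambda>_. \<mu>"] measurable_component_singleton[of j "{i,
        j}" "\<lambda>_. \<mu>"]
      by (simp_all cong: measurable_cong_sets)
    then show ?thesis by (rule borel_measurable_eq)
  qed
  have "emeasure ?P ?D = (\<integral>\<^sup>+x. indicator ?D x \<partial>PiM (insert i {j}) (\<lambda>_. \<mu>))" using D by simp
  also have "\<dots> = (\<integral>\<^sup>+x. \<integral>\<^sup>+y. indicator ?D (x(i := y)) \<partial>\<mu> \<partial>PiM {j} (\<lambda>_. \<mu>))"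
    using D assms by (intro P.product_nn_integral_insert) auto
  also have "\<dots> = (\<integral>\<^sup>+x. 0 \<partial>PiM {j} (\<lambda>_. \<mu>))"
  proof (rule nn_integral_cong)
    fix x :: "nat \<Rightarrow> real"
    have "(\<integral>\<^sup>+y. indicator ?D (x(i := y)) \<partial>\<mu>) \<le> (\<integral>\<^sup>+y. indicator {x j} y \<partial>\<mu>)"
      using assms by (intro nn_integral_mono) (auto simp: indicator_def)
    also have "\<dots> = 0" using measure_singleton[of "x j"] by simp
    finally show "(\<integral>\<^sup>+y. indicator ?D (x(i := y)) \<partial>\<mu>) = 0" by simp
  qed
  finally have null: "emeasure ?P ?D = 0" by simp
  have "emeasure ?P ?D = emeasure M (?T -` ?D \<inter> space M)"
    unfolding joint_law[of "{i, j}", simplified, symmetric] using D sp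
      by (subst emeasure_distr[OF T]) (auto simp: sp)
  also have "?T -` ?D \<inter> space M = {\<omega> \<in> space M. X i \<omega> = X j \<omega>}"
    by (auto simp: space_PiM)
  finally have "emeasure M {\<omega> \<in> space M. X i \<omega> = X j \<omega>} = 0" using null by simp
  then show ?thesis by (subst AE_iff_measurable[OF _ refl]) auto
qed

lemma AE_inj: "AE \<omega> in M. inj (\<lambda>i. X i \<omega>)"
proof -
  have "AE \<omega> in M. \<forall>i. \<forall>j. i \<noteq> j \<longrightarrow> X i \<omega> \<noteq> X j \<omega>"
    unfolding AE_all_countable using AE_neq by (intro allI) (auto intro: AE_impI)
  then show ?thesis by eventually_elim (auto simp: inj_def)
qed

lemma sets_pattern_event [measurable]: "pattern_event M X ys \<in> sets M"
  unfolding pattern_event_def by measurable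

text \<open>Exchangeability: \<sigma> is the inverse permutation of \<open>ys\<close>, and
  reindexing the product measure by it carries the event to that of increasing keys, the same for
  all \<open>ys\<close>.\<close>

lemma emeasure_pattern_event_eq:
  assumes ys: "ys \<in> permutations_of_set (real ` {..<n})" and n: "n > 0"
  shows "emeasure M (pattern_event M X ys) = emeasure (PiM {..<n} (\<lambda>_. \<mu>)) {x \<in>
    space (PiM {..<n} (\<lambda>_. \<mu>)). \<forall>a<n. \<forall>b<n. a < b \<longrightarrow> x a < x b}"
proof -
  have d: "distinct ys" "set ys = real ` {..<n}" using ys by (auto simp: permutations_of_set_def)
  have l: "length ys = n" by (rule length_permutations_of_reals[OF ys])
  have "\<exists>i<n. ys ! i = real a" if "a < n" for a
  proof -
    have "real a \<in> set ys" using that d(2) by blast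
    then show ?thesis unfolding in_set_conv_nth l .
  qed
  then have "\<forall>a. \<exists>i. a < n \<longrightarrow> i < n \<and> ys ! i = real a" by blast
  from choice[OF this] obtain \<sigma> where \<sigma>: "\<And>a. a < n \<Longrightarrow> \<sigma> a < n \<and> ys ! \<sigma> a = real a" by blast
  have inj: "inj_on \<sigma> {..<n}"
  proof (rule inj_onI)
    fix a b assume ab: "a \<in> {..<n}" "b \<in> {..<n}" "\<sigma> a = \<sigma> b"
    have "a < n" "b < n" using ab(1,2) by blast+
    from \<sigma>[OF this(1), THEN conjunct2] \<sigma>[OF this(2), THEN conjunct2] have "real a = real b"
      unfolding ab(3) by (rule trans[OF sym])
    then show "a = b" by (simp only: of_nat_eq_iff)
  qed
  have surj: "\<exists>a<n. i = \<sigma> a" if "i < n" for i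
  proof -
    have "\<sigma> ` {..<n} \<subseteq> {..<n}" using \<sigma> by blast
    then have "\<sigma> ` {..<n} = {..<n}" by (rule endo_inj_surj[OF finite_lessThan _ inj])
    then have "i \<in> \<sigma> ` {..<n}" using that by blast
    then show ?thesis by blast
  qed
  let ?P = "PiM {..<n} (\<lambda>_. \<mu>)"
  let ?U = "{x \<in> space ?P. \<forall>a<n. \<forall>b<n. a < b \<longrightarrow> x a < x b}"
  let ?V = "{x \<in> space ?P. \<forall>a<n. \<forall>b<n. a < b \<longrightarrow> x (\<sigma> a) < x (\<sigma> b)}"
  let ?T = "\<lambda>\<omega>. \<lambda>i\<in>{..<n}. X i \<omega>" and ?R = "\<lambda>x. \<lambda>a\<in>{..<n}. x (\<sigma> a)"
  have c: "(\<lambda>x. x a) \<in> borel_measurable ?P" if "a < n" for a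
    using measurable_component_singleton[of a "{..<n}" "\<lambda>_. \<mu>"] that by (simp cong: measurable_cong_sets)
  have meas: "{x \<in> space ?P. \<forall>a\<in>{..<n}. \<forall>b\<in>{..<n}. a < b \<longrightarrow> x (f a) < x (f b)} \<in> sets ?P"
    if "\<And>a. a < n \<Longrightarrow> f a < n" for f
  proof (intro sets.sets_Collect_finite_All' sets.sets_Collect_finite_All)
    fix a b assume ab: "a \<in> {..<n}" "b \<in> {..<n}"
    show "{x \<in> space ?P. a < b \<longrightarrow> x (f a) < x (f b)} \<in> sets ?P"
    proof (cases "a < b")
      case True
      then show ?thesis using borel_measurable_less[OF c[of "f a"] c[of "f b"]] that ab by simp
    qed simp
  qed (use n in auto)
  have U: "?U \<in> sets ?P" using meas[of "\<lambda>a. a"] by (simp add: Ball_def)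
  have V: "?V \<in> sets ?P" using meas[of \<sigma>] \<sigma> by (simp add: Ball_def)
  have sp: "sets ?P = sets (PiM {..<n} (\<lambda>_. borel))" by (intro sets_PiM_cong) auto
  have T: "?T \<in> M \<rightarrow>\<^sub>M PiM {..<n} (\<lambda>_. borel)" by (intro measurable_restrict measurable_X)
  have pe: "pattern_event M X ys = ?T -` ?V \<inter> space M"
  proof -
    have "(\<forall>i<n. \<forall>j<n. ys ! i < ys ! j \<longrightarrow> X i \<omega> < X j \<omega>) \<longleftrightarrow> (\<forall>a<n. \<forall>b<n. a < b \<longrightarrow> X (\<sigma> a) \<omega> < X (\<sigma> b) \<omega>)" for \<omega>
    proof
      assume L: "\<forall>i<n. \<forall>j<n. ys ! i < ys ! j \<longrightarrow> X i \<omega> < X j \<omega>"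
      show "\<forall>a<n. \<forall>b<n. a < b \<longrightarrow> X (\<sigma> a) \<omega> < X (\<sigma> b) \<omega>" using L \<sigma> by simp
    next
      assume R: "\<forall>a<n. \<forall>b<n. a < b \<longrightarrow> X (\<sigma> a) \<omega> < X (\<sigma> b) \<omega>"
      show "\<forall>i<n. \<forall>j<n. ys ! i < ys ! j \<longrightarrow> X i \<omega> < X j \<omega>"
      proof (intro allI impI)
        fix i j assume ij: "i < n" "j < n" "ys ! i < ys ! j"
        obtain a b where ab: "a < n" "i = \<sigma> a" "b < n" "j = \<sigma> b" using surj ij by blast
        then have "a < b" using ij(3) \<sigma> by simp
        then show "X i \<omega> < X j \<omega>" using R ab by simp
      qed
    qed
    then have "pattern_event M X ys = {\<omega> \<in> space M. \<forall>a<n. \<forall>b<n. a < b \<longrightarrow> X (\<sigma> a) \<omega> < X (\<sigma> b) \<omega>}"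
      by (simp only: pattern_event_def l)
    also have "\<dots> = ?T -` ?V \<inter> space M"
    proof -
      have "?T \<omega> \<in> space ?P" for \<omega> by (simp add: space_PiM)
      moreover have "(?T \<omega> (\<sigma> a) < ?T \<omega> (\<sigma> b)) = (X (\<sigma> a) \<omega> < X (\<sigma> b) \<omega>)" if "a < n" "b < n" for a b \<omega>
        using \<sigma>[OF that(1)] \<sigma>[OF that(2)] by simp
      ultimately show ?thesis by blast
    qed
    finally show ?thesis .
  qed
  have "emeasure M (pattern_event M X ys) = emeasure (distr M (PiM {..<n} (\<lambda>_. borel)) ?T) ?V"
    unfolding pe by (rule emeasure_distr[OF T, symmetric]) (rule V[unfolded sp])
  also have "distr M (PiM {..<n} (\<lambda>_. borel)) ?T = ?P" using n by (intro joint_law) blast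
  also have "emeasure ?P ?V = emeasure (distr ?P ?P ?R) ?U"
  proof -
    have R: "?R \<in> ?P \<rightarrow>\<^sub>M ?P" using \<sigma> by (intro measurable_restrict measurable_component_singleton) blast
    have "?R -` ?U \<inter> space ?P = ?V"
    proof -
      have "?R x \<in> space ?P" for x by (simp add: space_PiM)
      moreover have "(?R x a < ?R x b) = (x (\<sigma> a) < x (\<sigma> b))" if "a < n" "b < n" for a b x
        using that by simp
      ultimately show ?thesis by blast
    qed
    then show ?thesis using emeasure_distr[OF R U] by (simp only:)
  qed
  also have "distr ?P ?P ?R = ?P"
  proof (rule distr_PiM_reindex[where M = "\<lambda>_. \<mu>" and f = \<sigma> and K = "{..<n}" and I = "{..<n}"])
    show "\<sigma> \<in> {..<n} \<rightarrow> {..<n}" using \<sigma> by blast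
  qed (rule \<mu>.prob_space_axioms inj)+
  finally show ?thesis .
qed

lemma AE_pattern:
  "AE \<omega> in M. \<omega> \<in> (\<Union>ys\<in>permutations_of_set (real ` {..<n}). pattern_event M X ys)"
  using AE_inj AE_space
proof eventually_elim
  case (elim \<omega>)
  have "inj_on (\<lambda>i. X i \<omega>) {..<n}" using elim(1) by (rule inj_on_subset) auto
  then obtain ys where "ys \<in> permutations_of_set (real ` {..<n})" "\<omega> \<in> pattern_event M X ys"
    by (rule pattern_exists[where \<phi> = "\<lambda>_. True" and M = M]) (simp_all add: elim(2) order_invariant_def)
  then show ?case by blast
qed

lemma disjoint_pattern_event:
  "Y \<subseteq> permutations_of_set (real ` {..<n}) \<Longrightarrow> disjoint_family_on (pattern_event M X) Y"
  unfolding disjoint_family_on_def using pattern_event_unique[of _ n _ _ M X] by blast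

text \<open>There are n! disjoint events of equal measure, and together they cover almost
  everything.\<close>

lemma measure_pattern_event:
  assumes ys: "ys \<in> permutations_of_set (real ` {..<n})" and n: "n > 0"
  shows "measure M (pattern_event M X ys) = 1 / fact n"
proof -
  let ?Y = "permutations_of_set (real ` {..<n})"
  define p where "p = measure M (pattern_event M X ys)"
  have p: "measure M (pattern_event M X zs) = p" if "zs \<in> ?Y" for zs
    unfolding p_def measure_def emeasure_pattern_event_eq[OF ys n] emeasure_pattern_event_eq[OF that n] ..
  have "measure M (\<Union>zs\<in>?Y. pattern_event M X zs) = (\<Sum>zs\<in>?Y. measure M (pattern_event M X zs))"
    using disjoint_pattern_event[OF order_refl] by (intro finite_measure_finite_Union) auto
  also have "\<dots> = fact n * p" using p by (simp add: card_image)
  finally have *: "measure M (\<Union>zs\<in>?Y. pattern_event M X zs) = fact n * p" .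
  have "(\<Union>zs\<in>?Y. pattern_event M X zs) \<in> sets M" by (intro sets.finite_UN) (auto simp: sets_pattern_event)
  then have "fact n * p = 1" using AE_pattern[of n] prob_eq_1[of "\<Union>zs\<in>?Y. pattern_event M X zs"] * by simp
  then show ?thesis unfolding p_def by (simp add: field_simps)
qed

text \<open>Borel-Cantelli: up to a null set the event is a union of pattern events, so its
  probability is the average of \<phi> over permutations.\<close>

lemma AE_eventually_not:
  fixes \<phi> :: "real list \<Rightarrow> bool" and n :: "nat \<Rightarrow> nat"
  assumes \<phi>: "order_invariant \<phi>" and n: "\<And>i. n i > 0"
    and s: "summable (\<lambda>i. avg (n i) (\<lambda>xs. of_bool (\<phi> xs)))"
  shows "AE \<omega> in M. eventually (\<lambda>i. \<not> \<phi> (map (\<lambda>k. X k \<omega>) [0..<n i])) sequentially"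
proof -
  define Y where "Y i = {ys \<in> permutations_of_set (real ` {..<n i}). \<phi> ys}" for i
  define A where "A i = (\<Union>ys\<in>Y i. pattern_event M X ys)" for i
  have fin: "finite (Y i)" for i by (simp add: Y_def)
  have A: "A i \<in> sets M" for i unfolding A_def using fin by auto
  have "measure M (A i) = avg (n i) (\<lambda>xs. of_bool (\<phi> xs))" for i
  proof -
    have "measure M (A i) = (\<Sum>ys\<in>Y i. measure M (pattern_event M X ys))"
      unfolding A_def using disjoint_pattern_event[of "Y i" "n i"] fin
      by (intro finite_measure_finite_Union) (auto simp: Y_def)
    also have "\<dots> = (\<Sum>ys\<in>Y i. 1 / fact (n i))"
      using measure_pattern_event n by (intro sum.cong) (auto simp: Y_def)
    also have "\<dots> = avg (n i) (\<lambda>xs. of_bool (\<phi> xs))"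
    proof -
      have "(\<Sum>ys\<in>permutations_of_set (real ` {..<n i}). of_bool (\<phi> ys) :: real) = real (card (Y i))"
        unfolding Y_def of_bool_def by (subst sum.inter_filter[symmetric]) simp_all
      then show ?thesis unfolding avg_def perm_avg_def by (simp add: card_image)
    qed
    finally show ?thesis .
  qed
  then have "summable (\<lambda>i. measure M (A i))" using s by simp
  then have "AE \<omega> in M. eventually (\<lambda>i. \<omega> \<in> space M - A i) sequentially"
    using A by (intro borel_cantelli_AE1) (auto simp: emeasure_eq_measure)
  with AE_inj AE_space show ?thesis
  proof eventually_elim
    case (elim \<omega>)
    show ?case using elim(3)
    proof (rule eventually_mono)
      fix i assume i: "\<omega> \<in> space M - A i"
      have "inj_on (\<lambda>k. X k \<omega>) {..<n i}" using elim(1) by (rule inj_on_subset) auto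
      then obtain ys where ys: "ys \<in> permutations_of_set (real ` {..<n i})" "\<omega> \<in> pattern_event M X ys"
        "\<phi> (map (\<lambda>k. X k \<omega>) [0..<n i]) = \<phi> ys" using pattern_exists[OF _ elim(2) \<phi>] by blast
      then show "\<not> \<phi> (map (\<lambda>k. X k \<omega>) [0..<n i])" using i unfolding A_def Y_def by auto
    qed
  qed
qed

end

section \<open>Almost sure convergence\<close>

text \<open>Between consecutive points of the subsequence, monotonicity yields bounds that are off
  by the factor \<open>?R\<close>. It tends to 1 because the points grow polynomially; along a
  geometric sequence it would not.\<close>

lemma mono_tendsto_interpolate:
  fixes f :: "nat \<Rightarrow> real"
  assumes mono: "mono f" and nonneg: "\<And>n. 0 \<le> f n" and q: "q \<ge> 1"
    and lim: "(\<lambda>i. f (Suc i ^ q) / (real (Suc i ^ q) + 1)) \<longlonglongrightarrow> c"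
  shows "(\<lambda>n. f n / (real n + 1)) \<longlonglongrightarrow> c"
proof -
  let ?n = "\<lambda>i. Suc i ^ q"
  let ?R = "\<lambda>i. (real (?n (Suc i)) + 1) / (real (?n i) + 1)"
  have R: "?R \<longlonglongrightarrow> 1"
  proof (rule tendsto_sandwich)
    have n: "?n i \<le> ?n (Suc i)" for i by (rule power_mono) auto
    show "eventually (\<lambda>i. 1 \<le> ?R i) sequentially"
    proof (intro always_eventually allI)
      fix i
      have "real (?n i) + 1 \<le> real (?n (Suc i)) + 1" by (intro add_right_mono of_nat_mono n)
      moreover have "0 < real (?n i) + 1" by linarith
      ultimately show "1 \<le> ?R i" by (simp only: le_divide_eq_1_pos)
    qed
    have "?R i \<le> (real (Suc (Suc i)) / real (Suc i)) ^ q" for i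
    proof -
      have "(y + 1) / (x + 1) \<le> y / x" if "0 < x" "x \<le> y" for x y :: real
        using that by (simp add: field_simps)
      from this[of "real (?n i)" "real (?n (Suc i))"] have "?R i \<le> real (?n (Suc i)) / real (?n i)"
        using of_nat_mono[OF n[of i], where 'a = real] by simp
      then show ?thesis by (simp only: of_nat_power power_divide)
    qed
    then show "eventually (\<lambda>i. ?R i \<le> (real (Suc (Suc i)) / real (Suc i)) ^ q) sequentially"
      by (intro always_eventually allI)
    have "(\<lambda>i. real (Suc (Suc i)) / real (Suc i)) \<longlonglongrightarrow> 1" by real_asymp
    from tendsto_power[OF this, of q] show "(\<lambda>i. (real (Suc (Suc i)) / real (Suc i)) ^ q) \<longlonglongrightarrow> 1" by simp
  qed simp
  \<comment> \<open>The largest i with (Suc i)^q <= n, meaningful for n >= 1.\<close>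
  define r where "r n = Max {i. ?n i \<le> n}" for n
  have le: "i \<le> ?n i" for i
    using self_le_power[of "Suc i" q] q by linarith
  have fin: "finite {i. ?n i \<le> n}" for n
    by (rule finite_subset[of _ "{..n}"]) (use le order_trans in blast)+
  have r: "?n (r n) \<le> n" "n \<le> ?n (Suc (r n))" if "n \<ge> 1" for n
  proof -
    have "{i. ?n i \<le> n} \<noteq> {}" using that by (auto intro: exI[of _ 0])
    from Max_in[OF fin this] show "?n (r n) \<le> n" by (simp add: r_def)
    have "\<not> ?n (Suc (r n)) \<le> n"
    proof
      assume "?n (Suc (r n)) \<le> n"
      then have "Suc (r n) \<le> r n" unfolding r_def by (intro Max_ge[OF fin]) simp
      then show False by simp
    qed
    then show "n \<le> ?n (Suc (r n))" by simp
  qed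
  have "filterlim r at_top sequentially"
    unfolding filterlim_at_top
  proof
    fix K
    have "K \<le> r n" if "n \<ge> ?n K" for n
      unfolding r_def using that by (intro Max_ge[OF fin]) simp
    then show "eventually (\<lambda>n. K \<le> r n) sequentially" by (rule eventually_sequentiallyI)
  qed
  note r_top = this
  let ?g = "\<lambda>i. f (?n i) / (real (?n i) + 1)"
  have up: "(\<lambda>i. ?g (Suc i) * ?R i) \<longlonglongrightarrow> c * 1"
    by (intro tendsto_mult R filterlim_compose[OF lim filterlim_Suc])
  have low: "(\<lambda>i. ?g i / ?R i) \<longlonglongrightarrow> c / 1"
    by (intro tendsto_divide R lim) simp
  show ?thesis
  proof (rule tendsto_sandwich)
    show "(\<lambda>n. ?g (r n) / ?R (r n)) \<longlonglongrightarrow> c" using filterlim_compose[OF low r_top] by simp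
    show "(\<lambda>n. ?g (Suc (r n)) * ?R (r n)) \<longlonglongrightarrow> c" using filterlim_compose[OF up r_top] by simp
    have cancel: "y / b / (a / b) = y / a" "y / a * (a / b) = y / b" if "a > 0" "b > 0" for y a b :: real
      using that by (simp_all add: field_simps)
    have pos: "real k + 1 > 0" for k by simp
    have bounds: "?g (r n) / ?R (r n) \<le> f n / (real n + 1) \<and> f n / (real n + 1) \<le>
      ?g (Suc (r n)) * ?R (r n)" if "n \<ge> 1" for n
      unfolding cancel[OF pos pos] using r[OF that] mono nonneg
      by (intro conjI frac_le monoD[OF mono]) (simp_all del: power_Suc of_nat_power)
    show "eventually (\<lambda>n. ?g (r n) / ?R (r n) \<le> f n / (real n + 1)) sequentially"
      "eventually (\<lambda>n. f n / (real n + 1) \<le> ?g (Suc (r n)) * ?R (r n)) sequentially"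
      using bounds by (auto simp only: intro!: eventually_sequentiallyI[of 1])
  qed
qed

lemma tree_functional_card:
  assumes m: "m \<ge> 2"
  shows "tree_functional m True (\<lambda>xs. real (card (shape m xs)))"
  by unfold_locales (use m in \<open>simp_all add: shape_short card_shape_rec\<close>)

lemma tree_functional_n_mc:
  assumes m: "m \<ge> 2"
  shows "tree_functional m False (\<lambda>xs. real (n_mc m path_child (shape m xs)))"
proof unfold_locales
  fix xs :: "real list" assume "m - 1 \<le> length xs"
  then show "real (n_mc m path_child (shape m xs)) =
      (if False \<or> full m xs then of_bool False + (\<Sum>i=1..m. real (n_mc m path_child (shape m (subkeys m xs
        i)))) else 1)"
    unfolding n_mc_shape_rec[OF m \<open>m - 1 \<le> length xs\<close>] full_def by simp
qed (use m in \<open>simp_all add: shape_short n_mc_singleton n_mc_def[of _ _ "{}"]\<close>)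

lemma (in iid_continuous) tree_functional_AE:
  assumes "tree_functional m b F"
  shows "AE \<omega> in M. (\<lambda>n. F (map (\<lambda>k. X k \<omega>) [0..<n]) / (real n + 1)) \<longlonglongrightarrow> tree_functional.rate m F"
proof -
  interpret T: tree_functional m b F by fact
  obtain q where q: "q \<ge> 1" "\<And>\<epsilon>. 0 < \<epsilon> \<Longrightarrow> summable (\<lambda>i. avg (Suc i ^ q) (\<lambda>xs. of_bool (T.far \<epsilon> xs)))"
    by (rule T.summable_far) blast
  let ?xs = "\<lambda>\<omega> n. map (\<lambda>k. X k \<omega>) [0..<n]"
  \<comment> \<open>Countably many tolerances, so that the exceptional null sets can be
    united.\<close>
  have "AE \<omega> in M. \<forall>N. eventually (\<lambda>i. \<not> T.far (1 / real (Suc N)) (?xs \<omega> (Suc i ^ q))) sequentially"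
    unfolding AE_all_countable by (intro allI AE_eventually_not T.order_invariant_far q(2)) simp_all
  then show ?thesis
  proof eventually_elim
    case (elim \<omega>)
    let ?f = "\<lambda>n. F (?xs \<omega> n)"
    show ?case
    proof (rule mono_tendsto_interpolate[OF _ _ q(1)])
      show "mono ?f"
        using T.F_append_mono by (auto simp: mono_iff_le_Suc)
      show "0 \<le> ?f n" for n using T.F_bounds by blast
      show "(\<lambda>i. ?f (Suc i ^ q) / (real (Suc i ^ q) + 1)) \<longlonglongrightarrow> T.rate"
      proof (rule LIMSEQ_I)
        fix e :: real assume e: "0 < e"
        obtain N where N: "3 / e < real (Suc N)"
          using reals_Archimedean2[of "3 / e"] by (meson less_trans lessI of_nat_less_iff)
        have "norm (?f n / (real n + 1) - T.rate) < e" if "\<not> T.far (1 / real (Suc N)) (?xs \<omega> n)" for n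
        proof -
          have "\<bar>?f n - T.rate * (real n + 1)\<bar> \<le> 3 / real (Suc N) * (real n + 1)"
            using that unfolding T.far_def by simp
          moreover have "?f n / (real n + 1) - T.rate = (?f n - T.rate * (real n + 1)) / (real n + 1)"
            by (simp add: field_simps)
          ultimately have "\<bar>?f n / (real n + 1) - T.rate\<bar> \<le> 3 / real (Suc N)"
            by (simp only: abs_divide) (simp add: pos_divide_le_eq)
          also have "3 / real (Suc N) < e" using N e by (simp add: field_simps)
          finally show ?thesis by simp
        qed
        note close = this
        have "eventually (\<lambda>i. norm (?f (Suc i ^ q) / (real (Suc i ^ q) + 1) - T.rate) < e) sequentially"
          by (rule eventually_mono[OF elim[rule_format, of N]]) (rule close)
        then show "\<exists>no. \<forall>i\<ge>no. norm (?f (Suc i ^ q) / (real (Suc i ^ q) + 1) - T.rate) < e"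
          unfolding eventually_sequentially .
      qed
    qed
  qed
qed

theorem theorem11p2:
  fixes m :: nat and M :: "'a measure" and X :: "nat \<Rightarrow> 'a \<Rightarrow> real" and \<mu> :: "real measure"
  assumes "m \<ge> 2"
    and "prob_space M"
    and "prob_space.indep_vars M (\<lambda>_. borel) X UNIV"
    and "\<And>i. distr M borel (X i) = \<mu>"
    and "continuous_on UNIV (cdf \<mu>)"
  shows "AE \<omega> in M.
    (\<lambda>n. let T = search_tree m (\<lambda>i. X i \<omega>) n in
           real (n_mc m path_child T) / real (card T))
      \<longlonglongrightarrow> P_mc m"
proof -
  interpret prob_space M by fact
  interpret iid_continuous M X \<mu> by unfold_locales fact+
  let ?h = "total_exit m" and ?s = "\<lambda>\<omega> n. shape m (map (\<lambda>k. X k \<omega>) [0..<n])"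
  note T = tree_functional_card[OF \<open>m \<ge> 2\<close>] tree_functional_n_mc[OF \<open>m \<ge> 2\<close>]
  have h: "?h > 0" by (rule total_exit_pos) fact
  have "AE \<omega> in M. (\<lambda>n. real (card (?s \<omega> n)) / (real n + 1)) \<longlonglongrightarrow> 1 / ?h"
    using tree_functional_AE[OF T(1)] unfolding tree_functional.rate_True[OF T(1) TrueI] .
  moreover have "AE \<omega> in M. (\<lambda>n. real (n_mc m path_child (?s \<omega> n)) / (real n + 1)) \<longlonglongrightarrow> P_mc m / ?h"
    using tree_functional_AE[OF T(2)] unfolding tree_functional.rate_False[OF T(2) not_False_eq_True[THEN
      iffD2, OF TrueI]] .
  ultimately show ?thesis
  proof eventually_elim
    case (elim \<omega>)
    \<comment> \<open>The normalisation n + 1 and the denominator \<open>total_exit m\<close> of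
      both rates cancel in the quotient.\<close>
    have "(\<lambda>n. (real (n_mc m path_child (?s \<omega> n)) / (real n + 1)) / (real (card (?s \<omega> n)) / (real n + 1)))
        \<longlonglongrightarrow> (P_mc m / ?h) / (1 / ?h)"
      using h by (intro tendsto_divide[OF elim(2) elim(1)]) simp
    moreover have "x / (real n + 1) / (y / (real n + 1)) = x / y" for x y :: real and n by simp
    ultimately show ?case using h by (simp add: Let_def search_tree_eq_shape)
  qed
qed

end
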